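(* Let $\mathcal{E}$ be a formally integrable system of PDEs in $n$ independent variables, of pure first order, whose symbolic system $g=\{g_k\}_{k\ge 0}$, $g_k\subset S^kT^*\otimes N$ ($\dim T=n$), is involutive. Let $h^{0,i}=\dim H^{0,i}(g)$ denote the dimensions of its Spencer $\delta$-cohomology groups. If $\operatorname{codim}\operatorname{Char}^{\mathbb{C}}(\mathcal{E})=n-p$ (codimension in $\mathbb{P}^{\mathbb{C}}T^*$), then the functional rank $\sigma$ of the system equals $$\sigma=\sum_{i}(-1)^i\,h^{0,i}\,\frac{(-i)^{n-p}}{(n-p)!},$$ where $i$ runs over $0\le i\le n$ and $0^0=1$.
   Context: Symbolic systems. $T$ and $N$ are finite-dimensional real vector spaces, $\dim T=n$, $\dim N=m$ (for a PDE system: $T$ is the tangent space to the space of independent variables, $N$ that of the dependent variables). $\delta:S^kT^*\otimes N\otimes\Lambda^jT^*\to S^{k-1}T^*\otimes N\otimes\Lambda^{j+1}T^*$ is the de Rham differential of $N$-valued polynomial differential forms on $T$ (with $S^iT^*=0$ for $i<0$), and $\delta_v=i_v\circ\delta:S^{k+1}T^*\otimes N\to S^kT^*\otimes N$ is differentiation along $v\in T$. The $l$-th prolongation of $h\subset S^kT^*\otimes N$ is $h^{(l)}=\{q\in S^{k+l}T^*\otimes N: \delta_{v_1}\cdots\delta_{v_l}q\in h\ \ \forall v_1,\dots,v_l\in T\}$. A symbolic system is a sequence of subspaces $g_k\subset S^kT^*\otimes N$, $k\ge0$, with $g_0=N$ and $g_k\subset g_{k-1}^{(1)}$. Its set of orders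 is $\operatorname{ord}(g)=\{k: g_k\ne g_{k-1}^{(1)}\}$; it is of pure first order if $\operatorname{ord}(g)=\{1\}$, i.e. $g_k=g_1^{(k-1)}$ for $k\ge1$ and $g_1\neq T^*\otimes N$. Spencer cohomology. $H^{i,j}(g)$ is the cohomology at the term $g_i\otimes\Lambda^jT^*$ of the Spencer complex $$0\to g_k\xrightarrow{\delta}g_{k-1}\otimes T^*\xrightarrow{\delta}g_{k-2}\otimes\Lambda^2T^*\to\cdots\to g_{k-n}\otimes\Lambda^nT^*\to0,\qquad k=i+j$$ (with $g_i=0$ for $i<0$). Involutivity. For an integer $k$ let $g^{|k\rangle}_i=S^iT^*\otimes N$ for $i<k$ and $g^{|k\rangle}_i=g_k^{(i-k)}$ for $i\ge k$. The system $g$ is involutive (all $g_k$ are involutive in the sense of Cartan) iff $H^{i,j}(g^{|k\rangle})=0$ for all $i\ge k$, all $j$, and all $k\in\operatorname{ord}(g)$. For a system of pure first order this says $H^{i,j}(g)=0$ for all $i\ge1$ and all $j$. PDE systems. The symbolic system $g$ of a PDE system $\mathcal{E}$ (at a point of the equation) consists of the symbol spaces $g_k$, the kernels of the (differentials of the) projections $\mathcal{E}_k\to\mathcal{E}_{k-1}$ of the equation and its prolongations in jet spaces. It is assumed that the type of $g$ does not vary from point to point (the dimensions of $g_k$, of the characteristic variety and of the fibres of the characteristic sheaf are constant). Characteristic variety. $g^*=\bigoplus_i g_i^*$ is a graded module over the symmetric algebra $ST=\bigoplus_i S^iT$ (dualizing the maps $\delta_v$), finitely generated. $\operatorname{Char}^{\mathbb{C}}(\mathcal{E})=\operatorname{Char}^{\mathbb{C}}(g)\subset\mathbb{P}^{\mathbb{C}}T^*$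 is the support of its complexification, the projective zero locus of $\operatorname{Ann}(g^* )\subset ST$. The empty variety has dimension $-1$, so codimension $n$ in $\mathbb{P}^{\mathbb{C}}T^*$. Functional dimension and rank. For large $k$ the sum $\sum_{i\le k}\dim g_i$ coincides with a polynomial $P_{\mathcal{E}}(k)$, the Hilbert polynomial of $g^*$. The functional dimension is $p=\deg P_{\mathcal{E}}$ (one has $p=\dim\operatorname{Char}^{\mathbb{C}}(\mathcal{E})+1$), and the functional rank is $\sigma=P_{\mathcal{E}}^{(p)}$ (the $p$-th derivative, a constant), i.e. $P_{\mathcal{E}}(z)=\sigma\,z^p/p!+\text{lower order terms}$. *)

theory Defs
  imports
    "HOL-Analysis.Analysis"
    "HOL-Library.Function_Algebras"
    "HOL-Library.Poly_Mapping"
    "HOL-Computational_Algebra.Polynomial"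
begin

text \<open>
  Conventions: \<open>T = real^'n\<close> and \<open>N = real^'m\<close>, so that \<open>n = CARD('n)\<close> and \<open>m = CARD('m)\<close>.
  An element of \<open>S\<^sup>kT\<^sup>* \<otimes> N\<close> is a homogeneous polynomial map \<open>T \<rightarrow> N\<close> of degree \<open>k\<close>, and
  \<open>ST\<close> is the polynomial ring in the standard basis of \<open>T\<close>.  Graded pieces of negative degree are
  zero and are not represented.
\<close>

text \<open>Pointwise vector space structure on functions; iterated, it also covers polynomial forms.\<close>

instantiation "fun" :: (type, real_vector) real_vector
begin

definition scaleR_fun :: "real \<Rightarrow> ('a \<Rightarrow> 'b) \<Rightarrow> 'a \<Rightarrow> 'b" where
  "scaleR_fun c f = (\<lambda>x. c *\<^sub>R f x)"

instance
  by standard (auto simp: scaleR_fun_def fun_eq_iff scaleR_add_right scaleR_add_left)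

end


section \<open>Symbolic systems\<close>

definition mdeg :: "('n::finite \<Rightarrow>\<^sub>0 nat) \<Rightarrow> nat" where
  "mdeg \<alpha> = (\<Sum>i\<in>UNIV. Poly_Mapping.lookup \<alpha> i)"

definition monom_eval :: "'a::comm_monoid_mult ^ 'n \<Rightarrow> ('n::finite \<Rightarrow>\<^sub>0 nat) \<Rightarrow> 'a" where
  "monom_eval x \<alpha> = (\<Prod>i\<in>UNIV. (x $ i) ^ Poly_Mapping.lookup \<alpha> i)"

definition sym_maps :: "nat \<Rightarrow> (real^'n \<Rightarrow> real^'m) set" where
  "sym_maps k = {q. \<exists>c. q = (\<lambda>x. \<Sum>\<alpha> | mdeg \<alpha> = k. monom_eval x \<alpha> *\<^sub>R c \<alpha>)}"

definition dir_deriv :: "real^'n \<Rightarrow> (real^'n \<Rightarrow> real^'m) \<Rightarrow> real^'n \<Rightarrow> real^'m" where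
  "dir_deriv v q = (\<lambda>x. frechet_derivative q (at x) v)"

definition prolong ::
    "nat \<Rightarrow> (real^'n \<Rightarrow> real^'m) set \<Rightarrow> nat \<Rightarrow> (real^'n \<Rightarrow> real^'m) set" where
  "prolong k h l = {q \<in> sym_maps (k + l). \<forall>vs. length vs = l \<longrightarrow> foldr dir_deriv vs q \<in> h}"

definition symbolic_system :: "(nat \<Rightarrow> (real^'n \<Rightarrow> real^'m) set) \<Rightarrow> bool" where
  "symbolic_system g \<longleftrightarrow>
     (\<forall>k. subspace (g k) \<and> g k \<subseteq> sym_maps k) \<and>
     g 0 = sym_maps 0 \<and>
     (\<forall>k. g (Suc k) \<subseteq> prolong k (g k) 1)"

text \<open>The order \<open>0\<close> never occurs, since \<open>g\<^sub>0 = N\<close> is the prolongation of \<open>g\<^sub>-\<^sub>1 = 0\<close>.\<close>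

definition orders :: "(nat \<Rightarrow> (real^'n \<Rightarrow> real^'m) set) \<Rightarrow> nat set" where
  "orders g = {Suc k | k. g (Suc k) \<noteq> prolong k (g k) 1}"

definition pure_first_order :: "(nat \<Rightarrow> (real^'n \<Rightarrow> real^'m) set) \<Rightarrow> bool" where
  "pure_first_order g \<longleftrightarrow> orders g = {1}"


section \<open>Spencer cohomology\<close>

text \<open>
  An element of \<open>V \<otimes> \<Lambda>\<^sup>jT\<^sup>*\<close>, for a space \<open>V\<close> of polynomial maps, is an alternating \<open>j\<close>-linear
  map from \<open>T\<close> to \<open>V\<close>.  Its arguments are collected in a list; the value on lists of any length
  other than \<open>j\<close> is fixed to be \<open>0\<close>.
\<close>

definition forms ::
    "nat \<Rightarrow> (real^'n \<Rightarrow> real^'m) set \<Rightarrow> ((real^'n) list \<Rightarrow> real^'n \<Rightarrow> real^'m) set" where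
  "forms j V = {\<omega>.
     (\<forall>vs. length vs \<noteq> j \<longrightarrow> \<omega> vs = 0) \<and>
     (\<forall>vs. length vs = j \<longrightarrow> \<omega> vs \<in> V) \<and>
     (\<forall>vs i. length vs = j \<and> i < j \<longrightarrow> linear (\<lambda>v. \<omega> (vs[i := v]))) \<and>
     (\<forall>vs. length vs = j \<and> \<not> distinct vs \<longrightarrow> \<omega> vs = 0)}"

text \<open>The de Rham differential in its invariant form, evaluated on constant vector fields.\<close>

definition spencer_d ::
    "((real^'n) list \<Rightarrow> real^'n \<Rightarrow> real^'m) \<Rightarrow> (real^'n) list \<Rightarrow> real^'n \<Rightarrow> real^'m" where
  "spencer_d \<omega> vs =
     (\<Sum>l<length vs. (-1) ^ l *\<^sub>R dir_deriv (vs ! l) (\<omega> (take l vs @ drop (Suc l) vs)))"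

definition spencer_cocycles ::
    "(nat \<Rightarrow> (real^'n \<Rightarrow> real^'m) set) \<Rightarrow> nat \<Rightarrow> nat
      \<Rightarrow> ((real^'n) list \<Rightarrow> real^'n \<Rightarrow> real^'m) set" where
  "spencer_cocycles g i j = {\<omega> \<in> forms j (g i). spencer_d \<omega> = 0}"

definition spencer_coboundaries ::
    "(nat \<Rightarrow> (real^'n \<Rightarrow> real^'m) set) \<Rightarrow> nat \<Rightarrow> nat
      \<Rightarrow> ((real^'n) list \<Rightarrow> real^'n \<Rightarrow> real^'m) set" where
  "spencer_coboundaries g i j =
     (case j of 0 \<Rightarrow> {0} | Suc j' \<Rightarrow> spencer_d ` forms j' (g (Suc i)))"

definition spencer_vanishes ::
    "(nat \<Rightarrow> (real^'n \<Rightarrow> real^'m) set) \<Rightarrow> nat \<Rightarrow> nat \<Rightarrow> bool" where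
  "spencer_vanishes g i j \<longleftrightarrow> spencer_cocycles g i j = spencer_coboundaries g i j"

text \<open>
  For a symbolic system both spaces are finite-dimensional and the coboundaries are contained in
  the cocycles, so the truncated subtraction is the dimension of the quotient.
\<close>

definition spencer_dim ::
    "(nat \<Rightarrow> (real^'n \<Rightarrow> real^'m) set) \<Rightarrow> nat \<Rightarrow> nat \<Rightarrow> nat" where
  "spencer_dim g i j = dim (spencer_cocycles g i j) - dim (spencer_coboundaries g i j)"

definition generated_from ::
    "nat \<Rightarrow> (nat \<Rightarrow> (real^'n \<Rightarrow> real^'m) set) \<Rightarrow> nat \<Rightarrow> (real^'n \<Rightarrow> real^'m) set" where
  "generated_from k g i = (if i < k then sym_maps i else prolong k (g k) (i - k))"

definition involutive :: "(nat \<Rightarrow> (real^'n \<Rightarrow> real^'m) set) \<Rightarrow> bool" where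
  "involutive g \<longleftrightarrow>
     (\<forall>k\<in>orders g. \<forall>i\<ge>k. \<forall>j. spencer_vanishes (generated_from k g) i j)"


section \<open>The characteristic variety\<close>

text \<open>
  The variable \<open>i\<close> of the polynomial ring is the basis vector \<open>axis i 1\<close> of \<open>T\<close>, acting as
  differentiation along it.  Partial derivatives of polynomial maps commute, so the ordering chosen
  by \<open>SOME\<close> is irrelevant.
\<close>

definition partial_deriv ::
    "('n \<Rightarrow>\<^sub>0 nat) \<Rightarrow> (real^'n \<Rightarrow> real^'m) \<Rightarrow> real^'n \<Rightarrow> real^'m" where
  "partial_deriv \<alpha> q =
     foldr (\<lambda>i. dir_deriv (axis i 1))
       (SOME is. \<forall>i. count_list is i = Poly_Mapping.lookup \<alpha> i) q"

definition diff_op ::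
    "(('n \<Rightarrow>\<^sub>0 nat) \<Rightarrow>\<^sub>0 real) \<Rightarrow> (real^'n \<Rightarrow> real^'m) \<Rightarrow> real^'n \<Rightarrow> real^'m" where
  "diff_op f q =
     (\<Sum>\<alpha>\<in>Poly_Mapping.keys f. Poly_Mapping.lookup f \<alpha> *\<^sub>R partial_deriv \<alpha> q)"

text \<open>
  An element of \<open>g\<^sup>* = \<Oplus>\<^sub>i g\<^sub>i\<^sup>*\<close> is represented by a linear functional on all maps \<open>T \<rightarrow> N\<close> (every
  functional on the direct sum of the \<open>g\<^sub>i\<close> extends); two of them represent the same element iff
  they agree on all \<open>g\<^sub>i\<close>.  A polynomial \<open>f\<close> acts on \<open>g\<^sup>*\<close> by the transpose of \<open>diff_op f\<close>.
\<close>

definition graded_dual ::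
    "(nat \<Rightarrow> (real^'n \<Rightarrow> real^'m) set) \<Rightarrow> ((real^'n \<Rightarrow> real^'m) \<Rightarrow> real) set" where
  "graded_dual g = {\<phi>. linear \<phi> \<and> finite {i. \<exists>q\<in>g i. \<phi> q \<noteq> 0}}"

definition dual_act ::
    "(('n \<Rightarrow>\<^sub>0 nat) \<Rightarrow>\<^sub>0 real) \<Rightarrow> ((real^'n \<Rightarrow> real^'m) \<Rightarrow> real) \<Rightarrow> (real^'n \<Rightarrow> real^'m) \<Rightarrow> real"
    where
  "dual_act f \<phi> = (\<lambda>q. \<phi> (diff_op f q))"

definition annihilator ::
    "(nat \<Rightarrow> (real^'n \<Rightarrow> real^'m) set) \<Rightarrow> (('n \<Rightarrow>\<^sub>0 nat) \<Rightarrow>\<^sub>0 real) set" where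
  "annihilator g = {f. \<forall>\<phi>\<in>graded_dual g. \<forall>i. \<forall>q\<in>g i. dual_act f \<phi> q = 0}"

definition mpoly_eval ::
    "(('n::finite \<Rightarrow>\<^sub>0 nat) \<Rightarrow>\<^sub>0 complex) \<Rightarrow> complex^'n \<Rightarrow> complex" where
  "mpoly_eval f \<xi> = (\<Sum>\<alpha>\<in>Poly_Mapping.keys f. Poly_Mapping.lookup f \<alpha> * monom_eval \<xi> \<alpha>)"

definition mpoly_homogeneous :: "(('n::finite \<Rightarrow>\<^sub>0 nat) \<Rightarrow>\<^sub>0 complex) \<Rightarrow> bool" where
  "mpoly_homogeneous f \<longleftrightarrow> (\<exists>d. \<forall>\<alpha>\<in>Poly_Mapping.keys f. mdeg \<alpha> = d)"

text \<open>
  A point of the complex projective space of \<open>T\<^sup>*\<close> is a complex line in \<open>complex^'n\<close>, where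
  \<open>\<xi> $ i\<close> is the value of the covector \<open>\<xi>\<close> on the basis vector \<open>axis i 1\<close>.
\<close>

definition proj_points :: "(complex^'n) set set" where
  "proj_points = {vec.span {\<xi>} | \<xi>. \<xi> \<noteq> 0}"

definition zero_locus ::
    "(('n::finite \<Rightarrow>\<^sub>0 nat) \<Rightarrow>\<^sub>0 complex) set \<Rightarrow> (complex^'n) set set" where
  "zero_locus F = {L \<in> proj_points. \<forall>f\<in>F. \<forall>\<xi>\<in>L. mpoly_eval f \<xi> = 0}"

definition char_variety ::
    "(nat \<Rightarrow> (real^'n \<Rightarrow> real^'m) set) \<Rightarrow> (complex^'n) set set" where
  "char_variety g = zero_locus (Poly_Mapping.map complex_of_real ` annihilator g)"

definition zariski_closed :: "(complex^'n) set set \<Rightarrow> bool" where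
  "zariski_closed X \<longleftrightarrow> (\<exists>F. (\<forall>f\<in>F. mpoly_homogeneous f) \<and> X = zero_locus F)"

definition irreducible_closed :: "(complex^'n) set set \<Rightarrow> bool" where
  "irreducible_closed X \<longleftrightarrow> zariski_closed X \<and> X \<noteq> {} \<and>
     (\<forall>A B. zariski_closed A \<and> zariski_closed B \<and> X = A \<union> B \<longrightarrow> X = A \<or> X = B)"

text \<open>
  Krull dimension of a Zariski closed set; chain lengths are bounded by \<open>CARD('n) - 1\<close>, so the
  supremum over \<open>nat\<close> is a maximum.
\<close>

definition proj_dim :: "(complex^'n) set set \<Rightarrow> int" where
  "proj_dim X = (if X = {} then -1 else
     int (Sup {l. \<exists>C. (\<forall>i\<le>l. irreducible_closed (C i) \<and> C i \<subseteq> X) \<and>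
                      (\<forall>i<l. C i \<subset> C (Suc i))}))"

definition proj_codim :: "(complex^'n) set set \<Rightarrow> int" where
  "proj_codim X = (int CARD('n) - 1) - proj_dim X"


section \<open>Functional dimension and rank\<close>

definition hilbert_poly :: "(nat \<Rightarrow> (real^'n \<Rightarrow> real^'m) set) \<Rightarrow> real poly" where
  "hilbert_poly g =
     (THE P. \<forall>\<^sub>F k in sequentially. poly P (real k) = (\<Sum>i\<le>k. real (dim (g i))))"

definition functional_dim :: "(nat \<Rightarrow> (real^'n \<Rightarrow> real^'m) set) \<Rightarrow> nat" where
  "functional_dim g = degree (hilbert_poly g)"

text \<open>The derivative of order \<open>functional_dim g\<close> is a constant polynomial; \<open>0\<close> is an arbitrary point.\<close>

definition functional_rank :: "(nat \<Rightarrow> (real^'n \<Rightarrow> real^'m) set) \<Rightarrow> real" where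
  "functional_rank g = poly ((pderiv ^^ functional_dim g) (hilbert_poly g)) 0"

end

(* Exactness of the Spencer complex in positive degrees turns its Euler characteristic into
   (1 - t)^n H(t) = sum_i (-1)^i h^{0,i} t^i, where H is the Hilbert series of g.  Hence the Hilbert
   polynomial is P(z) = sum_i (-1)^i h^{0,i} binom(z - i + n, n).  Expanding in the moments
   M_s = sum_i (-1)^i h^{0,i} (-i)^s shows that deg P = n - s for the first s with M_s \<noteq> 0 and that
   the leading coefficient times (deg P)! is M_s / s!.

   It remains to see that deg P is dim Char + 1.  Upper bound: if X < Y are closed with Y
   irreducible, a form vanishing on X but not on Y is a nonzerodivisor on the functions on the cone
   over Y, so the growth exponent drops along a chain, while the growth for Char is bounded by P.
   Lower bound: Noether normalization gives a subspace W of T over which ST / Ann is finite and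
   with S(W) meeting Ann in 0, so that deg P is at most dim W.  Lying over, together with Zorn's
   lemma and the finiteness of the fibres, lifts a complete flag of the projective space of W* to a
   chain of irreducible closed subsets of Char. *)

theory Submission
  imports Defs
    "HOL-Computational_Algebra.Formal_Power_Series"
    "HOL-Computational_Algebra.Fundamental_Theorem_Algebra"
begin

section \<open>Finite-dimensional subspaces of real vector spaces\<close>


text \<open>The rank formula is quick once \<open>p\<close> is known to be the degree of the Hilbert
  polynomial: in the coefficient of z^(n-s) the lower coefficients of binom(z + n, n) meet only
  moments of order below s, so the first nonzero moment meets the leading coefficient 1/n! alone.
  The weight lies on deg P = dim Char + 1, where only growth up to constant factors matters. Forms
  of degree k on the cone over Char are a quotient of the operators of degree k modulo those that
  kill g_k, and killing g_k is at most m dim g_k conditions. Conversely, in high degree g_k is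
  determined by its derivatives along W. Two obstacles shape the second half. Symbols are real while
  Char is complex, so complex polynomials are split as A + i B with real A and B. And a decreasing
  chain of closed sets projecting onto a linear space could lose a point in the limit; this is where
  finite fibres enter. A minimal closed set over a linear space is irreducible because the linear
  space is, and each lift is sought inside the previous one.\<close>

definition fin_dim :: "'a::real_vector set \<Rightarrow> bool" where
  "fin_dim V \<longleftrightarrow> (\<exists>B. finite B \<and> V \<subseteq> span B)"

text \<open>Linearity on a subset only: differentiation is additive on differentiable maps but not
  on the whole function space, so operators cannot be required to be globally linear.\<close>

definition lin_on :: "'a::real_vector set \<Rightarrow> ('a \<Rightarrow> 'b::real_vector) \<Rightarrow> bool" where
  "lin_on V f \<longleftrightarrow> (\<forall>x\<in>V. \<forall>y\<in>V. f (x + y) = f x + f y) \<and> (\<forall>c. \<forall>x\<in>V. f (c *\<^sub>R x) = c *\<^sub>R f x)"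

lemma fin_dimI: "finite B \<Longrightarrow> V \<subseteq> span B \<Longrightarrow> fin_dim V"
  by (auto simp: fin_dim_def)

lemma fin_dim_subset: "fin_dim V \<Longrightarrow> U \<subseteq> V \<Longrightarrow> fin_dim U"
  by (auto simp: fin_dim_def)

lemma fin_dim_zero [simp]: "fin_dim {0}"
  by (rule fin_dimI[of "{}"]) auto

lemma lin_on_subset: "lin_on V f \<Longrightarrow> U \<subseteq> V \<Longrightarrow> lin_on U f"
  unfolding lin_on_def by blast

lemma linear_lin_on: "linear f \<Longrightarrow> lin_on V f"
  by (simp add: lin_on_def linear_add linear_scale)

lemma fin_dim_basis:
  assumes "fin_dim V"
  obtains B where "B \<subseteq> V" "finite B" "independent B" "V \<subseteq> span B" "card B = dim V"
proof -
  obtain C where C: "finite C" "V \<subseteq> span C" using assms by (auto simp: fin_dim_def)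
  obtain B where B: "B \<subseteq> V" "independent B" "V \<subseteq> span B" "card B = dim V"
    using real_vector.basis_exists[of V] by metis
  have "finite B" using real_vector.independent_span_bound[of C B] C B by blast
  with B that show ?thesis by blast
qed

text \<open>\<open>dim\<close> of an infinite-dimensional space is 0, so monotonicity requires the
  larger space to have a finite spanning set.\<close>

lemma dim_le_fin_dim:
  assumes "fin_dim V" "U \<subseteq> V"
  shows "dim U \<le> dim V"
proof -
  obtain B where B: "B \<subseteq> V" "finite B" "independent B" "V \<subseteq> span B" "card B = dim V"
    using fin_dim_basis[OF assms(1)] by metis
  have "U \<subseteq> span B" using B assms(2) by blast
  with real_vector.dim_le_card[of U B] B show ?thesis by simp
qed

text \<open>Values on a basis of \<open>V\<close> extend to a global linear map. This makes the
  facts about \<open>linear\<close> available for operators that are linear only on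
  \<open>V\<close>.\<close>

lemma lin_on_linear_ext:
  assumes "subspace V" "lin_on V f"
  obtains h where "linear h" "\<And>x. x \<in> V \<Longrightarrow> h x = f x"
proof -
  obtain B where B: "B \<subseteq> V" "independent B" "V \<subseteq> span B"
    using real_vector.basis_exists[of V] by metis
  obtain h where h: "linear h" "\<And>x. x \<in> B \<Longrightarrow> h x = f x"
    using real_vector.linear_independent_extend[OF B(2), of f] by blast
  have sp: "span B = V" using B assms(1) real_vector.span_subspace by blast
  have "h x = f x \<and> x \<in> V" if "x \<in> span B" for x
    using that
  proof (induction rule: real_vector.span_induct_alt)
    case base
    have "0 \<in> V" using assms(1) by (simp add: subspace_0)
    then have "f (0 *\<^sub>R 0) = 0 *\<^sub>R f 0" using assms(2) unfolding lin_on_def by blast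
    then show ?case using h(1) \<open>0 \<in> V\<close> by (simp add: linear_0)
  next
    case (step c x y)
    have "x \<in> V" using step B by auto
    moreover have "y \<in> V" using step(2) by blast
    ultimately have "f (c *\<^sub>R x + y) = c *\<^sub>R f x + f y"
      using assms unfolding lin_on_def by (metis subspace_scale)
    then show ?case using h step B assms(1) by (auto simp: linear_add linear_scale subspace_add subspace_scale)
  qed
  then show ?thesis using that h(1) sp by blast
qed

lemma fin_dim_image:
  assumes "subspace V" "lin_on V f" "fin_dim V"
  shows "fin_dim (f ` V)"
proof -
  obtain h where h: "linear h" "\<And>x. x \<in> V \<Longrightarrow> h x = f x"
    using lin_on_linear_ext[OF assms(1,2)] by metis
  obtain C where C: "finite C" "V \<subseteq> span C" using assms by (auto simp: fin_dim_def)
  have "f ` V = h ` V" using h by simp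
  also have "\<dots> \<subseteq> span (h ` C)" using C(2) linear_span_image[OF h(1)] by blast
  finally show ?thesis using C(1) by (intro fin_dimI[of "h ` C"]) auto
qed

lemma subspace_image_lin_on:
  assumes "subspace V" "lin_on V f"
  shows "subspace (f ` V)"
proof -
  obtain h where h: "linear h" "\<And>x. x \<in> V \<Longrightarrow> h x = f x"
    using lin_on_linear_ext[OF assms(1,2)] by metis
  have "f ` V = h ` V" using h by simp
  then show ?thesis using linear_subspace_image[OF h(1) assms(1)] by simp
qed

lemma rank_nullity:
  assumes "subspace V" "lin_on V f" "fin_dim V"
  shows "dim V = dim {x \<in> V. f x = 0} + dim (f ` V)"
proof -
  obtain h where h: "linear h" "\<And>x. x \<in> V \<Longrightarrow> h x = f x"
    using lin_on_linear_ext[OF assms(1,2)] by metis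
  let ?K = "{x \<in> V. h x = 0}"
  have K: "{x \<in> V. f x = 0} = ?K" using h by auto
  have im: "f ` V = h ` V" using h by simp
  obtain B0 where B0: "B0 \<subseteq> ?K" "finite B0" "independent B0" "?K \<subseteq> span B0" "card B0 = dim ?K"
    using fin_dim_basis[of ?K] fin_dim_subset[OF assms(3)] by (metis (lifting) mem_Collect_eq subsetI)
  obtain B where B: "B0 \<subseteq> B" "B \<subseteq> V" "independent B" "V \<subseteq> span B"
    using real_vector.maximal_independent_subset_extend[of B0 V] B0 by blast
  obtain C where C: "finite C" "V \<subseteq> span C" using assms by (auto simp: fin_dim_def)
  have fB: "finite B" using real_vector.independent_span_bound[of C B] C B by blast
  have cB: "card B = dim V" using real_vector.basis_card_eq_dim B by blast
  let ?D = "B - B0"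
  have spB: "span B = V" using B assms(1) real_vector.span_subspace by blast
  have inj: "inj_on h (span ?D)"
  proof (subst real_vector.linear_inj_on_iff_eq_0[OF h(1) subspace_span], intro ballI impI)
    fix x assume x: "x \<in> span ?D" "h x = 0"
    then have "x \<in> span B" using real_vector.span_mono[of ?D B] by auto
    then have "x \<in> ?K" using x spB by auto
    then have "x \<in> span B0" using B0 by auto
    \<comment> \<open>A vector in both spans has its representation supported on \<open>B0\<close>
      and on \<open>?D\<close> at once, hence the zero representation.\<close>
    with x show "x = 0"
    proof -
      have xB: "x \<in> span B" by fact
      have r1: "real_vector.representation B x = real_vector.representation B0 x"
        using real_vector.representation_extend[OF B(3) \<open>x \<in> span B0\<close> B(1)] by simp
      have r2: "real_vector.representation B x = real_vector.representation ?D x"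
        using real_vector.representation_extend[OF B(3) x(1)] by simp
      have z: "real_vector.representation B x b = 0" for b
        using real_vector.representation_ne_zero[of B0 x b] real_vector.representation_ne_zero[of ?D x b] r1 r2
        by (metis DiffD2)
      show ?thesis
        using real_vector.sum_nonzero_representation_eq[OF B(3) xB] z by simp
    qed
  qed
  have indD: "independent ?D" using B(3) real_vector.independent_mono by blast
  have ind: "independent (h ` ?D)"
    using real_vector.linear_independent_injective_image[OF h(1) indD inj] .
  have sp: "h ` V \<subseteq> span (h ` ?D)"
  proof -
    have "span B \<subseteq> {x. h x \<in> span (h ` ?D)}"
    proof (rule real_vector.span_minimal)
      show "B \<subseteq> {x. h x \<in> span (h ` ?D)}"
      proof
        fix b assume "b \<in> B"
        then show "b \<in> {x. h x \<in> span (h ` ?D)}"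
        proof (cases "b \<in> B0")
          case True
          then have "h b = 0" using B0(1) by blast
          then show ?thesis by (simp add: span_zero)
        next
          case False
          then have "h b \<in> h ` ?D" using \<open>b \<in> B\<close> by blast
          then show ?thesis by (simp add: span_base)
        qed
      qed
      show "subspace {x. h x \<in> span (h ` ?D)}"
        using real_vector.linear_subspace_vimage[OF h(1) subspace_span[of "h ` ?D"]] by (simp add: vimage_def)
    qed
    then show ?thesis using spB by auto
  qed
  have "card (h ` ?D) = dim (h ` V)"
    by (rule real_vector.basis_card_eq_dim) (use B sp ind in auto)
  moreover have "card (h ` ?D) = card ?D"
    using inj real_vector.span_superset[of ?D] by (meson card_image inj_on_subset)
  moreover have "card B = card B0 + card ?D"
    using B(1) fB by (metis card_Diff_subset card_mono finite_subset le_add_diff_inverse)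
  ultimately show ?thesis using cB B0 K im by simp
qed

lemma dim_image_le_lin_on:
  assumes "subspace V" "lin_on V f" "fin_dim V"
  shows "dim (f ` V) \<le> dim V"
  using rank_nullity[OF assms] by simp

lemma dim_zero_set [simp]: "dim {0::'a::real_vector} = 0"
  using real_vector.dim_le_card[of "{0}" "{}"] by simp

lemma dim_inj_lin_on:
  assumes "subspace V" "lin_on V f" "fin_dim V" "\<And>x. x \<in> V \<Longrightarrow> f x = 0 \<Longrightarrow> x = 0"
  shows "dim (f ` V) = dim V"
proof -
  have "0 \<in> V" using assms(1) by (simp add: subspace_0)
  moreover have "f 0 = 0" using assms(2) \<open>0 \<in> V\<close> unfolding lin_on_def by (metis scale_zero_left)
  ultimately have "{x \<in> V. f x = 0} = {0}" using assms(4) by auto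
  then show ?thesis using rank_nullity[OF assms(1-3)] by simp
qed

lemma dim_zero_iff_fin_dim:
  assumes "subspace V" "fin_dim V"
  shows "dim V = 0 \<longleftrightarrow> V = {0}"
proof
  assume d: "dim V = 0"
  obtain B where B: "B \<subseteq> V" "finite B" "independent B" "V \<subseteq> span B" "card B = dim V"
    using fin_dim_basis[OF assms(2)] by metis
  then have "B = {}" using d by auto
  then show "V = {0}" using B assms(1) subspace_0 by fastforce
qed auto

text \<open>By rank-nullity the larger kernel has the smaller image. The two codomains may be
  unrelated, which is how functions on a variety get compared with values of operators.\<close>

lemma dim_kernel_mono:
  assumes "subspace V" "lin_on V f" "lin_on V h" "fin_dim V"
    and "\<And>x. x \<in> V \<Longrightarrow> f x = 0 \<Longrightarrow> h x = 0"
  shows "dim (h ` V) \<le> dim (f ` V)"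
proof -
  have "dim {x \<in> V. f x = 0} \<le> dim {x \<in> V. h x = 0}"
    by (rule dim_le_fin_dim) (use assms(5) fin_dim_subset[OF assms(4)] in auto)
  then show ?thesis using rank_nullity[OF assms(1,2,4)] rank_nullity[OF assms(1,3,4)] by linarith
qed

text \<open>Meant for powers of a coordinate, to produce a polynomial relation. The family may
  repeat a vector; a repetition is itself a relation with coefficients 1 and -1.\<close>

lemma sum_sq_dependent:
  fixes v :: "nat \<Rightarrow> 'a::real_vector"
  assumes "finite B" "\<And>i. i \<le> card B \<Longrightarrow> v i \<in> span B"
  obtains c :: "nat \<Rightarrow> real" where "\<exists>i\<le>card B. c i \<noteq> 0" "(\<Sum>i\<le>card B. c i *\<^sub>R v i) = 0"
proof (cases "inj_on v {..card B}")
  case True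
  let ?S = "v ` {..card B}"
  have "dependent ?S"
  proof (rule ccontr)
    assume "\<not> dependent ?S"
    then have "card ?S \<le> card B"
    proof -
      have "?S \<subseteq> span B" using assms(2) by (auto simp: image_subset_iff)
      with real_vector.independent_span_bound[OF assms(1), of ?S] \<open>\<not> dependent ?S\<close> show ?thesis by simp
    qed
    then show False using True by (simp add: card_image)
  qed
  then obtain u w where u: "w \<in> ?S" "u w \<noteq> 0" "(\<Sum>x\<in>?S. u x *\<^sub>R x) = 0"
    using real_vector.dependent_finite[of ?S] by auto
  show ?thesis
  proof (rule that[of "u \<circ> v"])
    show "\<exists>i\<le>card B. (u \<circ> v) i \<noteq> 0" using u by auto
    show "(\<Sum>i\<le>card B. (u \<circ> v) i *\<^sub>R v i) = 0"
      using u(3) sum.reindex[OF True, of "\<lambda>x. u x *\<^sub>R x"] by (simp add: o_def)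
  qed
next
  case False
  then obtain i j where ij: "i \<le> card B" "j \<le> card B" "i \<noteq> j" "v i = v j"
    by (auto simp: inj_on_def)
  show ?thesis
  proof (rule that[of "\<lambda>k. if k = i then 1 else if k = j then -1 else 0"])
    show "\<exists>k\<le>card B. (if k = i then 1 else if k = j then - 1 else 0) \<noteq> (0::real)"
      using ij by auto
    have "(\<Sum>k\<le>card B. (if k = i then 1 else if k = j then - 1 else 0) *\<^sub>R v k)
      = (\<Sum>k\<in>{i,j}. (if k = i then 1 else if k = j then - 1 else 0) *\<^sub>R v k)"
      by (rule sum.mono_neutral_right) (use ij in auto)
    also have "\<dots> = 0" using ij by simp
    finally show "(\<Sum>k\<le>card B. (if k = i then 1 else if k = j then - 1 else 0) *\<^sub>R v k) = 0" .
  qed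
qed

section \<open>Direct sums of copies of a space\<close>

text \<open>The direct sum of copies of \<open>V\<close> indexed by \<open>I\<close>. Extension by 0
  outside \<open>I\<close> keeps it inside a function type with its pointwise vector space
  structure.\<close>

definition supp_funs :: "'i set \<Rightarrow> 'v::real_vector set \<Rightarrow> ('i \<Rightarrow> 'v) set" where
  "supp_funs I V = {f. (\<forall>i\<in>I. f i \<in> V) \<and> (\<forall>i. i \<notin> I \<longrightarrow> f i = 0)}"

lemma subspace_supp_funs: "subspace V \<Longrightarrow> subspace (supp_funs I V)"
  by (auto simp: supp_funs_def subspace_def scaleR_fun_def)

lemma linear_apply: "linear (\<lambda>f::'i \<Rightarrow> 'v::real_vector. f i)"
  by (rule linearI) (auto simp: scaleR_fun_def)

lemma linear_single: "linear (\<lambda>x::'v::real_vector. (\<lambda>i. if i = j then x else 0))"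
  by (rule linearI) (auto simp: scaleR_fun_def fun_eq_iff)

lemma fin_dim_supp_funs:
  assumes "finite I" "fin_dim V"
  shows "fin_dim (supp_funs I V)"
proof -
  obtain B where B: "finite B" "V \<subseteq> span B" using assms by (auto simp: fin_dim_def)
  let ?e = "\<lambda>j x i. if i = j then x else (0::'b)"
  let ?C = "\<Union>j\<in>I. ?e j ` B"
  show ?thesis
  proof (rule fin_dimI[of ?C])
    show "finite ?C" using assms B by auto
    show "supp_funs I V \<subseteq> span ?C"
    proof
      fix f assume f: "f \<in> supp_funs I V"
      have "f = (\<Sum>j\<in>I. ?e j (f j))"
      proof
        fix i
        have "(\<Sum>j\<in>J. ?e j (f j)) i = (\<Sum>j\<in>J. ?e j (f j) i)" for J
          by (induction J rule: infinite_finite_induct) simp_all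
        also have "(\<Sum>j\<in>I. ?e j (f j) i) = f i"
        proof (cases "i \<in> I")
          case True then show ?thesis using assms(1) by (simp add: sum.delta)
        next
          case False
          then have "(\<Sum>j\<in>I. ?e j (f j) i) = (\<Sum>j\<in>I. 0)" by (intro sum.cong) auto
          then show ?thesis using f False by (simp add: supp_funs_def)
        qed
        finally show "f i = (\<Sum>j\<in>I. ?e j (f j)) i" by simp
      qed
      moreover have "?e j (f j) \<in> span ?C" if "j \<in> I" for j
      proof -
        have "f j \<in> span B" using f B that by (auto simp: supp_funs_def)
        then have "?e j (f j) \<in> span (?e j ` B)"
          using linear_span_image[OF linear_single[of j]] by blast
        then show ?thesis using that real_vector.span_mono[of "?e j ` B" ?C] by blast
      qed
      ultimately show "f \<in> span ?C"
        using real_vector.span_sum[of I "\<lambda>j. ?e j (f j)" ?C] by simp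
    qed
  qed
qed

text \<open>Evaluation at a new index maps onto \<open>V\<close>, with the functions supported on
  the old index set as kernel.\<close>

lemma dim_supp_funs:
  assumes "finite I" "fin_dim V" "subspace V"
  shows "dim (supp_funs I V) = card I * dim V"
  using assms(1)
proof (induction I)
  case empty
  have "supp_funs ({} :: 'a set) V = {0}" by (auto simp: supp_funs_def fun_eq_iff)
  then show ?case by simp
next
  case (insert j I)
  let ?F = "supp_funs (insert j I) V"
  have "dim ?F = dim {f \<in> ?F. f j = 0} + dim ((\<lambda>f. f j) ` ?F)"
    by (rule rank_nullity) (use assms insert in \<open>auto intro!: subspace_supp_funs fin_dim_supp_funs linear_lin_on linear_apply\<close>)
  moreover have "{f \<in> ?F. f j = 0} = supp_funs I V"
    using insert(2) assms(3) by (auto simp: supp_funs_def subspace_0)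
  moreover have "(\<lambda>f. f j) ` ?F = V"
  proof
    show "V \<subseteq> (\<lambda>f. f j) ` ?F"
    proof
      fix x assume "x \<in> V"
      then have "(\<lambda>i. if i = j then x else 0) \<in> ?F"
        using subspace_0[OF assms(3)] unfolding supp_funs_def by simp
      then show "x \<in> (\<lambda>f. f j) ` ?F" by (rule rev_image_eqI) simp
    qed
  qed (auto simp: supp_funs_def)
  ultimately show ?case using insert by simp
qed

section \<open>Polynomial maps and their derivatives\<close>


text \<open>Forms take values that are functions themselves, so pointwise evaluation is unfolded
  only on demand and at the chosen level.\<close>

declare plus_fun_apply [simp del] zero_fun_apply [simp del] times_fun_apply [simp del] one_fun_apply [simp del]
lemmas fun_simps = plus_fun_apply zero_fun_apply times_fun_apply one_fun_apply scaleR_fun_def fun_eq_iff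

section \<open>Exponents and monomials\<close>

lemma mdeg_zero [simp]: "mdeg 0 = 0"
  by (simp add: mdeg_def)

lemma mdeg_add: "mdeg (\<alpha> + \<beta>) = mdeg \<alpha> + mdeg \<beta>"
  by (simp add: mdeg_def lookup_add sum.distrib)

lemma mdeg_single [simp]: "mdeg (Poly_Mapping.single i k) = k"
  by (simp add: mdeg_def lookup_single when_def)

lemma lookup_le_mdeg: "Poly_Mapping.lookup \<alpha> i \<le> mdeg \<alpha>"
  unfolding mdeg_def by (rule member_le_sum) auto

lemma finite_mdeg [simp]: "finite {\<alpha>::'n::finite \<Rightarrow>\<^sub>0 nat. mdeg \<alpha> = k}"
proof -
  have "Poly_Mapping.lookup ` {\<alpha>::'n \<Rightarrow>\<^sub>0 nat. mdeg \<alpha> = k} \<subseteq> PiE UNIV (\<lambda>_. {..k})"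
    using lookup_le_mdeg by fastforce
  moreover have "finite (PiE (UNIV::'n set) (\<lambda>_. {..k}))"
    by (rule finite_PiE) auto
  ultimately have "finite (Poly_Mapping.lookup ` {\<alpha>::'n \<Rightarrow>\<^sub>0 nat. mdeg \<alpha> = k})"
    by (rule finite_subset)
  then show ?thesis
    by (rule finite_imageD) (auto simp: inj_on_def intro: poly_mapping_eqI)
qed

lemma single_add_minus:
  fixes \<alpha> :: "'n \<Rightarrow>\<^sub>0 nat"
  assumes "Poly_Mapping.lookup \<alpha> i \<noteq> 0"
  shows "Poly_Mapping.single i 1 + (\<alpha> - Poly_Mapping.single i 1) = \<alpha>"
  by (rule poly_mapping_eqI) (use assms in \<open>auto simp: lookup_add lookup_minus lookup_single when_def\<close>)

text \<open>Raising one exponent at a time means that multiplication by one variable, or one partial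
  derivative, is the only step ever to be analysed.\<close>

lemma expo_induct [case_names zero add]:
  fixes \<alpha> :: "'n::finite \<Rightarrow>\<^sub>0 nat"
  assumes "P 0" "\<And>i \<alpha>. P \<alpha> \<Longrightarrow> P (Poly_Mapping.single i 1 + \<alpha>)"
  shows "P \<alpha>"
proof (induction "mdeg \<alpha>" arbitrary: \<alpha>)
  case 0
  then have "\<alpha> = 0" by (intro poly_mapping_eqI) (auto simp: mdeg_def)
  then show ?case using assms by simp
next
  case (Suc k)
  then obtain i where i: "Poly_Mapping.lookup \<alpha> i \<noteq> 0"
    unfolding mdeg_def by (metis nat.distinct(1) sum.neutral)
  have eq: "Poly_Mapping.single i 1 + (\<alpha> - Poly_Mapping.single i 1) = \<alpha>"
    using single_add_minus[OF i] .
  then have "mdeg \<alpha> = 1 + mdeg (\<alpha> - Poly_Mapping.single i 1)"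
    by (metis mdeg_add mdeg_single)
  then have "k = mdeg (\<alpha> - Poly_Mapping.single i 1)" using Suc by simp
  from assms(2)[OF Suc(1)[OF this]] eq show ?case by metis
qed

lemma monom_eval_zero [simp]: "monom_eval x 0 = 1"
  by (simp add: monom_eval_def)

lemma monom_eval_add: "monom_eval x (\<alpha> + \<beta>) = monom_eval x \<alpha> * monom_eval (x::'a::comm_semiring_1^'n) \<beta>"
  by (simp add: monom_eval_def lookup_add power_add prod.distrib)

lemma monom_eval_single [simp]: "monom_eval (x::'a::comm_semiring_1^'n::finite) (Poly_Mapping.single i (Suc 0)) = x $ i"
proof -
  have "monom_eval x (Poly_Mapping.single i (Suc 0)) = (\<Prod>j\<in>UNIV. if j = i then x $ j else 1)"
    unfolding monom_eval_def by (rule prod.cong) (auto simp: lookup_single when_def)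
  then show ?thesis by simp
qed

lemma monom_eval_has_derivative:
  fixes x :: "real^'n"
  shows "((\<lambda>x. monom_eval x \<alpha>) has_derivative
    (\<lambda>v. \<Sum>i\<in>UNIV. v $ i * (real (Poly_Mapping.lookup \<alpha> i) * monom_eval x (\<alpha> - Poly_Mapping.single i 1)))) (at x)"
proof (induction \<alpha> rule: expo_induct)
  case zero
  then show ?case by (simp add: monom_eval_def)
next
  case (add i \<alpha>)
  let ?d = "\<lambda>\<alpha> v. \<Sum>i\<in>UNIV. v $ i * (real (Poly_Mapping.lookup \<alpha> i) * monom_eval x (\<alpha> - Poly_Mapping.single i 1))"
  have e: "(\<lambda>x::real^'n. monom_eval x (Poly_Mapping.single i 1 + \<alpha>)) = (\<lambda>x. x $ i * monom_eval x \<alpha>)"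
    by (simp add: monom_eval_add)
  have "((\<lambda>x. x $ i * monom_eval x \<alpha>) has_derivative (\<lambda>v. x $ i * ?d \<alpha> v + v $ i * monom_eval x \<alpha>)) (at x)"
    by (rule has_derivative_mult[OF _ add]) (rule bounded_linear_imp_has_derivative, rule bounded_linear_vec_nth)
  moreover have "x $ i * ?d \<alpha> v + v $ i * monom_eval x \<alpha> = ?d (Poly_Mapping.single i 1 + \<alpha>) v" for v
  proof -
    have t: "v $ j * (real (Poly_Mapping.lookup (Poly_Mapping.single i 1 + \<alpha>) j) * monom_eval x (Poly_Mapping.single i 1 + \<alpha> - Poly_Mapping.single j 1))
       = x $ i * (v $ j * (real (Poly_Mapping.lookup \<alpha> j) * monom_eval x (\<alpha> - Poly_Mapping.single j 1)))
        + (if j = i then v $ i * monom_eval x \<alpha> else 0)" for j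
    proof (cases "j = i")
      case True
      show ?thesis
      \<comment> \<open>For exponent 0 the truncated subtraction leaves \<open>\<alpha>\<close>
        unchanged, but the factor \<open>lookup\<close> removes the term.\<close>
      proof (cases "Poly_Mapping.lookup \<alpha> i = 0")
        case True
        then show ?thesis using \<open>j = i\<close> by (simp add: lookup_add lookup_single)
      next
        case False
        then have "monom_eval x \<alpha> = x $ i * monom_eval x (\<alpha> - Poly_Mapping.single i 1)"
          by (metis single_add_minus monom_eval_add monom_eval_single One_nat_def)
        then show ?thesis using \<open>j = i\<close> by (simp add: lookup_add lookup_single algebra_simps)
      qed
    next
      case False
      then have l: "Poly_Mapping.lookup (Poly_Mapping.single i 1 + \<alpha>) j = Poly_Mapping.lookup \<alpha> j"
        by (simp add: lookup_add lookup_single)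
      show ?thesis
      proof (cases "Poly_Mapping.lookup \<alpha> j = 0")
        case True
        then show ?thesis using False l by simp
      next
        case n: False
        have "Poly_Mapping.single i 1 + \<alpha> - Poly_Mapping.single j 1
          = Poly_Mapping.single i 1 + (\<alpha> - Poly_Mapping.single j 1)"
          by (rule poly_mapping_eqI) (use False n in \<open>auto simp: lookup_add lookup_minus lookup_single when_def\<close>)
        then show ?thesis using False l by (simp add: monom_eval_add)
      qed
    qed
    show ?thesis unfolding t by (simp add: sum.distrib sum_distrib_left)
  qed
  ultimately show ?case unfolding e by simp
qed

section \<open>Polynomial maps spanned by vector-valued monomials\<close>

definition vmon :: "('n::finite \<Rightarrow>\<^sub>0 nat) \<Rightarrow> real^'m \<Rightarrow> real^'n \<Rightarrow> real^'m" where
  "vmon \<alpha> c = (\<lambda>x. monom_eval x \<alpha> *\<^sub>R c)"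

definition poly_maps :: "(real^'n \<Rightarrow> real^'m) set" where
  "poly_maps = span {vmon \<alpha> c | \<alpha> c. True}"

lemma subspace_poly_maps [simp]: "subspace poly_maps"
  by (simp add: poly_maps_def)

lemma vmon_poly_maps [simp]: "vmon \<alpha> c \<in> poly_maps"
  by (auto simp: poly_maps_def intro: span_base)

lemma vmon_zero [simp]: "vmon \<alpha> 0 = 0"
  by (simp add: vmon_def fun_simps)

lemma vmon_add: "vmon \<alpha> (c + d) = vmon \<alpha> c + vmon \<alpha> d"
  by (simp add: vmon_def fun_simps scaleR_add_right)

lemma vmon_scale: "vmon \<alpha> (r *\<^sub>R c) = r *\<^sub>R vmon \<alpha> c"
  by (simp add: vmon_def fun_simps scaleR_fun_def)

lemma sum_fun_apply: "(\<Sum>i\<in>A. f i) x = (\<Sum>i\<in>A. f i x)"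
  by (induction A rule: infinite_finite_induct) (simp_all add: fun_simps)

lemma sym_maps_vmon: "q \<in> sym_maps k \<longleftrightarrow> (\<exists>c. q = (\<Sum>\<alpha> | mdeg \<alpha> = k. vmon \<alpha> (c \<alpha>)))"
  unfolding sym_maps_def by (simp add: vmon_def fun_simps sum_fun_apply)

lemma subspace_sym_maps [simp]: "subspace (sym_maps k)"
proof (rule subspaceI)
  show "0 \<in> sym_maps k" unfolding sym_maps_vmon by (rule exI[of _ "\<lambda>_. 0"]) simp
next
  fix p q :: "real^'a \<Rightarrow> real^'b"
  assume "p \<in> sym_maps k" "q \<in> sym_maps k"
  then obtain c d where "p = (\<Sum>\<alpha> | mdeg \<alpha> = k. vmon \<alpha> (c \<alpha>))" "q = (\<Sum>\<alpha> | mdeg \<alpha> = k. vmon \<alpha> (d \<alpha>))"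
    unfolding sym_maps_vmon by blast
  then show "p + q \<in> sym_maps k" unfolding sym_maps_vmon
    by (intro exI[of _ "\<lambda>\<alpha>. c \<alpha> + d \<alpha>"]) (simp add: vmon_add sum.distrib)
next
  fix p :: "real^'a \<Rightarrow> real^'b" and r
  assume "p \<in> sym_maps k"
  then obtain c where "p = (\<Sum>\<alpha> | mdeg \<alpha> = k. vmon \<alpha> (c \<alpha>))"
    unfolding sym_maps_vmon by blast
  then show "r *\<^sub>R p \<in> sym_maps k" unfolding sym_maps_vmon
    by (intro exI[of _ "\<lambda>\<alpha>. r *\<^sub>R c \<alpha>"]) (simp add: vmon_scale scaleR_sum_right)
qed

lemma vmon_sym_maps: "vmon \<alpha> c \<in> sym_maps (mdeg \<alpha>)"
  unfolding sym_maps_vmon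
proof (rule exI[of _ "\<lambda>\<beta>. if \<beta> = \<alpha> then c else 0"])
  have "(\<Sum>\<beta> | mdeg \<beta> = mdeg \<alpha>. vmon \<beta> (if \<beta> = \<alpha> then c else 0))
    = (\<Sum>\<beta> | mdeg \<beta> = mdeg \<alpha>. if \<beta> = \<alpha> then vmon \<alpha> c else 0)"
    by (rule sum.cong) auto
  then show "vmon \<alpha> c = (\<Sum>\<beta> | mdeg \<beta> = mdeg \<alpha>. vmon \<beta> (if \<beta> = \<alpha> then c else 0))"
    by simp
qed

text \<open>Scalars are absorbed into the coefficient vector of \<open>vmon\<close>, so closure
  under addition suffices.\<close>

lemma sym_maps_induct [consumes 1, case_names vmon zero add]:
  assumes "q \<in> sym_maps k" "\<And>\<alpha> c. mdeg \<alpha> = k \<Longrightarrow> P (vmon \<alpha> c)" "P 0"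
    "\<And>p q. p \<in> sym_maps k \<Longrightarrow> q \<in> sym_maps k \<Longrightarrow> P p \<Longrightarrow> P q \<Longrightarrow> P (p + q)"
  shows "P q"
proof -
  obtain c where c: "q = (\<Sum>\<alpha> | mdeg \<alpha> = k. vmon \<alpha> (c \<alpha>))"
    using assms(1) unfolding sym_maps_vmon by blast
  have "finite A \<Longrightarrow> A \<subseteq> {\<alpha>. mdeg \<alpha> = k} \<Longrightarrow>
    P (\<Sum>\<alpha>\<in>A. vmon \<alpha> (c \<alpha>)) \<and> (\<Sum>\<alpha>\<in>A. vmon \<alpha> (c \<alpha>)) \<in> sym_maps k" for A
  proof (induction A rule: finite_induct)
    case empty
    then show ?case using assms(3) by (simp add: subspace_0)
  next
    case (insert \<alpha> A)
    then have "vmon \<alpha> (c \<alpha>) \<in> sym_maps k" using vmon_sym_maps[of \<alpha> "c \<alpha>"] by simp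
    with insert assms(2)[of \<alpha> "c \<alpha>"] assms(4)[of "vmon \<alpha> (c \<alpha>)" "\<Sum>\<alpha>\<in>A. vmon \<alpha> (c \<alpha>)"]
    show ?case by (simp add: subspace_add)
  qed
  from this[of "{\<alpha>. mdeg \<alpha> = k}"] show ?thesis unfolding c by simp
qed

lemma sym_maps_poly_maps: "q \<in> sym_maps k \<Longrightarrow> q \<in> poly_maps"
  by (induction rule: sym_maps_induct) (auto simp: subspace_0 subspace_add)

lemma poly_maps_induct [consumes 1, case_names zero vmon add]:
  assumes "q \<in> poly_maps" "P 0" "\<And>\<alpha> c. P (vmon \<alpha> c)"
    "\<And>p q. p \<in> poly_maps \<Longrightarrow> q \<in> poly_maps \<Longrightarrow> P p \<Longrightarrow> P q \<Longrightarrow> P (p + q)"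
  shows "P q"
proof -
  have "q \<in> span {vmon \<alpha> c | \<alpha> c. True}" using assms(1) by (simp add: poly_maps_def)
  then have "P q \<and> q \<in> poly_maps"
  proof (induction rule: real_vector.span_induct_alt)
    case base
    then show ?case using assms(2) by (simp add: subspace_0)
  next
    case (step r x y)
    then obtain \<alpha> c where "x = vmon \<alpha> c" by blast
    then have x: "r *\<^sub>R x = vmon \<alpha> (r *\<^sub>R c)" by (simp add: vmon_scale)
    show ?case unfolding x
      using step assms(3)[of \<alpha> "r *\<^sub>R c"] assms(4)[of "vmon \<alpha> (r *\<^sub>R c)" y]
      by (simp add: subspace_add)
  qed
  then show ?thesis by simp
qed

lemma vmon_has_derivative:
  "(vmon \<alpha> c has_derivative
    (\<lambda>v. (\<Sum>i\<in>UNIV. v $ i * (real (Poly_Mapping.lookup \<alpha> i) * monom_eval x (\<alpha> - Poly_Mapping.single i 1))) *\<^sub>R c)) (at x)"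
  unfolding vmon_def by (rule has_derivative_scaleR_left[OF monom_eval_has_derivative])

lemma poly_maps_differentiable:
  assumes "q \<in> poly_maps"
  shows "q differentiable (at x)"
  using assms
proof (induction rule: poly_maps_induct)
  case zero
  show ?case by (simp add: zero_fun_def)
next
  case (vmon \<alpha> c)
  then show ?case using vmon_has_derivative differentiableI by blast
next
  case (add p q)
  have "p + q = (\<lambda>x. p x + q x)" by (simp add: fun_simps)
  then show ?case using add by simp
qed

lemma poly_maps_has_derivative:
  assumes "q \<in> poly_maps"
  shows "(q has_derivative (\<lambda>v. dir_deriv v q x)) (at x)"
  using poly_maps_differentiable[OF assms, of x] unfolding dir_deriv_def
  by (simp add: frechet_derivative_works)

lemma dir_deriv_eqI:
  assumes "\<And>x. (q has_derivative (\<lambda>v. d v x)) (at x)"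
  shows "dir_deriv v q = d v"
proof
  fix x
  show "dir_deriv v q x = d v x"
    using frechet_derivative_at[OF assms[of x]] unfolding dir_deriv_def by metis
qed

lemma linear_dir_deriv_dir:
  assumes "q \<in> poly_maps"
  shows "linear (\<lambda>v. dir_deriv v q)"
proof -
  have l: "linear (\<lambda>v. dir_deriv v q x)" for x
    using poly_maps_has_derivative[OF assms] has_derivative_linear by blast
  show ?thesis
    by (rule linearI) (simp_all add: fun_simps linear_add[OF l] linear_scale[OF l] scaleR_fun_def)
qed

lemma dir_deriv_add:
  assumes "p \<in> poly_maps" "q \<in> poly_maps"
  shows "dir_deriv v (p + q) = dir_deriv v p + dir_deriv v q"
proof -
  have "dir_deriv v (p + q) = (\<lambda>v x. dir_deriv v p x + dir_deriv v q x) v"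
  proof (rule dir_deriv_eqI)
    fix x
    have "p + q = (\<lambda>x. p x + q x)" by (simp add: fun_simps)
    then show "((p + q) has_derivative (\<lambda>v. dir_deriv v p x + dir_deriv v q x)) (at x)"
      using has_derivative_add[OF poly_maps_has_derivative[OF assms(1)] poly_maps_has_derivative[OF assms(2)], of x] by simp
  qed
  then show ?thesis by (simp add: fun_simps)
qed

lemma dir_deriv_scale:
  assumes "p \<in> poly_maps"
  shows "dir_deriv v (r *\<^sub>R p) = r *\<^sub>R dir_deriv v p"
proof -
  have "dir_deriv v (r *\<^sub>R p) = (\<lambda>v x. r *\<^sub>R dir_deriv v p x) v"
  proof (rule dir_deriv_eqI)
    fix x
    have "r *\<^sub>R p = (\<lambda>x. r *\<^sub>R p x)" by (simp add: fun_simps scaleR_fun_def)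
    then show "((r *\<^sub>R p) has_derivative (\<lambda>v. r *\<^sub>R dir_deriv v p x)) (at x)"
      using has_derivative_scaleR_right[OF poly_maps_has_derivative[OF assms(1)], of r x] by simp
  qed
  then show ?thesis by (simp add: fun_simps scaleR_fun_def)
qed

lemma dir_deriv_zero [simp]: "dir_deriv v (0 :: real^'n \<Rightarrow> real^'m) = 0"
  using dir_deriv_scale[of "0 :: real^'n \<Rightarrow> real^'m" v 0] by (simp add: subspace_0)

lemma lin_on_dir_deriv: "lin_on poly_maps (dir_deriv v)"
  by (simp add: lin_on_def dir_deriv_add dir_deriv_scale)

lemma dir_deriv_vmon:
  "dir_deriv v (vmon \<alpha> c) =
    (\<Sum>i\<in>UNIV. vmon (\<alpha> - Poly_Mapping.single i 1) ((v $ i * real (Poly_Mapping.lookup \<alpha> i)) *\<^sub>R c))"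
proof -
  have "dir_deriv v (vmon \<alpha> c) = (\<lambda>v x. (\<Sum>i\<in>UNIV. v $ i * (real (Poly_Mapping.lookup \<alpha> i) * monom_eval x (\<alpha> - Poly_Mapping.single i 1))) *\<^sub>R c) v"
    by (rule dir_deriv_eqI) (rule vmon_has_derivative)
  also have "\<dots> = (\<Sum>i\<in>UNIV. vmon (\<alpha> - Poly_Mapping.single i 1) ((v $ i * real (Poly_Mapping.lookup \<alpha> i)) *\<^sub>R c))"
    by (simp add: fun_simps sum_fun_apply vmon_def scaleR_sum_left mult_ac)
  finally show ?thesis .
qed

lemma dir_deriv_axis_vmon:
  "dir_deriv (axis i 1) (vmon \<alpha> c) = vmon (\<alpha> - Poly_Mapping.single i 1) (real (Poly_Mapping.lookup \<alpha> i) *\<^sub>R c)"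
proof -
  have "dir_deriv (axis i 1) (vmon \<alpha> c) =
    (\<Sum>j\<in>UNIV. if j = i then vmon (\<alpha> - Poly_Mapping.single i 1) (real (Poly_Mapping.lookup \<alpha> i) *\<^sub>R c) else 0)"
    unfolding dir_deriv_vmon by (rule sum.cong) (auto simp: axis_def)
  then show ?thesis by simp
qed

lemma dir_deriv_poly_maps [simp]:
  assumes "q \<in> poly_maps"
  shows "dir_deriv v q \<in> poly_maps"
  using assms
proof (induction rule: poly_maps_induct)
  case (vmon \<alpha> c)
  then show ?case unfolding dir_deriv_vmon by (intro subspace_sum) auto
qed (auto simp: dir_deriv_add subspace_0 subspace_add)

lemma dir_deriv_sym_maps:
  assumes "q \<in> sym_maps (Suc k)"
  shows "dir_deriv v q \<in> sym_maps k"
  using assms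
proof (induction rule: sym_maps_induct)
  case (vmon \<alpha> c)
  show ?case unfolding dir_deriv_vmon
  proof (rule subspace_sum[OF subspace_sym_maps])
    fix i
    show "vmon (\<alpha> - Poly_Mapping.single i 1) ((v $ i * real (Poly_Mapping.lookup \<alpha> i)) *\<^sub>R c) \<in> sym_maps k"
    proof (cases "Poly_Mapping.lookup \<alpha> i = 0")
      case True
      then show ?thesis by (simp add: subspace_0)
    next
      case False
      from single_add_minus[OF this] have "mdeg \<alpha> = 1 + mdeg (\<alpha> - Poly_Mapping.single i 1)"
        by (metis mdeg_add mdeg_single)
      then have "mdeg (\<alpha> - Poly_Mapping.single i 1) = k" using vmon by simp
      then show ?thesis using vmon_sym_maps by metis
    qed
  qed
qed (auto simp: dir_deriv_add sym_maps_poly_maps subspace_0 subspace_add)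

lemma dir_deriv_sym_maps_0:
  assumes "q \<in> sym_maps 0"
  shows "dir_deriv v q = 0"
  using assms
proof (induction rule: sym_maps_induct)
  case (vmon \<alpha> c)
  then have "Poly_Mapping.lookup \<alpha> i = 0" for i by (simp add: mdeg_def)
  then show ?case unfolding dir_deriv_vmon by simp
qed (auto simp: dir_deriv_add sym_maps_poly_maps)

lemma poly_maps_deriv_sum:
  assumes "\<And>i. i \<in> A \<Longrightarrow> q i \<in> poly_maps"
  shows "dir_deriv v (\<Sum>i\<in>A. q i) = (\<Sum>i\<in>A. dir_deriv v (q i))"
  using assms by (induction A rule: infinite_finite_induct) (auto simp: dir_deriv_add subspace_sum)

text \<open>On a monomial the second derivative is a double sum over two variables, symmetric in
  them even with truncated exponents.\<close>

lemma dir_deriv_commute: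
  assumes "q \<in> poly_maps"
  shows "dir_deriv v (dir_deriv w q) = dir_deriv w (dir_deriv v q)"
  using assms
proof (induction rule: poly_maps_induct)
  case (vmon \<alpha> c)
  have e: "dir_deriv v (dir_deriv w (vmon \<alpha> c)) = (\<Sum>i\<in>UNIV. \<Sum>j\<in>UNIV.
     vmon (\<alpha> - Poly_Mapping.single i 1 - Poly_Mapping.single j 1)
      ((v $ j * w $ i * real (Poly_Mapping.lookup (\<alpha> - Poly_Mapping.single i 1) j * Poly_Mapping.lookup \<alpha> i)) *\<^sub>R c))" for v w
    unfolding dir_deriv_vmon[of w]
    by (subst poly_maps_deriv_sum) (simp_all add: dir_deriv_vmon mult_ac)
  show ?case unfolding e
    apply (subst sum.swap)
    apply (intro sum.cong refl)
    subgoal for i j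
    proof -
      have "\<alpha> - Poly_Mapping.single j 1 - Poly_Mapping.single i 1 = \<alpha> - Poly_Mapping.single i 1 - Poly_Mapping.single j (1::nat)"
        by (rule poly_mapping_eqI) (simp add: lookup_minus)
      moreover have "Poly_Mapping.lookup (\<alpha> - Poly_Mapping.single j 1) i * Poly_Mapping.lookup \<alpha> j
        = Poly_Mapping.lookup (\<alpha> - Poly_Mapping.single i 1) j * Poly_Mapping.lookup \<alpha> i"
        by (simp add: lookup_minus lookup_single when_def)
      ultimately show ?thesis by (simp add: mult_ac)
    qed
    done
qed (simp_all add: dir_deriv_add)

lemma sym_maps_scale: "q \<in> sym_maps k \<Longrightarrow> q (t *\<^sub>R x) = t ^ k *\<^sub>R q x"
proof (induction rule: sym_maps_induct)
  case (vmon \<alpha> c)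
  have "monom_eval (t *\<^sub>R x) \<alpha> = t ^ mdeg \<alpha> * monom_eval x \<alpha>"
    by (simp add: monom_eval_def mdeg_def power_mult_distrib prod.distrib power_sum)
  then show ?case using vmon by (simp add: vmon_def)
qed (simp_all add: scaleR_add_right fun_simps)

lemma sym_maps_at_0: "q \<in> sym_maps (Suc k) \<Longrightarrow> q 0 = 0"
  using sym_maps_scale[of q "Suc k" 0 0] by simp

lemma sym_maps_0_iff: "q \<in> sym_maps 0 \<longleftrightarrow> (\<exists>c. q = (\<lambda>x. c))"
proof
  assume "q \<in> sym_maps 0"
  then have "q x = q 0" for x using sym_maps_scale[of q 0 0 x] by simp
  then show "\<exists>c. q = (\<lambda>x. c)" by (intro exI[of _ "q 0"]) (simp add: fun_simps)
next
  assume "\<exists>c. q = (\<lambda>x. c)"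
  then obtain c where "q = vmon 0 c" by (auto simp: vmon_def)
  then show "q \<in> sym_maps 0" using vmon_sym_maps[of 0 c] by simp
qed

text \<open>Vanishing derivatives make \<open>q\<close> constant, and positive degree makes its
  value at 0 vanish.\<close>

lemma sym_maps_deriv_zero:
  assumes "q \<in> sym_maps (Suc k)" "\<And>i. dir_deriv (axis i 1) q = 0"
  shows "q = 0"
proof
  fix x
  note q = sym_maps_poly_maps[OF assms(1)]
  have "dir_deriv v q = 0" for v
  proof -
    have "dir_deriv (\<Sum>i\<in>UNIV. v $ i *\<^sub>R axis i 1) q = (\<Sum>i\<in>UNIV. v $ i *\<^sub>R dir_deriv (axis i 1) q)"
      using linear_sum[OF linear_dir_deriv_dir[OF q], of "\<lambda>i. v $ i *\<^sub>R axis i 1" UNIV]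
      by (simp add: linear_scale[OF linear_dir_deriv_dir[OF q]])
    moreover have "(\<Sum>i\<in>UNIV. v $ i *\<^sub>R axis i 1) = v"
      using basis_expansion[of v] by (simp add: scalar_mult_eq_scaleR)
    ultimately show ?thesis using assms(2) by simp
  qed
  then have "(q has_derivative (\<lambda>v. 0)) (at x)" for x
    using poly_maps_has_derivative[OF q, of x] by (simp add: zero_fun_apply)
  then have "\<exists>c. \<forall>x\<in>UNIV. q x = c"
    by (intro has_derivative_zero_constant) auto
  then have "q x = q 0" by auto
  then show "q x = 0 x" using sym_maps_at_0[OF assms(1)] by (simp add: fun_simps)
qed

lemma fin_dim_sym_maps [simp]: "fin_dim (sym_maps k :: (real^'n \<Rightarrow> real^'m) set)"
proof (rule fin_dimI)
  let ?B = "(\<lambda>(\<alpha>, j). vmon \<alpha> (axis j 1)) ` ({\<alpha>. mdeg \<alpha> = k} \<times> UNIV) :: (real^'n \<Rightarrow> real^'m) set"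
  show "finite ?B" by simp
  show "sym_maps k \<subseteq> span ?B"
  proof
    fix q :: "real^'n \<Rightarrow> real^'m" assume "q \<in> sym_maps k"
    then show "q \<in> span ?B"
    proof (induction rule: sym_maps_induct)
      case (vmon \<alpha> c)
      have "vmon \<alpha> (\<Sum>j\<in>UNIV. c $ j *\<^sub>R axis j 1) = (\<Sum>j\<in>UNIV. c $ j *\<^sub>R vmon \<alpha> (axis j 1))"
        by (simp add: vmon_def fun_simps sum_fun_apply scaleR_fun_def scaleR_sum_right mult_ac)
      moreover have "(\<Sum>j\<in>UNIV. c $ j *\<^sub>R axis j 1) = c"
        using basis_expansion[of c] by (simp add: scalar_mult_eq_scaleR)
      moreover have "(\<Sum>j\<in>UNIV. c $ j *\<^sub>R vmon \<alpha> (axis j 1)) \<in> span ?B"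
        by (intro span_sum span_scale span_base) (use vmon in auto)
      ultimately show ?case by simp
    next
      case zero
      then show ?case by (rule span_zero)
    next
      case (add p q)
      then show ?case by (intro span_add)
    qed
  qed
qed

lemma poly_maps_homogeneous_sum:
  assumes "q \<in> poly_maps"
  obtains K r where "\<And>k. r k \<in> sym_maps k" "q = (\<Sum>k<K. r k)"
proof -
  \<comment> \<open>The induction also records that components vanish from \<open>K\<close> on, so
    that two decompositions can be padded to a common length and added.\<close>
  have "\<exists>K r. (\<forall>k. r k \<in> sym_maps k) \<and> (\<forall>k\<ge>K. r k = 0) \<and> q = (\<Sum>k<K. r k)"
    using assms
  proof (induction rule: poly_maps_induct)
    case zero
    then show ?case by (intro exI[of _ 0] exI[of _ "\<lambda>_. 0"]) (simp add: subspace_0)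
  next
    case (vmon \<alpha> c)
    show ?case
      by (rule exI[of _ "Suc (mdeg \<alpha>)"], rule exI[of _ "\<lambda>k. if k = mdeg \<alpha> then vmon \<alpha> c else 0"])
        (simp add: vmon_sym_maps subspace_0)
  next
    case (add p q)
    obtain K r where r: "\<forall>k. r k \<in> sym_maps k" "\<forall>k\<ge>K. r k = 0" "p = (\<Sum>k<K. r k)" using add by metis
    obtain L s where s: "\<forall>k. s k \<in> sym_maps k" "\<forall>k\<ge>L. s k = 0" "q = (\<Sum>k<L. s k)" using add by metis
    have "p = (\<Sum>k<max K L. r k)" unfolding r(3) by (rule sum.mono_neutral_left) (use r in auto)
    moreover have "q = (\<Sum>k<max K L. s k)" unfolding s(3) by (rule sum.mono_neutral_left) (use s in auto)
    ultimately show ?case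
      by (intro exI[of _ "max K L"] exI[of _ "\<lambda>k. r k + s k"]) (use r s in \<open>auto simp: subspace_add sum.distrib\<close>)
  qed
  then show ?thesis using that by blast
qed


section \<open>Formal polynomials and differential operators\<close>

lemma foldr_dir_deriv_poly_maps:
  "q \<in> poly_maps \<Longrightarrow> foldr (\<lambda>i. dir_deriv (axis i 1)) is q \<in> poly_maps"
  by (induction "is") auto

lemma foldr_dir_deriv_remove1:
  assumes "q \<in> poly_maps" "i \<in> set is"
  shows "foldr (\<lambda>i. dir_deriv (axis i 1)) is q =
    dir_deriv (axis i 1) (foldr (\<lambda>i. dir_deriv (axis i 1)) (remove1 i is) q)"
  using assms(2)
proof (induction "is")
  case (Cons j "is")
  show ?case
  proof (cases "i = j")
    case False
    then have "i \<in> set is" using Cons by simp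
    then have "foldr (\<lambda>i. dir_deriv (axis i 1)) is q =
      dir_deriv (axis i 1) (foldr (\<lambda>i. dir_deriv (axis i 1)) (remove1 i is) q)" using Cons by simp
    then show ?thesis using False
      using dir_deriv_commute[OF foldr_dir_deriv_poly_maps[OF assms(1)]] by simp
  qed simp
qed simp

text \<open>Since derivatives commute, only the multiset of directions counts; this frees
  \<open>partial_deriv\<close> from the list chosen by \<open>SOME\<close>.\<close>

lemma foldr_dir_deriv_mset:
  assumes "q \<in> poly_maps" "mset is = mset js"
  shows "foldr (\<lambda>i. dir_deriv (axis i 1)) is q = foldr (\<lambda>i. dir_deriv (axis i 1)) js q"
  using assms(2)
proof (induction "is" arbitrary: js)
  case (Cons i "is")
  then have i: "i \<in> set js" by (metis list.set_intros(1) mset_eq_setD)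
  have "mset is = mset (remove1 i js)"
    using Cons(2) by (metis add_mset_remove_trivial mset.simps(2) mset_remove1)
  from Cons(1)[OF this] show ?case by (simp add: foldr_dir_deriv_remove1[OF assms(1) i])
qed simp

lemma ex_count_list:
  fixes f :: "'n::finite \<Rightarrow> nat"
  shows "\<exists>is. \<forall>i. count_list is i = f i"
proof -
  obtain "is" where "mset is = Abs_multiset f" using ex_mset by metis
  then have "count (mset is) = f" by (simp add: Abs_multiset_inverse)
  then show ?thesis by (metis count_mset)
qed

definition expo_list :: "('n \<Rightarrow>\<^sub>0 nat) \<Rightarrow> 'n list" where
  "expo_list \<alpha> = (SOME is. \<forall>i. count_list is i = Poly_Mapping.lookup \<alpha> i)"

lemma count_expo_list: "count_list (expo_list \<alpha>) i = Poly_Mapping.lookup (\<alpha>::'n::finite \<Rightarrow>\<^sub>0 nat) i"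
  using someI_ex[OF ex_count_list[of "Poly_Mapping.lookup \<alpha>"]] unfolding expo_list_def by simp

lemma partial_deriv_list:
  assumes "q \<in> poly_maps" "\<And>i. count_list is i = Poly_Mapping.lookup \<alpha> i"
  shows "partial_deriv \<alpha> q = foldr (\<lambda>i. dir_deriv (axis i 1)) is q"
proof -
  have "mset (expo_list \<alpha>) = mset is"
    by (rule multiset_eqI) (simp add: count_mset count_expo_list assms(2))
  then show ?thesis
    using foldr_dir_deriv_mset[OF assms(1)] unfolding partial_deriv_def expo_list_def by metis
qed

lemma partial_deriv_zero [simp]: "q \<in> poly_maps \<Longrightarrow> partial_deriv 0 q = q"
  using partial_deriv_list[of q "[]" 0] by simp

lemma partial_deriv_add_single:
  assumes "q \<in> poly_maps"
  shows "partial_deriv (Poly_Mapping.single i 1 + \<alpha>) q = dir_deriv (axis i 1) (partial_deriv \<alpha> q)"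
proof -
  have "partial_deriv (Poly_Mapping.single i 1 + \<alpha>) q = foldr (\<lambda>i. dir_deriv (axis i 1)) (i # expo_list \<alpha>) q"
    by (rule partial_deriv_list[OF assms]) (auto simp: lookup_add lookup_single when_def count_expo_list)
  moreover have "partial_deriv \<alpha> q = foldr (\<lambda>i. dir_deriv (axis i 1)) (expo_list \<alpha>) q"
    by (rule partial_deriv_list[OF assms]) (simp add: count_expo_list)
  ultimately show ?thesis by simp
qed

lemma partial_deriv_poly_maps [simp]: "q \<in> poly_maps \<Longrightarrow> partial_deriv \<alpha> q \<in> poly_maps"
  by (induction \<alpha> rule: expo_induct) (simp_all add: partial_deriv_add_single del: One_nat_def)

lemma partial_deriv_dir_deriv:
  assumes "q \<in> poly_maps"
  shows "partial_deriv \<alpha> (dir_deriv v q) = dir_deriv v (partial_deriv \<alpha> q)"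
proof (induction \<alpha> rule: expo_induct)
  case (add i \<alpha>)
  then show ?case using assms by (simp add: partial_deriv_add_single dir_deriv_commute del: One_nat_def)
qed (use assms in simp)

lemma partial_deriv_add:
  assumes "p \<in> poly_maps" "q \<in> poly_maps"
  shows "partial_deriv \<alpha> (p + q) = partial_deriv \<alpha> p + partial_deriv \<alpha> q"
  using assms by (induction \<alpha> rule: expo_induct)
    (simp_all add: partial_deriv_add_single subspace_add dir_deriv_add del: One_nat_def)

lemma partial_deriv_scale:
  assumes "p \<in> poly_maps"
  shows "partial_deriv \<alpha> (r *\<^sub>R p) = r *\<^sub>R partial_deriv \<alpha> p"
  using assms by (induction \<alpha> rule: expo_induct)
    (simp_all add: partial_deriv_add_single subspace_scale dir_deriv_scale del: One_nat_def)

lemma partial_deriv_of_zero [simp]: "partial_deriv \<alpha> (0::real^'n \<Rightarrow> real^'m) = 0"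
  using partial_deriv_scale[of "0::real^'n \<Rightarrow> real^'m" \<alpha> 0] by (simp add: subspace_0)

lemma partial_deriv_sum:
  assumes "\<And>i. i \<in> A \<Longrightarrow> q i \<in> poly_maps"
  shows "partial_deriv \<alpha> (\<Sum>i\<in>A. q i) = (\<Sum>i\<in>A. partial_deriv \<alpha> (q i))"
  using assms by (induction A rule: infinite_finite_induct) (auto simp: partial_deriv_add subspace_sum)

lemma partial_deriv_sym_maps:
  assumes "q \<in> sym_maps (mdeg \<alpha> + k)"
  shows "partial_deriv \<alpha> q \<in> sym_maps k"
  using assms
proof (induction \<alpha> arbitrary: k rule: expo_induct)
  case zero
  then show ?case by (simp add: sym_maps_poly_maps)
next
  case (add i \<alpha>)
  then have "q \<in> sym_maps (mdeg \<alpha> + Suc k)" by (simp add: mdeg_add)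
  then show ?case using add(1) by (simp add: partial_deriv_add_single sym_maps_poly_maps dir_deriv_sym_maps del: One_nat_def)
qed

lemma partial_deriv_sym_maps_less:
  assumes "q \<in> sym_maps k" "k < mdeg \<alpha>"
  shows "partial_deriv \<alpha> q = 0"
  using assms
proof (induction \<alpha> rule: expo_induct)
  case (add i \<alpha>)
  then have q: "q \<in> poly_maps" by (simp add: sym_maps_poly_maps)
  show ?case
  proof (cases "k < mdeg \<alpha>")
    case True
    then show ?thesis using add q by (simp add: partial_deriv_add_single del: One_nat_def)
  next
    case False
    then have "k = mdeg \<alpha>" using add by (simp add: mdeg_add)
    then have "q \<in> sym_maps (mdeg \<alpha> + 0)" using add by simp
    from partial_deriv_sym_maps[OF this] show ?thesis
      using q by (simp add: partial_deriv_add_single dir_deriv_sym_maps_0 del: One_nat_def)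
  qed
qed simp

lemma partial_deriv_sym_maps_at_0:
  assumes "q \<in> sym_maps k" "k \<noteq> mdeg \<alpha>"
  shows "partial_deriv \<alpha> q 0 = 0"
proof (cases "k < mdeg \<alpha>")
  case True
  then show ?thesis using partial_deriv_sym_maps_less[OF assms(1)] by (simp add: zero_fun_apply)
next
  case False
  then have "k = mdeg \<alpha> + Suc (k - mdeg \<alpha> - 1)" using assms(2) by simp
  then have "partial_deriv \<alpha> q \<in> sym_maps (Suc (k - mdeg \<alpha> - 1))"
    using partial_deriv_sym_maps assms(1) by metis
  then show ?thesis by (rule sym_maps_at_0)
qed

text \<open>Derivatives at 0 are dual to the monomials up to nonzero factors; \<open>r\<close> is
  the multi-index factorial of \<open>\<alpha>\<close>. Coefficients of a polynomial can thus be
  recovered from its values.\<close>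

lemma partial_deriv_vmon_at_0:
  "\<exists>r. r \<noteq> 0 \<and> (\<forall>\<beta>. partial_deriv \<alpha> (vmon \<beta> c) 0 = (if \<alpha> = \<beta> then r *\<^sub>R c else 0))"
proof (induction \<alpha> arbitrary: c rule: expo_induct)
  case zero
  show ?case
  proof (intro exI[of _ 1] conjI allI)
    fix \<beta> :: "'a \<Rightarrow>\<^sub>0 nat"
    show "partial_deriv 0 (vmon \<beta> c) 0 = (if 0 = \<beta> then 1 *\<^sub>R c else 0)"
    proof (cases "\<beta> = 0")
      case True
      moreover have "vmon 0 c 0 = c" by (simp add: vmon_def)
      ultimately show ?thesis by simp
    next
      case False
      then have "mdeg \<beta> \<noteq> 0" by (auto simp: mdeg_def intro: poly_mapping_eqI)
      then show ?thesis using False partial_deriv_sym_maps_at_0[OF vmon_sym_maps, of \<beta> 0 c] by simp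
    qed
  qed simp
next
  case (add i \<alpha>)
  have "\<exists>r. r \<noteq> 0 \<and> (\<forall>\<beta>. partial_deriv \<alpha> (vmon \<beta> c) 0 = (if \<alpha> = \<beta> then r *\<^sub>R c else 0))" for c :: "real^'b"
    using add .
  then have "\<exists>r. r \<noteq> 0 \<and> (\<forall>\<beta>. partial_deriv \<alpha> (vmon \<beta> c) 0 = (if \<alpha> = \<beta> then r *\<^sub>R c else 0))" by blast
  then obtain r where r: "r \<noteq> 0" "\<And>\<beta>. partial_deriv \<alpha> (vmon \<beta> c) 0 = (if \<alpha> = \<beta> then r *\<^sub>R c else 0)" by blast
  show ?case
  proof (intro exI[of _ "r * (1 + real (Poly_Mapping.lookup \<alpha> i))"] conjI allI)
    fix \<beta>
    have "partial_deriv (Poly_Mapping.single i 1 + \<alpha>) (vmon \<beta> c) =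
       partial_deriv \<alpha> (dir_deriv (axis i 1) (vmon \<beta> c))"
      by (simp add: partial_deriv_add_single partial_deriv_dir_deriv del: One_nat_def)
    also have "\<dots> = real (Poly_Mapping.lookup \<beta> i) *\<^sub>R partial_deriv \<alpha> (vmon (\<beta> - Poly_Mapping.single i 1) c)"
      by (simp add: dir_deriv_axis_vmon vmon_scale partial_deriv_scale)
    finally have e: "partial_deriv (Poly_Mapping.single i 1 + \<alpha>) (vmon \<beta> c) 0 =
      real (Poly_Mapping.lookup \<beta> i) *\<^sub>R (if \<alpha> = \<beta> - Poly_Mapping.single i 1 then r *\<^sub>R c else 0)"
      using r by (simp add: scaleR_fun_def)
    show "partial_deriv (Poly_Mapping.single i 1 + \<alpha>) (vmon \<beta> c) 0 =
      (if Poly_Mapping.single i 1 + \<alpha> = \<beta> then (r * (1 + real (Poly_Mapping.lookup \<alpha> i))) *\<^sub>R c else 0)"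
    proof (cases "Poly_Mapping.lookup \<beta> i = 0")
      case True
      then have "Poly_Mapping.single i 1 + \<alpha> \<noteq> \<beta>" by (auto simp: lookup_add)
      then show ?thesis using e True by simp
    next
      case False
      have "\<alpha> = \<beta> - Poly_Mapping.single i 1 \<longleftrightarrow> Poly_Mapping.single i 1 + \<alpha> = \<beta>"
        using single_add_minus[OF False] by (metis add_diff_cancel_left')
      then show ?thesis unfolding e by (auto simp: lookup_add mult.commute)
    qed
  next
    show "r * (1 + real (Poly_Mapping.lookup \<alpha> i)) \<noteq> 0" using r(1)
      by (metis add_nonneg_eq_0_iff mult_eq_0_iff of_nat_0_le_iff zero_le_one zero_neq_one)
  qed
qed

text \<open>A nonzero form can be differentiated, one variable at a time, down to a nonzero
  constant.\<close>

lemma ex_partial_deriv_nonzero: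
  assumes "q \<in> sym_maps k" "q \<noteq> 0"
  shows "\<exists>\<alpha>. mdeg \<alpha> = k \<and> partial_deriv \<alpha> q 0 \<noteq> 0"
  using assms
proof (induction k arbitrary: q)
  case 0
  then obtain c where "q = (\<lambda>x. c)" by (auto simp: sym_maps_0_iff)
  then have "q 0 \<noteq> 0" using 0 by (auto simp: zero_fun_def)
  then show ?case using 0 by (intro exI[of _ 0]) (simp add: sym_maps_poly_maps)
next
  case (Suc k)
  then obtain i where "dir_deriv (axis i 1) q \<noteq> 0" using sym_maps_deriv_zero by blast
  then obtain \<alpha> where \<alpha>: "mdeg \<alpha> = k" "partial_deriv \<alpha> (dir_deriv (axis i 1) q) 0 \<noteq> 0"
    using Suc(1)[OF dir_deriv_sym_maps[OF Suc(2)]] by blast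
  then show ?case using sym_maps_poly_maps[OF Suc(2)]
    by (intro exI[of _ "Poly_Mapping.single i 1 + \<alpha>"])
      (simp add: mdeg_add partial_deriv_add_single partial_deriv_dir_deriv del: One_nat_def)
qed

lemma partial_deriv_homogeneous_sum_at_0:
  assumes "finite A" "\<And>k. k \<in> A \<Longrightarrow> r k \<in> sym_maps k" "mdeg \<alpha> \<in> A"
  shows "partial_deriv \<alpha> (\<Sum>k\<in>A. r k) 0 = partial_deriv \<alpha> (r (mdeg \<alpha>)) 0"
proof -
  have "partial_deriv \<alpha> (\<Sum>k\<in>A. r k) 0 = (\<Sum>k\<in>A. partial_deriv \<alpha> (r k) 0)"
    by (subst partial_deriv_sum) (use assms(2) sym_maps_poly_maps in \<open>auto simp: sum_fun_apply\<close>)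
  also have "\<dots> = (\<Sum>k\<in>A. if k = mdeg \<alpha> then partial_deriv \<alpha> (r (mdeg \<alpha>)) 0 else 0)"
    by (rule sum.cong) (use assms(2) partial_deriv_sym_maps_at_0 in auto)
  also have "\<dots> = partial_deriv \<alpha> (r (mdeg \<alpha>)) 0" using assms by simp
  finally show ?thesis .
qed

text \<open>A derivative of order k taken at 0 sees only the component of degree k.\<close>

lemma sym_maps_graded_independent:
  assumes "finite A" "\<And>k. k \<in> A \<Longrightarrow> r k \<in> sym_maps k" "(\<Sum>k\<in>A. r k) = 0" "k \<in> A"
  shows "r k = 0"
proof (rule ccontr)
  assume "r k \<noteq> 0"
  then obtain \<alpha> where "mdeg \<alpha> = k" "partial_deriv \<alpha> (r k) 0 \<noteq> 0"
    using ex_partial_deriv_nonzero assms(2,4) by blast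
  then show False using partial_deriv_homogeneous_sum_at_0[OF assms(1,2), of \<alpha>] assms(3,4)
    by (simp add: zero_fun_apply)
qed

lemma ex_partial_deriv_nonzero_poly_maps:
  assumes "q \<in> poly_maps" "q \<noteq> 0"
  shows "\<exists>\<alpha>. partial_deriv \<alpha> q 0 \<noteq> 0"
proof -
  obtain K r where r: "\<And>k. r k \<in> sym_maps k" "q = (\<Sum>k<K. r k)"
    using poly_maps_homogeneous_sum[OF assms(1)] by blast
  then obtain k where k: "k < K" "r k \<noteq> 0" using assms(2) by (metis lessThan_iff sum.neutral)
  then obtain \<alpha> where "mdeg \<alpha> = k" "partial_deriv \<alpha> (r k) 0 \<noteq> 0"
    using ex_partial_deriv_nonzero r(1) by blast
  then show ?thesis using partial_deriv_homogeneous_sum_at_0[of "{..<K}" r \<alpha>] r k by auto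
qed

section \<open>Formal polynomials acting as differential operators\<close>

text \<open>The common shape of \<open>diff_op\<close> and \<open>mpoly_eval\<close>. Additivity is
  proved once here, where the sums are moved to a common index set because cancellation may shrink
  the support of \<open>F + G\<close>.\<close>

definition coeff_sum :: "('k \<Rightarrow> 'c \<Rightarrow> 'b) \<Rightarrow> ('k \<Rightarrow>\<^sub>0 'c::zero) \<Rightarrow> 'b::comm_monoid_add" where
  "coeff_sum \<phi> F = (\<Sum>\<alpha>\<in>Poly_Mapping.keys F. \<phi> \<alpha> (Poly_Mapping.lookup F \<alpha>))"

lemma coeff_sum_superset:
  assumes "finite A" "Poly_Mapping.keys F \<subseteq> A" "\<And>\<alpha>. \<phi> \<alpha> 0 = 0"
  shows "coeff_sum \<phi> F = (\<Sum>\<alpha>\<in>A. \<phi> \<alpha> (Poly_Mapping.lookup F \<alpha>))"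
  unfolding coeff_sum_def
  by (rule sum.mono_neutral_left) (use assms in \<open>auto simp: in_keys_iff\<close>)

lemma coeff_sum_add:
  fixes F G :: "'k \<Rightarrow>\<^sub>0 'c::monoid_add"
  assumes "\<And>\<alpha>. \<phi> \<alpha> 0 = 0" "\<And>\<alpha> c d. \<phi> \<alpha> (c + d) = \<phi> \<alpha> c + \<phi> \<alpha> d"
  shows "coeff_sum \<phi> (F + G) = coeff_sum \<phi> F + coeff_sum \<phi> G"
proof -
  let ?A = "Poly_Mapping.keys F \<union> Poly_Mapping.keys G"
  have "coeff_sum \<phi> H = (\<Sum>\<alpha>\<in>?A. \<phi> \<alpha> (Poly_Mapping.lookup H \<alpha>))" if "Poly_Mapping.keys H \<subseteq> ?A" for H
    by (rule coeff_sum_superset) (use that assms in auto)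
  from this[of F] this[of G] this[of "F + G"] show ?thesis
    using keys_add[of F G] assms by (simp add: lookup_add sum.distrib)
qed

lemma coeff_sum_single:
  assumes "\<And>\<alpha>. \<phi> \<alpha> 0 = 0"
  shows "coeff_sum \<phi> (Poly_Mapping.single \<alpha> c) = \<phi> \<alpha> c"
  using assms by (cases "c = 0") (simp_all add: coeff_sum_def)

lemma poly_mapping_induct_single [case_names single add]:
  assumes "\<And>\<alpha> c. P (Poly_Mapping.single \<alpha> c)" "\<And>F G. P F \<Longrightarrow> P G \<Longrightarrow> P (F + G)"
  shows "P (F :: 'k \<Rightarrow>\<^sub>0 'c::comm_monoid_add)"
proof -
  have "F = (\<Sum>\<alpha>\<in>Poly_Mapping.keys F. Poly_Mapping.single \<alpha> (Poly_Mapping.lookup F \<alpha>))"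
    by (rule poly_mapping_eqI)
      (auto simp: lookup_sum lookup_single when_def in_keys_iff)
  moreover have "P (\<Sum>\<alpha>\<in>A. Poly_Mapping.single \<alpha> (Poly_Mapping.lookup F \<alpha>))" for A
  proof (induction A rule: infinite_finite_induct)
    case (insert \<alpha> A)
    then show ?case using assms by simp
  qed (use assms(1)[of undefined 0] in simp_all)
  ultimately show ?thesis by metis
qed

definition pvar :: "'n \<Rightarrow> ('n \<Rightarrow>\<^sub>0 nat) \<Rightarrow>\<^sub>0 'c::comm_semiring_1" where
  "pvar i = Poly_Mapping.single (Poly_Mapping.single i 1) 1"

definition pconst :: "'c \<Rightarrow> ('n \<Rightarrow>\<^sub>0 nat) \<Rightarrow>\<^sub>0 'c::comm_semiring_1" where
  "pconst c = Poly_Mapping.single 0 c"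

lemma single_pvar_mult:
  "Poly_Mapping.single (Poly_Mapping.single i 1 + \<alpha>) (c::'c::comm_semiring_1) = pvar i * Poly_Mapping.single \<alpha> c"
  by (simp add: pvar_def mult_single)

lemma poly_induct [case_names const mult add]:
  fixes F :: "('n::finite \<Rightarrow>\<^sub>0 nat) \<Rightarrow>\<^sub>0 'c::comm_semiring_1"
  assumes "\<And>c. P (pconst c)" "\<And>i F. P F \<Longrightarrow> P (pvar i * F)" "\<And>F G. P F \<Longrightarrow> P G \<Longrightarrow> P (F + G)"
  shows "P F"
proof (induction F rule: poly_mapping_induct_single)
  case (single \<alpha> c)
  then show ?case
  proof (induction \<alpha> rule: expo_induct)
    case zero
    show ?case using assms(1)[of c] by (simp add: pconst_def)
  next
    case (add i \<alpha>)
    then show ?case using assms(2) by (simp only: single_pvar_mult)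
  qed
qed (use assms in simp)

lemma diff_op_coeff_sum: "diff_op F q = coeff_sum (\<lambda>\<alpha> c. c *\<^sub>R partial_deriv \<alpha> q) F"
  by (simp add: diff_op_def coeff_sum_def)

lemma diff_op_add: "diff_op (F + G) q = diff_op F q + diff_op G q"
  unfolding diff_op_coeff_sum by (rule coeff_sum_add) (simp_all add: scaleR_left_distrib)

lemma diff_op_zero [simp]: "diff_op 0 q = 0"
  by (simp add: diff_op_def)

lemma diff_op_single: "diff_op (Poly_Mapping.single \<alpha> c) q = c *\<^sub>R partial_deriv \<alpha> q"
  unfolding diff_op_coeff_sum by (rule coeff_sum_single) simp

lemma diff_op_pconst: "q \<in> poly_maps \<Longrightarrow> diff_op (pconst c) q = c *\<^sub>R q"
  by (simp add: pconst_def diff_op_single)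

lemma diff_op_poly_maps [simp]: "q \<in> poly_maps \<Longrightarrow> diff_op F q \<in> poly_maps"
  unfolding diff_op_def by (intro subspace_sum subspace_scale) auto

lemma diff_op_pvar_mult:
  assumes "q \<in> poly_maps"
  shows "diff_op (pvar i * F) q = dir_deriv (axis i 1) (diff_op F q)"
proof (induction F rule: poly_mapping_induct_single)
  case (single \<alpha> c)
  show ?case using assms
    by (simp add: single_pvar_mult[symmetric] diff_op_single partial_deriv_add_single dir_deriv_scale del: One_nat_def)
next
  case (add F G)
  then show ?case using assms by (simp add: distrib_left diff_op_add dir_deriv_add)
qed

lemma lin_on_diff_op: "lin_on poly_maps (diff_op F)"
  unfolding lin_on_def diff_op_def
  by (simp add: partial_deriv_add partial_deriv_scale scaleR_add_right sum.distrib scaleR_sum_right mult.commute)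

lemma diff_op_of_zero [simp]: "diff_op F 0 = (0::real^'n \<Rightarrow> real^'m)"
  by (simp add: diff_op_def)

text \<open>This makes polynomial maps a module over \<open>ST\<close>. By
  \<open>poly_induct\<close> it comes down to constants and single variables.\<close>

lemma diff_op_mult:
  assumes "q \<in> poly_maps"
  shows "diff_op (F * G) q = diff_op F (diff_op G q)"
proof (induction F rule: poly_induct)
  case (const c)
  show ?case
  proof (induction G rule: poly_mapping_induct_single)
    case (single \<alpha> d)
    then show ?case using assms by (simp add: pconst_def mult_single diff_op_single subspace_scale)
  next
    case (add F G)
    then show ?case using assms by (simp add: distrib_left diff_op_add diff_op_pconst scaleR_add_right subspace_add)
  qed
next
  case (mult i F)
  then show ?case using assms by (simp add: mult.assoc diff_op_pvar_mult)
next
  case (add F G)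
  then show ?case using assms by (simp add: distrib_right diff_op_add)
qed

section \<open>Homogeneous operators\<close>

text \<open>The degree is an argument and 0 has every degree, so each graded piece is closed under
  addition.\<close>

definition hom_poly :: "nat \<Rightarrow> (('n::finite \<Rightarrow>\<^sub>0 nat) \<Rightarrow>\<^sub>0 'c::zero) \<Rightarrow> bool" where
  "hom_poly k F \<longleftrightarrow> (\<forall>\<alpha>\<in>Poly_Mapping.keys F. mdeg \<alpha> = k)"

lemma hom_poly_zero [simp]: "hom_poly k 0"
  by (simp add: hom_poly_def)

lemma hom_poly_add:
  fixes F G :: "('n::finite \<Rightarrow>\<^sub>0 nat) \<Rightarrow>\<^sub>0 'c::comm_monoid_add"
  shows "hom_poly k F \<Longrightarrow> hom_poly k G \<Longrightarrow> hom_poly k (F + G)"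
  using keys_add[of F G] unfolding hom_poly_def by blast

lemma hom_poly_single: "mdeg \<alpha> = k \<Longrightarrow> hom_poly k (Poly_Mapping.single \<alpha> c)"
  by (auto simp: hom_poly_def split: if_splits)

lemma hom_poly_pconst: "hom_poly 0 (pconst c)"
  by (simp add: pconst_def hom_poly_single)

lemma hom_poly_mult:
  fixes F G :: "('n::finite \<Rightarrow>\<^sub>0 nat) \<Rightarrow>\<^sub>0 'c::comm_semiring_1"
  assumes "hom_poly k F" "hom_poly l G"
  shows "hom_poly (k + l) (F * G)"
  using keys_mult[of F G] assms unfolding hom_poly_def by (fastforce simp: mdeg_add)

lemma hom_poly_pvar: "hom_poly 1 (pvar i)"
  unfolding pvar_def by (rule hom_poly_single) simp

lemma hom_poly_induct [consumes 1, case_names single zero add]: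
  fixes F :: "('n::finite \<Rightarrow>\<^sub>0 nat) \<Rightarrow>\<^sub>0 'c::comm_monoid_add"
  assumes "hom_poly k F" "\<And>\<alpha> c. mdeg \<alpha> = k \<Longrightarrow> P (Poly_Mapping.single \<alpha> c)" "P 0"
    "\<And>F G. P F \<Longrightarrow> P G \<Longrightarrow> P (F + G)"
  shows "P F"
proof -
  have "F = (\<Sum>\<alpha>\<in>Poly_Mapping.keys F. Poly_Mapping.single \<alpha> (Poly_Mapping.lookup F \<alpha>))"
    by (rule poly_mapping_eqI)
      (auto simp: lookup_sum lookup_single when_def in_keys_iff)
  moreover have "A \<subseteq> Poly_Mapping.keys F \<Longrightarrow> P (\<Sum>\<alpha>\<in>A. Poly_Mapping.single \<alpha> (Poly_Mapping.lookup F \<alpha>))" for A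
  proof (induction A rule: infinite_finite_induct)
    case (insert \<alpha> A)
    then have "mdeg \<alpha> = k" using assms(1) by (auto simp: hom_poly_def)
    then show ?case using assms insert by simp
  qed (use assms in simp_all)
  ultimately show ?thesis by (metis order_refl)
qed

lemma diff_op_hom_sym_maps:
  assumes "hom_poly k F" "q \<in> sym_maps (k + l)"
  shows "diff_op F q \<in> sym_maps l"
  using assms(1)
proof (induction rule: hom_poly_induct)
  case (single \<alpha> c)
  then show ?case using partial_deriv_sym_maps[of q \<alpha> l] assms(2) by (simp add: diff_op_single subspace_scale)
qed (simp_all add: subspace_0 diff_op_add subspace_add)

lemma diff_op_hom_less:
  assumes "hom_poly k F" "q \<in> sym_maps l" "l < k"
  shows "diff_op F q = 0"
  using assms(1)
proof (induction rule: hom_poly_induct)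
  case (single \<alpha> c)
  then show ?case using partial_deriv_sym_maps_less[of q l \<alpha>] assms by (simp add: diff_op_single)
qed (simp_all add: diff_op_add)

lemma homogeneous_decomp:
  fixes F :: "('n::finite \<Rightarrow>\<^sub>0 nat) \<Rightarrow>\<^sub>0 'c::comm_monoid_add"
  obtains K G where "\<And>k. hom_poly k (G k)" "F = (\<Sum>k<K. G k)"
proof -
  have "\<exists>K G. (\<forall>k. hom_poly k (G k)) \<and> (\<forall>k\<ge>K. G k = 0) \<and> F = (\<Sum>k<K. G k)"
  proof (induction F rule: poly_mapping_induct_single)
    case (single \<alpha> c)
    show ?case
      by (rule exI[of _ "Suc (mdeg \<alpha>)"], rule exI[of _ "\<lambda>k. if k = mdeg \<alpha> then Poly_Mapping.single \<alpha> c else 0"])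
        (simp add: hom_poly_single)
  next
    case (add p q)
    obtain K r where r: "\<forall>k. hom_poly k (r k)" "\<forall>k\<ge>K. r k = 0" "p = (\<Sum>k<K. r k)" using add by metis
    obtain L s where s: "\<forall>k. hom_poly k (s k)" "\<forall>k\<ge>L. s k = 0" "q = (\<Sum>k<L. s k)" using add by metis
    have "p = (\<Sum>k<max K L. r k)" unfolding r(3) by (rule sum.mono_neutral_left) (use r in auto)
    moreover have "q = (\<Sum>k<max K L. s k)" unfolding s(3) by (rule sum.mono_neutral_left) (use s in auto)
    ultimately show ?case
      by (intro exI[of _ "max K L"] exI[of _ "\<lambda>k. r k + s k"]) (use r s in \<open>auto simp: hom_poly_add sum.distrib\<close>)
  qed
  then show ?thesis using that by blast
qed

lemma diff_op_sum: "diff_op (\<Sum>i\<in>A. F i) q = (\<Sum>i\<in>A. diff_op (F i) q)"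
  by (induction A rule: infinite_finite_induct) (simp_all add: diff_op_add)

text \<open>The homogeneous components of an operator have values in different degrees.\<close>

lemma diff_op_component_zero:
  assumes "\<And>k. hom_poly k (G k)" "q \<in> sym_maps l" "diff_op (\<Sum>k<K. G k) q = 0" "k < K"
  shows "diff_op (G k) q = 0"
proof (cases "k \<le> l")
  case True
  \<comment> \<open>The sum is reindexed by the degree \<open>l - k\<close> of the value, so that
    independence of the graded pieces applies.\<close>
  let ?r = "\<lambda>j. if l - j < K then diff_op (G (l - j)) q else 0"
  have r: "?r j \<in> sym_maps j" if "j \<in> {..l}" for j
    using diff_op_hom_sym_maps[OF assms(1)[of "l - j"], of q j] assms(2) that by (simp add: subspace_0)
  have "0 = (\<Sum>k<K. diff_op (G k) q)" using assms(3) by (simp add: diff_op_sum)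
  also have "\<dots> = (\<Sum>k\<in>{..<K} \<inter> {..l}. diff_op (G k) q)"
    by (rule sum.mono_neutral_right) (use diff_op_hom_less[OF assms(1,2)] in auto)
  also have "\<dots> = (\<Sum>k\<in>{..l}. if k < K then diff_op (G k) q else 0)"
    by (rule sum.mono_neutral_cong_left) auto
  also have "\<dots> = (\<Sum>j\<in>{..l}. ?r j)"
    by (rule sum.reindex_bij_witness[of _ "\<lambda>j. l - j" "\<lambda>j. l - j"]) auto
  finally have "?r (l - k) = 0"
    using sym_maps_graded_independent[of "{..l}" ?r "l - k"] r by auto
  then show ?thesis using True assms(4) by simp
next
  case False
  then show ?thesis using diff_op_hom_less[OF assms(1,2)] by simp
qed


section \<open>Alternating forms\<close>

text \<open>The conditions of \<open>forms\<close> on lists of length \<open>j\<close>, over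
  arbitrary vector spaces: they apply both to polynomial-valued forms and to the real elementary
  forms that serve as a basis.\<close>

definition alt_form :: "nat \<Rightarrow> ('a::real_vector list \<Rightarrow> 'b::real_vector) \<Rightarrow> bool" where
  "alt_form j \<omega> \<longleftrightarrow>
    (\<forall>vs i. length vs = j \<and> i < j \<longrightarrow> linear (\<lambda>v. \<omega> (vs[i := v]))) \<and>
    (\<forall>vs. length vs = j \<and> \<not> distinct vs \<longrightarrow> \<omega> vs = 0)"

lemma forms_alt_form:
  "\<omega> \<in> forms j V \<longleftrightarrow>
    (\<forall>vs. length vs \<noteq> j \<longrightarrow> \<omega> vs = 0) \<and> (\<forall>vs. length vs = j \<longrightarrow> \<omega> vs \<in> V) \<and> alt_form j \<omega>"
  by (simp add: forms_def alt_form_def)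

lemma alt_form_linear:
  assumes "alt_form j \<omega>" "length xs + Suc (length ys) = j"
  shows "linear (\<lambda>v. \<omega> (xs @ v # ys))"
proof -
  have "length (xs @ 0 # ys) = j" "length xs < j" using assms(2) by auto
  then have "linear (\<lambda>v. \<omega> ((xs @ 0 # ys)[length xs := v]))"
    using assms(1) unfolding alt_form_def by blast
  then show ?thesis by simp
qed

lemma alt_form_repeat:
  assumes "alt_form j \<omega>" "length vs = j" "\<not> distinct vs"
  shows "\<omega> vs = 0"
  using assms unfolding alt_form_def by blast

text \<open>Expand the vanishing value with \<open>a + b\<close> in both slots.\<close>

lemma alt_form_swap:
  assumes "alt_form j \<omega>" "length xs + Suc (Suc (length ys)) = j"
  shows "\<omega> (xs @ a # b # ys) = - \<omega> (xs @ b # a # ys)"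
proof -
  have l1: "linear (\<lambda>v. \<omega> (xs @ v # c # ys))" for c
    using alt_form_linear[OF assms(1), of xs "c # ys"] assms(2) by simp
  have l2: "linear (\<lambda>v. \<omega> (xs @ c # v # ys))" for c
    using alt_form_linear[OF assms(1), of "xs @ [c]" ys] assms(2) by simp
  have z: "\<omega> (xs @ c # c # ys) = 0" for c
    by (rule alt_form_repeat[OF assms(1)]) (use assms(2) in auto)
  have "0 = \<omega> (xs @ (a + b) # (a + b) # ys)" using z by simp
  also have "\<dots> = \<omega> (xs @ a # b # ys) + \<omega> (xs @ b # a # ys)"
    using z[of a] z[of b] by (simp only: linear_add[OF l1] linear_add[OF l2]) simp
  finally have "\<omega> (xs @ a # b # ys) + \<omega> (xs @ b # a # ys) = 0" by (rule sym)
  then show ?thesis by (simp add: eq_neg_iff_add_eq_0)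
qed

lemma alt_form_move:
  assumes "alt_form j \<omega>" "length xs + length ys + Suc (length zs) = j"
  shows "\<omega> (xs @ ys @ a # zs) = (-1) ^ length ys *\<^sub>R \<omega> (xs @ a # ys @ zs)"
  using assms(2)
proof (induction ys arbitrary: xs)
  case (Cons b ys)
  have "\<omega> ((xs @ [b]) @ ys @ a # zs) = (-1) ^ length ys *\<^sub>R \<omega> ((xs @ [b]) @ a # ys @ zs)"
    by (rule Cons.IH) (use Cons in simp)
  moreover have "\<omega> (xs @ b # a # ys @ zs) = - \<omega> (xs @ a # b # ys @ zs)"
    by (rule alt_form_swap[OF assms(1)]) (use Cons in simp)
  ultimately show ?case by simp
qed simp

text \<open>The Spencer differential is the case where \<open>B\<close> is differentiation; exterior
  multiplication by a coordinate covector is the case where \<open>B\<close> multiplies by that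
  coordinate. Alternation is proved once for both.\<close>

definition wedge :: "('a \<Rightarrow> 'b \<Rightarrow> 'c::real_vector) \<Rightarrow> ('a list \<Rightarrow> 'b) \<Rightarrow> 'a list \<Rightarrow> 'c" where
  "wedge B \<omega> vs = (\<Sum>l<length vs. (-1) ^ l *\<^sub>R B (vs ! l) (\<omega> (take l vs @ drop (Suc l) vs)))"

lemma spencer_d_wedge: "spencer_d = wedge dir_deriv"
  by (intro ext) (simp add: spencer_d_def wedge_def)

lemma nth_remove_nth:
  assumes "i \<noteq> l" "i < length vs" "l < length vs"
  shows "(take l vs @ drop (Suc l) vs) ! (if i < l then i else i - 1) = vs ! i"
  using assms by (auto simp: nth_append)

lemma remove_nth_update:
  assumes "i \<noteq> l" "i < length vs" "l < length vs"
  shows "take l (vs[i := v]) @ drop (Suc l) (vs[i := v]) =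
    (take l vs @ drop (Suc l) vs)[(if i < l then i else i - 1) := v]"
proof (cases "i < l")
  case True
  then show ?thesis using assms by (simp add: take_update_swap list_update_append)
next
  case False
  then obtain k where "i = Suc k" "l \<le> k" using assms by (cases i) auto
  then show ?thesis using assms by (simp add: drop_update_swap list_update_append)
qed

lemma linear_lin_on_comp:
  assumes "linear f" "lin_on V h" "\<And>x. f x \<in> V"
  shows "linear (\<lambda>x. h (f x))"
  using assms by (intro linearI) (auto simp: linear_add linear_scale lin_on_def)

text \<open>If two arguments agree, only the two terms that remove one of them survive. Moving the
  other across the \<open>ys\<close> in between shows that they are equal up to sign, and the signs
  cancel.\<close>

lemma alt_form_wedge:
  assumes alt: "alt_form j \<omega>" and V: "\<And>vs. length vs = j \<Longrightarrow> \<omega> vs \<in> V"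
    and B: "\<And>v. lin_on V (B v)" "\<And>x. x \<in> V \<Longrightarrow> linear (\<lambda>v. B v x)"
  shows "alt_form (Suc j) (wedge B \<omega>)"
  unfolding alt_form_def
proof (intro conjI allI impI; elim conjE)
  fix vs :: "'a list" and i
  assume vs: "length vs = Suc j" "i < Suc j"
  have "linear (\<lambda>v. (-1) ^ l *\<^sub>R B (vs[i := v] ! l) (\<omega> (take l (vs[i := v]) @ drop (Suc l) (vs[i := v]))))"
    if "l < Suc j" for l
  proof (rule linear_compose_scale_right)
    show "linear (\<lambda>v. B (vs[i := v] ! l) (\<omega> (take l (vs[i := v]) @ drop (Suc l) (vs[i := v]))))"
    proof (cases "l = i")
      case True
      have "\<omega> (take i vs @ drop (Suc i) vs) \<in> V" by (rule V) (use vs in simp)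
      then show ?thesis using B(2) True vs by simp
    next
      case False
      let ?us = "take l vs @ drop (Suc l) vs"
      \<comment> \<open>Removing slot \<open>l\<close> shifts the later slots down by one.\<close>
      let ?k = "if i < l then i else i - 1"
      have us: "length ?us = j" "?k < j" using vs that False by auto
      then have "linear (\<lambda>v. \<omega> (?us[?k := v]))" using alt unfolding alt_form_def by blast
      then have "linear (\<lambda>v. B (vs ! l) (\<omega> (?us[?k := v])))"
        by (rule linear_lin_on_comp[OF _ B(1)]) (use us V in simp)
      then show ?thesis using remove_nth_update[of i l vs] False vs that by simp
    qed
  qed
  then have "linear (\<lambda>v. \<Sum>l<Suc j. (-1) ^ l *\<^sub>R B (vs[i := v] ! l) (\<omega> (take l (vs[i := v]) @ drop (Suc l) (vs[i := v]))))"
    by (intro linear_compose_sum) simp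
  then show "linear (\<lambda>v. wedge B \<omega> (vs[i := v]))"
    by (simp only: wedge_def length_list_update vs)
next
  fix vs :: "'a list"
  assume vs: "length vs = Suc j" "\<not> distinct vs"
  obtain xs ys zs u where d: "vs = xs @ [u] @ ys @ [u] @ zs" using not_distinct_decomp[OF vs(2)] by blast
  let ?a = "length xs" and ?b = "Suc (length xs + length ys)"
  let ?t = "\<lambda>l. (-1) ^ l *\<^sub>R B (vs ! l) (\<omega> (take l vs @ drop (Suc l) vs))"
  \<comment> \<open>\<open>B v\<close> is additive only on \<open>V\<close>; the value of
    \<open>\<omega>\<close> on a list of zeros supplies an element of \<open>V\<close> to scale by
    0.\<close>
  have B0: "B v 0 = 0" for v
  proof -
    have "\<omega> (replicate j 0) \<in> V" using V by simp
    then show ?thesis using B(1)[of v] unfolding lin_on_def by (metis scale_zero_left)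
  qed
  have z: "?t l = 0" if l: "l < length vs" "l \<noteq> ?a" "l \<noteq> ?b" for l
  proof -
    let ?us = "take l vs @ drop (Suc l) vs"
    let ?k = "\<lambda>i. if i < l then i else i - 1"
    have "vs ! ?a = u" "vs ! ?b = u" unfolding d by (auto simp: nth_append)
    then have "?us ! ?k ?a = ?us ! ?k ?b"
      using nth_remove_nth[of ?a l vs] nth_remove_nth[of ?b l vs] l d by simp
    moreover have "?k ?a < length ?us" "?k ?b < length ?us" "?k ?a \<noteq> ?k ?b" using l d by auto
    ultimately have "\<not> distinct ?us" unfolding distinct_conv_nth by blast
    then have "\<omega> ?us = 0" by (intro alt_form_repeat[OF alt]) (use l vs in auto)
    then show ?thesis using B0 by simp
  qed
  have "wedge B \<omega> vs = (\<Sum>l\<in>{?a, ?b}. ?t l)"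
    unfolding wedge_def by (rule sum.mono_neutral_right) (use z d in auto)
  also have "\<dots> = ?t ?a + ?t ?b" by simp
  also have "\<dots> = (-1) ^ ?a *\<^sub>R B u (\<omega> (xs @ ys @ u # zs)) + (-1) ^ ?b *\<^sub>R B u (\<omega> (xs @ u # ys @ zs))"
    unfolding d by (simp add: nth_append)
  also have "\<omega> (xs @ ys @ u # zs) = (-1) ^ length ys *\<^sub>R \<omega> (xs @ u # ys @ zs)"
    by (rule alt_form_move[OF alt]) (use vs d in simp)
  also have "B u ((-1) ^ length ys *\<^sub>R \<omega> (xs @ u # ys @ zs)) = (-1) ^ length ys *\<^sub>R B u (\<omega> (xs @ u # ys @ zs))"
    using B(1)[of u] V[of "xs @ u # ys @ zs"] vs d unfolding lin_on_def by simp
  finally show "wedge B \<omega> vs = 0" by (simp add: power_add)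
qed

text \<open>A permutation of the arguments changes only the sign. Recording just the vanishing
  avoids signs of permutations; the prefix \<open>zs\<close> collects the arguments already
  matched.\<close>

lemma alt_form_zero_mset:
  assumes "alt_form j \<omega>" "length zs + length xs = j" "mset xs = mset ys"
  shows "\<omega> (zs @ xs) = 0 \<longleftrightarrow> \<omega> (zs @ ys) = 0"
  using assms(2,3)
proof (induction xs arbitrary: zs ys)
  case (Cons a xs)
  then have "a \<in> set ys" by (metis list.set_intros(1) mset_eq_setD)
  then obtain us ws where ys: "ys = us @ a # ws" by (meson split_list)
  have m: "mset xs = mset (us @ ws)" using Cons(3) ys by simp
  then have len: "length xs = length us + length ws" by (metis length_append mset_eq_length)
  have "\<omega> (zs @ us @ a # ws) = (-1) ^ length us *\<^sub>R \<omega> (zs @ a # us @ ws)"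
    by (rule alt_form_move[OF assms(1)]) (use Cons(2) len in simp)
  then have "\<omega> (zs @ ys) = 0 \<longleftrightarrow> \<omega> ((zs @ [a]) @ us @ ws) = 0" unfolding ys by simp
  moreover have "\<omega> ((zs @ [a]) @ xs) = 0 \<longleftrightarrow> \<omega> ((zs @ [a]) @ us @ ws) = 0"
    by (rule Cons.IH) (use Cons(2) m in auto)
  ultimately show ?case by simp
qed simp

section \<open>A basis of the alternating forms\<close>

definition basis_enum :: "nat \<Rightarrow> 'a::euclidean_space" where
  "basis_enum = (SOME e. bij_betw e {..<DIM('a)} Basis)"

lemma bij_basis_enum: "bij_betw (basis_enum :: nat \<Rightarrow> 'a::euclidean_space) {..<DIM('a)} Basis"
proof -
  have "\<exists>e. bij_betw e {..<DIM('a)} (Basis::'a set)"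
    using ex_bij_betw_nat_finite[of "Basis::'a set"] by (simp add: atLeast0LessThan)
  then show ?thesis unfolding basis_enum_def by (rule someI_ex)
qed

lemma inner_basis_enum:
  "i < DIM('a) \<Longrightarrow> j < DIM('a) \<Longrightarrow> (basis_enum i :: 'a::euclidean_space) \<bullet> basis_enum j = (if i = j then 1 else 0)"
  using bij_betwE[OF bij_basis_enum[where 'a = 'a]] bij_betw_imp_inj_on[OF bij_basis_enum[where 'a = 'a]]
  by (auto simp: inner_Basis inj_on_def)

abbreviation basis_list :: "nat set \<Rightarrow> 'a::euclidean_space list" where
  "basis_list S \<equiv> map basis_enum (sorted_list_of_set S)"

text \<open>Multilinearity reduces to basis vectors, and alternation to one increasing list for each
  subset of the basis.\<close>

lemma alt_form_eq_0:
  fixes \<omega> :: "'a::euclidean_space list \<Rightarrow> 'b::real_vector"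
  assumes alt: "alt_form j \<omega>"
    and z: "\<And>S. S \<subseteq> {..<DIM('a)} \<Longrightarrow> card S = j \<Longrightarrow> \<omega> (basis_list S) = 0"
    and vs: "length vs = j"
  shows "\<omega> vs = 0"
proof -
  have b: "\<omega> (map basis_enum js) = 0" if js: "length js = j" "set js \<subseteq> {..<DIM('a)}" for js
  proof (cases "distinct js")
    case False
    then have "\<not> distinct (map (basis_enum :: nat \<Rightarrow> 'a) js)" by (metis distinct_map)
    then show ?thesis using alt_form_repeat[OF alt] js by simp
  next
    case True
    have "mset js = mset (sorted_list_of_set (set js))"
      using True by (simp add: set_eq_iff_mset_eq_distinct[symmetric])
    then have "mset (map basis_enum js) = mset (basis_list (set js))" by (metis mset_map)
    then have "\<omega> ([] @ map basis_enum js) = 0 \<longleftrightarrow> \<omega> ([] @ basis_list (set js)) = 0"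
      by (intro alt_form_zero_mset[OF alt]) (use js in auto)
    then show ?thesis using z[of "set js"] True js by (simp add: distinct_card)
  qed
  \<comment> \<open>Arguments are replaced by basis vectors from the right; \<open>js\<close> lists
    those already replaced.\<close>
  have "length xs + length js = j \<Longrightarrow> set js \<subseteq> {..<DIM('a)} \<Longrightarrow> \<omega> (xs @ map basis_enum js) = 0" for xs js
  proof (induction xs arbitrary: js rule: rev_induct)
    case Nil
    then show ?case using b by simp
  next
    case (snoc x xs)
    have lin: "linear (\<lambda>v. \<omega> (xs @ v # map basis_enum js))"
      by (rule alt_form_linear[OF alt]) (use snoc in simp)
    have "x \<in> span Basis" by simp
    then have "\<omega> (xs @ x # map basis_enum js) = 0"
    proof (rule linear_eq_0_on_span[OF lin, rotated])
      fix v :: 'a assume "v \<in> Basis"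
      then obtain i where "i < DIM('a)" "v = basis_enum i"
        using bij_betw_imp_surj_on[OF bij_basis_enum] by (metis imageE lessThan_iff)
      then show "\<omega> (xs @ v # map basis_enum js) = 0"
        using snoc.IH[of "i # js"] snoc.prems by simp
    qed
    then show ?case by simp
  qed
  from this[of vs "[]"] show ?thesis using vs by simp
qed

text \<open>The exterior product of the coordinate covectors with the listed indices, that is, a
  determinant of coordinates by Laplace expansion.\<close>

fun elem_form :: "nat list \<Rightarrow> 'a::euclidean_space list \<Rightarrow> real" where
  "elem_form [] = (\<lambda>vs. if vs = [] then 1 else 0)"
| "elem_form (i # is) = wedge (\<lambda>v x. (v \<bullet> basis_enum i) * x) (elem_form is)"

lemma alt_elem_form: "alt_form (length is) (elem_form is :: 'a::euclidean_space list \<Rightarrow> real)"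
proof (induction "is")
  case Nil
  show ?case by (simp add: alt_form_def)
next
  case (Cons i "is")
  have "alt_form (Suc (length is)) (wedge (\<lambda>(v::'a) x. (v \<bullet> basis_enum i) * x) (elem_form is))"
    by (rule alt_form_wedge[OF Cons, of UNIV])
      (auto simp: lin_on_def algebra_simps inner_add_left intro!: linearI)
  then show ?case by simp
qed

lemma sorted_wrt_remove_nth:
  assumes "sorted_wrt (<) js" "l < length js"
  shows "sorted_wrt (<) (take l js @ drop (Suc l) (js :: nat list))"
proof -
  have "sorted_wrt (<) (take l js @ js ! l # drop (Suc l) js)"
    using assms by (simp add: id_take_nth_drop[symmetric])
  then show ?thesis by (auto simp: sorted_wrt_append)
qed

lemma elem_form_basis:
  assumes "sorted_wrt (<) is" "sorted_wrt (<) js" "length is = length js"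
    "set is \<subseteq> {..<DIM('a)}" "set js \<subseteq> {..<DIM('a)}"
  shows "elem_form is (map (basis_enum :: nat \<Rightarrow> 'a::euclidean_space) js) = (if is = js then 1 else 0)"
  using assms
proof (induction "is" arbitrary: js)
  case (Cons i "is")
  then obtain k ks where js: "js = k # ks" by (metis length_Suc_conv)
  let ?t = "\<lambda>l. (-1) ^ l * ((basis_enum (js ! l) \<bullet> (basis_enum i :: 'a)) *
      elem_form is (map (basis_enum :: nat \<Rightarrow> 'a) (take l js @ drop (Suc l) js)))"
  have e: "elem_form (i # is) (map (basis_enum :: nat \<Rightarrow> 'a) js) = (\<Sum>l<length js. ?t l)"
    by (simp add: wedge_def take_map drop_map)
  \<comment> \<open>If a later entry of \<open>js\<close> is \<open>i\<close>, removing it leaves a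
    list that starts with \<open>k < i\<close>, while all entries of \<open>is\<close> exceed
    \<open>i\<close>; the induction hypothesis then gives 0.\<close>
  have z: "?t l = 0" if l: "0 < l" "l < length js" for l
  proof (cases "js ! l = i")
    case True
    let ?us = "take l js @ drop (Suc l) js"
    have us: "?us = k # take (l - 1) ks @ drop l ks" using js l by (cases l) auto
    have "k < i" using Cons.prems(2) l js True nth_mem[of "l - 1" ks] by (auto simp: nth_Cons')
    moreover have "\<forall>x\<in>set is. i < x" using Cons.prems(1) by simp
    ultimately have "is \<noteq> ?us" unfolding us by (metis list.set_intros(1) less_asym)
    moreover have "elem_form is (map (basis_enum :: nat \<Rightarrow> 'a) ?us) = (if is = ?us then 1 else 0)"
    proof (rule Cons.IH)
      show "set ?us \<subseteq> {..<DIM('a)}"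
        using Cons.prems(5) set_take_subset[of l js] set_drop_subset[of "Suc l" js] by auto
    qed (use Cons.prems l sorted_wrt_remove_nth in auto)
    ultimately show ?thesis by simp
  next
    case False
    have "js ! l < DIM('a)" using Cons.prems(5) l nth_mem by blast
    then show ?thesis using False Cons.prems(4) by (simp add: inner_basis_enum)
  qed
  have "(\<Sum>l<length js. ?t l) = (\<Sum>l\<in>{0}. ?t l)"
    by (rule sum.mono_neutral_right) (use z js in auto)
  also have "\<dots> = (if k = i then 1 else 0) * (if is = ks then 1 else 0)"
    using Cons.IH[of ks] Cons.prems js by (simp add: inner_basis_enum)
  finally show ?case unfolding e by (auto simp: js)
qed simp

lemma elem_form_length: "length vs \<noteq> length is \<Longrightarrow> elem_form is vs = 0"
proof (induction "is" arbitrary: vs)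
  case (Cons i "is")
  then show ?case by (auto simp: wedge_def)
qed simp

lemma alt_form_scale_sum:
  fixes c :: "'i \<Rightarrow> 'b::real_vector" and E :: "'i \<Rightarrow> 'a::real_vector list \<Rightarrow> real"
  assumes "\<And>S. S \<in> I \<Longrightarrow> alt_form j (E S)"
  shows "alt_form j (\<lambda>vs. \<Sum>S\<in>I. E S vs *\<^sub>R c S)"
  unfolding alt_form_def
proof (intro conjI allI impI; elim conjE)
  fix vs :: "'a list" and i assume vs: "length vs = j" "i < j"
  have "linear (\<lambda>v. E S (vs[i := v]) *\<^sub>R c S)" if "S \<in> I" for S
  proof -
    have l: "linear (\<lambda>v. E S (vs[i := v]))" using assms[OF that] vs unfolding alt_form_def by blast
    show ?thesis by (rule linearI) (simp_all add: linear_add[OF l] linear_scale[OF l] scaleR_left_distrib)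
  qed
  then show "linear (\<lambda>v. \<Sum>S\<in>I. E S (vs[i := v]) *\<^sub>R c S)" by (intro linear_compose_sum) auto
next
  fix vs :: "'a list" assume "length vs = j" "\<not> distinct vs"
  then show "(\<Sum>S\<in>I. E S vs *\<^sub>R c S) = 0"
    using alt_form_repeat[OF assms] by (intro sum.neutral) auto
qed

lemma subspace_forms:
  assumes "subspace V"
  shows "subspace (forms j V)"
proof (rule subspaceI)
  show "0 \<in> forms j V"
    using assms linear_zero by (auto simp: forms_def zero_fun_apply subspace_0)
next
  fix \<omega> \<eta> assume "\<omega> \<in> forms j V" "\<eta> \<in> forms j V"
  then show "\<omega> + \<eta> \<in> forms j V"
    using assms by (auto simp: forms_def plus_fun_apply subspace_add intro!: linear_compose_add)
next
  fix \<omega> c assume "\<omega> \<in> forms j V"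
  then show "c *\<^sub>R \<omega> \<in> forms j V"
    using assms by (auto simp: forms_def scaleR_fun_def[of c \<omega>] subspace_scale intro!: linear_compose_scale_right)
qed

text \<open>\<open>?\<Psi>\<close> combines the elementary forms with coefficients in
  \<open>V\<close>, one for each \<open>j\<close>-subset of the basis; evaluation on the increasing
  basis lists inverts it.\<close>

lemma dim_forms:
  fixes V :: "(real^'n \<Rightarrow> real^'m) set"
  assumes V: "subspace V" "fin_dim V"
  shows "fin_dim (forms j V)" and "dim (forms j V) = (CARD('n) choose j) * dim V"
proof -
  let ?n = "DIM(real^'n)"
  define I where "I = {S. S \<subseteq> {..<?n} \<and> card S = j}"
  let ?E = "\<lambda>S. elem_form (sorted_list_of_set S) :: (real^'n) list \<Rightarrow> real"
  let ?\<Psi> = "\<lambda>f vs. \<Sum>S\<in>I. ?E S vs *\<^sub>R (f S :: real^'n \<Rightarrow> real^'m)"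
  let ?b = "basis_list :: nat set \<Rightarrow> (real^'n) list"
  have finI: "finite I" unfolding I_def by (rule finite_subset[of _ "Pow {..<?n}"]) auto
  have cardI: "card I = CARD('n) choose j" using n_subsets[of "{..<?n}" j] by (simp add: I_def)
  have finS: "finite S" if "S \<in> I" for S
    using that finite_subset[of S "{..<?n}"] by (simp add: I_def)
  have len: "length (sorted_list_of_set S) = j" if "S \<in> I" for S
    using that by (simp add: I_def)
  have setS: "set (sorted_list_of_set S) \<subseteq> {..<?n}" if "S \<in> I" for S
    using that finS[OF that] by (simp add: I_def)
  have altE: "alt_form j (?E S)" if "S \<in> I" for S
    using alt_elem_form[of "sorted_list_of_set S"] len[OF that] by simp
  have ev: "?\<Psi> f (?b S) = f S" if S: "S \<in> I" for f S
  proof -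
    have "?E R (?b S) = (if R = S then 1 else 0)" if R: "R \<in> I" for R
    proof -
      have "?E R (?b S) = (if sorted_list_of_set R = sorted_list_of_set S then 1 else 0)"
        by (rule elem_form_basis[OF _ _ _ setS[OF R] setS[OF S]]) (use R S in \<open>simp_all add: I_def\<close>)
      moreover have "sorted_list_of_set R = sorted_list_of_set S \<longleftrightarrow> R = S"
        using finS[OF R] finS[OF S] by (metis set_sorted_list_of_set)
      ultimately show ?thesis by simp
    qed
    then have "?\<Psi> f (?b S) = (\<Sum>R\<in>I. if R = S then f S else 0)" by (intro sum.cong) auto
    then show ?thesis using S finI by simp
  qed
  have into: "?\<Psi> f \<in> forms j V" if f: "f \<in> supp_funs I V" for f
    unfolding forms_alt_form
  proof (intro conjI allI impI)
    fix vs :: "(real^'n) list" assume "length vs \<noteq> j"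
    then have "?E S vs = 0" if "S \<in> I" for S using elem_form_length len[OF that] by metis
    then show "?\<Psi> f vs = 0" by (intro sum.neutral) auto
  next
    fix vs :: "(real^'n) list"
    show "?\<Psi> f vs \<in> V"
      by (intro subspace_sum[OF V(1)] subspace_scale[OF V(1)]) (use f in \<open>auto simp: supp_funs_def\<close>)
  next
    show "alt_form j (?\<Psi> f)" by (rule alt_form_scale_sum) (rule altE)
  qed
  have surj: "?\<Psi> ` supp_funs I V = forms j V"
  proof
    show "?\<Psi> ` supp_funs I V \<subseteq> forms j V" using into by blast
    show "forms j V \<subseteq> ?\<Psi> ` supp_funs I V"
    proof
      fix \<omega> assume \<omega>: "\<omega> \<in> forms j V"
      define f where "f = (\<lambda>S. if S \<in> I then \<omega> (?b S) else 0)"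
      have f: "f \<in> supp_funs I V"
        unfolding supp_funs_def f_def
        using \<omega> len by (auto simp: forms_alt_form)
      define \<delta> where "\<delta> = \<omega> - ?\<Psi> f"
      have "\<delta> \<in> forms j V" unfolding \<delta>_def
        by (rule subspace_diff[OF subspace_forms[OF V(1)] \<omega> into[OF f]])
      then have alt: "alt_form j \<delta>" and z: "\<And>vs. length vs \<noteq> j \<Longrightarrow> \<delta> vs = 0"
        by (auto simp: forms_alt_form)
      have "\<delta> (?b S) = 0" if "S \<in> I" for S
        using ev[OF that, of f] that unfolding \<delta>_def by (simp add: f_def)
      then have "\<delta> vs = 0" for vs
        using alt_form_eq_0[OF alt _, of vs] z[of vs] by (cases "length vs = j") (simp_all add: I_def)
      then have "\<delta> = (\<lambda>_. 0)" by (rule ext)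
      then have "\<delta> = 0" by (simp only: zero_fun_def)
      then have "\<omega> = ?\<Psi> f" unfolding \<delta>_def by simp
      then show "\<omega> \<in> ?\<Psi> ` supp_funs I V" using f by blast
    qed
  qed
  have sub: "subspace (supp_funs I V)" and fin: "fin_dim (supp_funs I V)"
    using subspace_supp_funs[OF V(1)] fin_dim_supp_funs[OF finI V(2)] by auto
  have lin: "lin_on (supp_funs I V) ?\<Psi>"
    unfolding lin_on_def
    by (auto simp: fun_eq_iff plus_fun_apply scaleR_fun_def scaleR_add_right sum.distrib scaleR_sum_right sum_fun_apply mult.commute)
  show "fin_dim (forms j V)" using fin_dim_image[OF sub lin fin] unfolding surj .
  have "dim (?\<Psi> ` supp_funs I V) = dim (supp_funs I V)"
  proof (rule dim_inj_lin_on[OF sub lin fin])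
    fix f assume f: "f \<in> supp_funs I V" "?\<Psi> f = 0"
    then have "f S = 0" if "S \<in> I" for S using ev[OF that, of f] fun_cong[OF f(2), of "?b S"] by (simp add: zero_fun_apply)
    then have "f S = 0" for S using f(1) unfolding supp_funs_def by blast
    then have "f = (\<lambda>_. 0)" by (rule ext)
    then show "f = 0" by (simp only: zero_fun_def)
  qed
  then show "dim (forms j V) = (CARD('n) choose j) * dim V"
    using dim_supp_funs[OF finI V(2,1)] unfolding surj cardI by simp
qed


section \<open>The Euler characteristic of the Spencer complex\<close>

lemma symbolic_system_facts:
  assumes "symbolic_system g"
  shows "subspace (g k)" "g k \<subseteq> sym_maps k" "fin_dim (g k)" "g 0 = sym_maps 0"
    "q \<in> g (Suc k) \<Longrightarrow> dir_deriv v q \<in> g k" "q \<in> g k \<Longrightarrow> q \<in> poly_maps" "0 \<in> g k"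
proof -
  have *: "subspace (g k)" "g k \<subseteq> sym_maps k" "g 0 = sym_maps 0"
    using assms by (auto simp: symbolic_system_def)
  then show "subspace (g k)" "g k \<subseteq> sym_maps k" "g 0 = sym_maps 0" by auto
  show "fin_dim (g k)" by (rule fin_dim_subset[OF fin_dim_sym_maps *(2)])
  show "q \<in> g k \<Longrightarrow> q \<in> poly_maps" using * sym_maps_poly_maps by blast
  show "0 \<in> g k" using * by (simp add: subspace_0)
  assume "q \<in> g (Suc k)"
  then have "q \<in> prolong k (g k) 1" using assms by (auto simp: symbolic_system_def)
  then have "foldr dir_deriv [v] q \<in> g k" unfolding prolong_def by (auto dest: spec[of _ "[v]"])
  then show "dir_deriv v q \<in> g k" by simp
qed

lemma spencer_d_forms:
  assumes "symbolic_system g" "\<omega> \<in> forms j (g (Suc i))"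
  shows "spencer_d \<omega> \<in> forms (Suc j) (g i)"
  unfolding forms_alt_form
proof (intro conjI allI impI)
  note g = symbolic_system_facts[OF assms(1)]
  have \<omega>: "\<And>vs. length vs \<noteq> j \<Longrightarrow> \<omega> vs = 0" "\<And>vs. length vs = j \<Longrightarrow> \<omega> vs \<in> g (Suc i)" "alt_form j \<omega>"
    using assms(2) by (auto simp: forms_alt_form)
  show "spencer_d \<omega> vs = 0" if "length vs \<noteq> Suc j" for vs
    unfolding spencer_d_def using that by (intro sum.neutral) (auto simp: \<omega>(1))
  show "spencer_d \<omega> vs \<in> g i" if "length vs = Suc j" for vs
    unfolding spencer_d_def using that
    by (intro subspace_sum[OF g(1)] subspace_scale[OF g(1)] g(5) \<omega>(2)) auto
  show "alt_form (Suc j) (spencer_d \<omega>)" unfolding spencer_d_wedge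
  proof (rule alt_form_wedge[OF \<omega>(3) \<omega>(2)])
    show "lin_on (g (Suc i)) (dir_deriv v)" for v
      by (rule lin_on_subset[OF lin_on_dir_deriv]) (use g(6) in blast)
    show "linear (\<lambda>v. dir_deriv v x)" if "x \<in> g (Suc i)" for x
      using linear_dir_deriv_dir g(6) that by blast
  qed
qed

lemma lin_on_spencer_d:
  assumes "symbolic_system g"
  shows "lin_on (forms j (g i)) spencer_d"
proof -
  note g = symbolic_system_facts[OF assms(1)]
  have P: "\<omega> vs \<in> poly_maps" if "\<omega> \<in> forms j (g i)" for \<omega> vs
  proof (cases "length vs = j")
    case True
    then show ?thesis using that g(6) unfolding forms_def by blast
  next
    case False
    then show ?thesis using that by (simp add: forms_def subspace_0)
  qed
  have "spencer_d (\<omega> + \<eta>) = spencer_d \<omega> + spencer_d \<eta>" if "\<omega> \<in> forms j (g i)" "\<eta> \<in> forms j (g i)" for \<omega> \<eta>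
    using P[OF that(1)] P[OF that(2)]
    by (simp add: fun_eq_iff[of "spencer_d (\<omega> + \<eta>)"] spencer_d_def plus_fun_apply[of \<omega> \<eta>] plus_fun_apply[of "spencer_d \<omega>"]
        dir_deriv_add scaleR_add_right sum.distrib)
  moreover have "spencer_d (c *\<^sub>R \<omega>) = c *\<^sub>R spencer_d \<omega>" if "\<omega> \<in> forms j (g i)" for \<omega> c
  proof
    fix vs
    have "spencer_d (c *\<^sub>R \<omega>) vs = (\<Sum>l<length vs. (-1) ^ l *\<^sub>R dir_deriv (vs ! l) (c *\<^sub>R \<omega> (take l vs @ drop (Suc l) vs)))"
      by (simp add: spencer_d_def scaleR_fun_def[of c \<omega>])
    also have "\<dots> = c *\<^sub>R spencer_d \<omega> vs"
      by (simp add: dir_deriv_scale[OF P[OF that]] spencer_d_def scaleR_sum_right mult.commute)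
    finally show "spencer_d (c *\<^sub>R \<omega>) vs = (c *\<^sub>R spencer_d \<omega>) vs" by (simp add: scaleR_fun_def[of c "spencer_d \<omega>"])
  qed
  ultimately show ?thesis unfolding lin_on_def by blast
qed

lemma spencer_d_zero_degree:
  assumes "symbolic_system g" "\<omega> \<in> forms j (g 0)"
  shows "spencer_d \<omega> = 0"
proof -
  note g = symbolic_system_facts[OF assms(1)]
  have P: "\<omega> vs \<in> sym_maps 0" for vs
    using assms(2) subspace_0[of "sym_maps 0"] g(4) unfolding forms_def by (cases "length vs = j") auto
  have "spencer_d \<omega> = (\<lambda>_. 0)" by (rule ext) (simp add: spencer_d_def dir_deriv_sym_maps_0[OF P])
  then show ?thesis by (simp only: zero_fun_def)
qed

lemma spencer_rank_nullity:
  assumes "symbolic_system g"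
  shows "(CARD('n) choose j) * dim (g (Suc i) :: (real^'n \<Rightarrow> real^'m) set)
    = dim (spencer_cocycles g (Suc i) j) + dim (spencer_coboundaries g i (Suc j))"
proof -
  note g = symbolic_system_facts[OF assms(1)]
  have "dim (forms j (g (Suc i))) = dim {\<omega> \<in> forms j (g (Suc i)). spencer_d \<omega> = 0} + dim (spencer_d ` forms j (g (Suc i)))"
    by (rule rank_nullity[OF subspace_forms[OF g(1)] lin_on_spencer_d[OF assms] dim_forms(1)[OF g(1,3)]])
  then show ?thesis
    by (simp add: dim_forms(2)[OF g(1,3)] spencer_cocycles_def spencer_coboundaries_def)
qed

text \<open>Constants have zero derivative, so every form of polynomial degree 0 is a cocycle. The
  inequality makes the truncated subtraction in \<open>spencer_dim\<close> exact in this
  degree.\<close>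

lemma spencer_degree_zero:
  assumes "symbolic_system g"
  shows "dim (spencer_cocycles g 0 j) = (CARD('n) choose j) * dim (g 0 :: (real^'n \<Rightarrow> real^'m) set)"
    and "dim (spencer_coboundaries g 0 j) \<le> dim (spencer_cocycles g 0 j)"
proof -
  note g = symbolic_system_facts[OF assms(1)]
  have e: "spencer_cocycles g 0 j = forms j (g 0)"
    unfolding spencer_cocycles_def using spencer_d_zero_degree[OF assms] by blast
  then show "dim (spencer_cocycles g 0 j) = (CARD('n) choose j) * dim (g 0)"
    by (simp add: dim_forms(2)[OF g(1,3)])
  have "0 \<in> forms j (g 0)" using subspace_0[OF subspace_forms[OF g(1)]] .
  then have "spencer_coboundaries g 0 j \<subseteq> forms j (g 0)"
    unfolding spencer_coboundaries_def using spencer_d_forms[OF assms] by (cases j) auto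
  then show "dim (spencer_coboundaries g 0 j) \<le> dim (spencer_cocycles g 0 j)"
    unfolding e by (rule dim_le_fin_dim[OF dim_forms(1)[OF g(1,3)]])
qed

text \<open>The complex of total degree k is exact except at its last term, in polynomial degree 0,
  so its alternating sum of dimensions telescopes to the cohomology there.\<close>

lemma spencer_euler:
  fixes g :: "nat \<Rightarrow> (real^'n \<Rightarrow> real^'m) set"
  assumes sys: "symbolic_system g" and van: "\<And>i j. i \<ge> 1 \<Longrightarrow> spencer_vanishes g i j"
  shows "(\<Sum>j\<le>k. (-1) ^ j * real ((CARD('n) choose j) * dim (g (k - j)))) = (-1) ^ k * real (spencer_dim g 0 k)"
proof (cases k)
  case 0
  then show ?thesis
    using spencer_degree_zero(1)[OF sys, of 0] by (simp add: spencer_dim_def spencer_coboundaries_def)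
next
  case (Suc k')
  \<comment> \<open>\<open>b j\<close> is the rank of the differential arriving at the j-th term; by
    exactness the dimension of that term is the sum of the ranks arriving and leaving.\<close>
  define b where "b j = real (dim (spencer_coboundaries g (k - j) j))" for j
  have b0: "b 0 = 0" by (simp add: b_def spencer_coboundaries_def)
  have t: "real ((CARD('n) choose j) * dim (g (k - j))) = b j + b (Suc j)" if "j < k" for j
  proof -
    have e: "k - j = Suc (k - Suc j)" using that by simp
    have "spencer_cocycles g (k - j) j = spencer_coboundaries g (k - j) j"
      using van[of "k - j" j] that by (simp add: spencer_vanishes_def)
    then show ?thesis using spencer_rank_nullity[OF sys, of j "k - Suc j"] unfolding b_def
      by (simp only: e[symmetric] of_nat_add[symmetric])
  qed
  have telescope: "(\<Sum>j<K. (-1) ^ j * (b j + b (Suc j))) = b 0 - (-1) ^ K * b K" for K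
    by (induction K) (simp_all add: algebra_simps)
  have "(\<Sum>j\<le>k. (-1) ^ j * real ((CARD('n) choose j) * dim (g (k - j))))
      = (\<Sum>j<k. (-1) ^ j * real ((CARD('n) choose j) * dim (g (k - j)))) + (-1) ^ k * real ((CARD('n) choose k) * dim (g 0))"
    by (simp add: lessThan_Suc_atMost[symmetric])
  also have "(\<Sum>j<k. (-1) ^ j * real ((CARD('n) choose j) * dim (g (k - j)))) = (\<Sum>j<k. (-1) ^ j * (b j + b (Suc j)))"
    by (rule sum.cong) (use t in auto)
  also have "\<dots> = - ((-1) ^ k * b k)" using telescope b0 by simp
  finally show ?thesis
    using spencer_degree_zero[OF sys, of k] by (simp add: b_def spencer_dim_def of_nat_diff algebra_simps)
qed

lemma spencer_dim_above:
  fixes g :: "nat \<Rightarrow> (real^'n \<Rightarrow> real^'m) set"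
  assumes "symbolic_system g" "k > CARD('n)"
  shows "spencer_dim g 0 k = 0"
  using spencer_degree_zero(1)[OF assms(1), of k] assms(2) by (simp add: spencer_dim_def binomial_eq_0)

section \<open>Involutive systems of pure first order\<close>

text \<open>No order above 1 means that every step beyond degree 1 is a full prolongation, and
  repeated single prolongations of \<open>g 1\<close> amount to one prolongation by several
  steps.\<close>

lemma pure_first_order_generated:
  assumes sys: "symbolic_system g" and pfo: "pure_first_order g"
  shows "generated_from 1 g = g"
proof
  fix i
  note g = symbolic_system_facts[OF sys]
  have step: "g (Suc k) = prolong k (g k) 1" if "k \<ge> 1" for k
  proof (rule ccontr)
    assume "g (Suc k) \<noteq> prolong k (g k) 1"
    then have "Suc k \<in> orders g" unfolding orders_def by blast
    then show False using pfo that unfolding pure_first_order_def by simp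
  qed
  have "prolong 1 (g 1) l = g (Suc l)" for l
  proof (induction l)
    case 0
    then show ?case using g(2)[of 1] by (auto simp: prolong_def)
  next
    case (Suc l)
    have "prolong 1 (g 1) (Suc l) = prolong (Suc l) (prolong 1 (g 1) l) 1"
    proof (intro set_eqI iffI)
      fix q assume q: "q \<in> prolong 1 (g 1) (Suc l)"
      then have qs: "q \<in> sym_maps (Suc (Suc l))" by (simp add: prolong_def)
      have "dir_deriv v q \<in> prolong 1 (g 1) l" for v
        unfolding prolong_def mem_Collect_eq
      proof (intro conjI allI impI)
        show "dir_deriv v q \<in> sym_maps (1 + l)" using dir_deriv_sym_maps[OF qs] by simp
        fix vs :: "(real^'a) list" assume "length vs = l"
        \<comment> \<open>\<open>foldr\<close> applies the last entry first, so appending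
          \<open>v\<close> differentiates along \<open>v\<close> before \<open>vs\<close>.\<close>
        then have "length (vs @ [v]) = Suc l" by simp
        then have "foldr dir_deriv (vs @ [v]) q \<in> g 1" using q unfolding prolong_def by blast
        then show "foldr dir_deriv vs (dir_deriv v q) \<in> g 1" by simp
      qed
      then show "q \<in> prolong (Suc l) (prolong 1 (g 1) l) 1"
        unfolding prolong_def[of "Suc l"] using qs by (auto simp: length_Suc_conv)
    next
      fix q assume q: "q \<in> prolong (Suc l) (prolong 1 (g 1) l) 1"
      have qd: "dir_deriv v q \<in> prolong 1 (g 1) l" for v
        using q unfolding prolong_def[of "Suc l"] by (auto dest: spec[of _ "[v]"])
      show "q \<in> prolong 1 (g 1) (Suc l)"
        unfolding prolong_def mem_Collect_eq
      proof (intro conjI allI impI)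
        show "q \<in> sym_maps (1 + Suc l)" using q unfolding prolong_def[of "Suc l"] by simp
        fix vs :: "(real^'a) list" assume "length vs = Suc l"
        then obtain us v where "vs = us @ [v]" "length us = l" by (metis length_Suc_conv_rev)
        then show "foldr dir_deriv vs q \<in> g 1" using qd[of v] unfolding prolong_def by simp
      qed
    qed
    then show ?case using Suc step[of "Suc l"] by simp
  qed
  then show "generated_from 1 g i = g i"
    using g(4) unfolding generated_from_def by (cases i) auto
qed

text \<open>The only order is 1, and the system generated from order 1 is \<open>g\<close>
  itself.\<close>

lemma involutive_pure_first_order_vanishes:
  assumes "symbolic_system g" "pure_first_order g" "involutive g" "i \<ge> 1"
  shows "spencer_vanishes g i j"
  using assms(2-4) pure_first_order_generated[OF assms(1,2)]
  unfolding involutive_def pure_first_order_def by auto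

section \<open>The Hilbert polynomial\<close>

text \<open>The polynomial binom(z + n, n), as a product that shows its degree and leading
  coefficient.\<close>

definition shifted_binom :: "nat \<Rightarrow> real poly" where
  "shifted_binom n = smult (1 / fact n) (\<Prod>j=1..n. [:real j, 1:])"

lemma poly_shifted_binom: "poly (shifted_binom n) (real k) = real ((k + n) choose n)"
proof -
  have "poly (shifted_binom n) (real k) = (\<Prod>j=1..n. real k + real j) / fact n"
    by (simp add: shifted_binom_def poly_prod add.commute)
  also have "(\<Prod>j=1..n. real k + real j) = fact (k + n) / fact k"
  proof (induction n)
    case (Suc n)
    have "(\<Prod>j=1..Suc n. real k + real j) = fact (k + n) / fact k * (real k + real (Suc n))"
      using Suc by simp
    then show ?case by (simp add: algebra_simps)
  qed simp
  finally show ?thesis by (simp add: binomial_fact)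
qed

lemma degree_shifted_binom: "degree (shifted_binom n) = n"
  by (simp add: shifted_binom_def degree_prod_sum_eq)

lemma coeff_shifted_binom: "coeff (shifted_binom n) n = 1 / fact n"
proof -
  have "lead_coeff (\<Prod>j=1..n. [:real j, 1:]) = 1" by (simp add: lead_coeff_prod)
  moreover have "degree (\<Prod>j=1..n. [:real j, 1:]) = n" by (simp add: degree_prod_sum_eq)
  ultimately show ?thesis by (simp add: shifted_binom_def)
qed

lemma coeff_pcompose_shift:
  fixes p :: "real poly"
  assumes "degree p \<le> n"
  shows "coeff (pcompose p [:c, 1:]) r = (\<Sum>j\<le>n. coeff p j * (real (j choose r) * c ^ (j - r)))"
proof -
  have "pcompose p [:c, 1:] = (\<Sum>j\<le>degree p. smult (coeff p j) ([:c, 1:] ^ j))"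
    by (simp add: pcompose_altdef poly_altdef degree_map_poly coeff_map_poly)
  also have "\<dots> = (\<Sum>j\<le>n. smult (coeff p j) ([:c, 1:] ^ j))"
    by (rule sum.mono_neutral_left) (use assms in \<open>auto simp: coeff_eq_0\<close>)
  finally have sum: "coeff (pcompose p [:c, 1:]) r = (\<Sum>j\<le>n. coeff p j * coeff ([:c, 1:] ^ j) r)"
    by (simp add: coeff_sum)
  have "coeff ([:c, 1:] ^ j) r = real (j choose r) * c ^ (j - r)" for j
  proof (cases "r \<le> j")
    case True
    then show ?thesis by (simp add: coeff_linear_poly_power)
  next
    case False
    moreover have "degree ([:c, 1:] ^ j) \<le> j" using degree_power_le[of "[:c, 1:]" j] by simp
    ultimately show ?thesis by (simp add: coeff_eq_0 binomial_eq_0)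
  qed
  then show ?thesis using sum by simp
qed

section \<open>Generating functions\<close>

lemma one_minus_X_mult_nth:
  "fps_nth ((1 - fps_X) * F) k = fps_nth F k - (if k = 0 then 0 else fps_nth F (k - 1))" for F :: "real fps"
  by (simp add: left_diff_distrib)

lemma one_minus_X_power: "(1 - fps_X) ^ m = Abs_fps (\<lambda>j. (-1) ^ j * real (m choose j))"
proof (induction m)
  case 0
  show ?case by (rule fps_ext) (simp add: binomial_eq_0_iff)
next
  case (Suc m)
  show ?case
  proof (rule fps_ext)
    fix j
    show "fps_nth ((1 - fps_X) ^ Suc m) j = fps_nth (Abs_fps (\<lambda>j. (-1) ^ j * real (Suc m choose j))) j"
      by (cases j) (simp_all only: power_Suc Suc one_minus_X_mult_nth, simp_all add: algebra_simps)
  qed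
qed

text \<open>By Pascal's rule, multiplication by 1 - t takes the series of binom(k + n + 1, n + 1) to
  that of binom(k + n, n).\<close>

lemma one_minus_X_power_mult:
  "(1 - fps_X) ^ Suc n * Abs_fps (\<lambda>k. real ((k + n) choose n)) = 1"
proof (induction n)
  case 0
  show ?case by (rule fps_ext) (simp add: one_minus_X_mult_nth)
next
  case (Suc n)
  have "(1 - fps_X) * Abs_fps (\<lambda>k. real ((k + Suc n) choose Suc n)) = Abs_fps (\<lambda>k. real ((k + n) choose n))"
  proof (rule fps_ext)
    fix k
    show "fps_nth ((1 - fps_X) * Abs_fps (\<lambda>k. real ((k + Suc n) choose Suc n))) k = fps_nth (Abs_fps (\<lambda>k. real ((k + n) choose n))) k"
      unfolding one_minus_X_mult_nth by (cases k) simp_all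
  qed
  then show ?case using Suc by (simp only: power_Suc2[of _ "Suc n"] mult.assoc)
qed

text \<open>From (1 - t)^n D = Q and (1 - t) S = D, multiplying S by (1 - t)^(n+1) G = 1 gives S = Q
  G. The bound on \<open>K\<close> brings in all of Q and makes \<open>K - i\<close> a true
  difference.\<close>

lemma dim_sum_eq:
  fixes g :: "nat \<Rightarrow> (real^'n \<Rightarrow> real^'m) set"
  assumes sys: "symbolic_system g" and van: "\<And>i j. i \<ge> 1 \<Longrightarrow> spencer_vanishes g i j"
    and K: "K \<ge> CARD('n)"
  shows "(\<Sum>i\<le>K. real (dim (g i))) =
    (\<Sum>i\<le>CARD('n). (-1) ^ i * real (spencer_dim g 0 i) * real ((K - i + CARD('n)) choose CARD('n)))"
proof -
  let ?n = "CARD('n)"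
  define D where "D = Abs_fps (\<lambda>k. real (dim (g k)))"
  define S where "S = Abs_fps (\<lambda>k. \<Sum>i\<le>k. real (dim (g i)))"
  define Q where "Q = Abs_fps (\<lambda>k. (-1) ^ k * real (spencer_dim g 0 k))"
  define G where "G = Abs_fps (\<lambda>k. real ((k + ?n) choose ?n))"
  let ?U = "1 - fps_X :: real fps"
  have UD: "?U ^ ?n * D = Q"
  proof (rule fps_ext)
    fix k
    have "fps_nth (?U ^ ?n * D) k = (\<Sum>j\<le>k. (-1) ^ j * real ((?n choose j) * dim (g (k - j))))"
      unfolding one_minus_X_power D_def by (simp add: fps_mult_nth atMost_atLeast0 mult.assoc)
    then show "fps_nth (?U ^ ?n * D) k = fps_nth Q k" using spencer_euler[OF sys van] by (simp add: Q_def)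
  qed
  have US: "?U * S = D"
  proof (rule fps_ext)
    fix k
    show "fps_nth (?U * S) k = fps_nth D k" unfolding one_minus_X_mult_nth S_def D_def by (cases k) simp_all
  qed
  have UG: "?U ^ Suc ?n * G = 1" unfolding G_def by (rule one_minus_X_power_mult)
  have "S = (?U ^ Suc ?n * G) * S" using UG by simp
  also have "\<dots> = G * (?U ^ ?n * (?U * S))" by (simp add: algebra_simps)
  also have "\<dots> = Q * G" using US UD by (simp add: mult.commute)
  finally have "S = Q * G" .
  then have "fps_nth S K = (\<Sum>i\<le>K. fps_nth Q i * fps_nth G (K - i))"
    by (simp add: fps_mult_nth atMost_atLeast0)
  also have "\<dots> = (\<Sum>i\<le>?n. fps_nth Q i * fps_nth G (K - i))"
    by (rule sum.mono_neutral_right) (use K spencer_dim_above[OF sys] in \<open>auto simp: Q_def\<close>)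
  finally show ?thesis by (simp add: S_def Q_def G_def)
qed

definition spencer_poly :: "(nat \<Rightarrow> (real^'n \<Rightarrow> real^'m) set) \<Rightarrow> real poly" where
  "spencer_poly g = (\<Sum>i\<le>CARD('n). smult ((-1) ^ i * real (spencer_dim g 0 i))
     (pcompose (shifted_binom CARD('n)) [:- real i, 1:]))"

lemma poly_spencer_poly:
  fixes g :: "nat \<Rightarrow> (real^'n \<Rightarrow> real^'m) set"
  assumes "symbolic_system g" "\<And>i j. i \<ge> 1 \<Longrightarrow> spencer_vanishes g i j" "K \<ge> CARD('n)"
  shows "poly (spencer_poly g) (real K) = (\<Sum>i\<le>K. real (dim (g i)))"
proof -
  have "poly (shifted_binom CARD('n)) (- real i + real K) = real ((K - i + CARD('n)) choose CARD('n))"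
    if "i \<le> CARD('n)" for i
    using poly_shifted_binom[of "CARD('n)" "K - i"] that assms(3) by (simp add: of_nat_diff)
  then have "poly (spencer_poly g) (real K) =
    (\<Sum>i\<le>CARD('n). (-1) ^ i * real (spencer_dim g 0 i) * real ((K - i + CARD('n)) choose CARD('n)))"
    unfolding spencer_poly_def poly_sum by (intro sum.cong refl) (simp add: poly_pcompose)
  then show ?thesis using dim_sum_eq[OF assms] by simp
qed

lemma poly_eq_if_eventually_eq:
  fixes P Q :: "real poly"
  assumes "\<forall>\<^sub>F k in sequentially. poly P (real k) = poly Q (real k)"
  shows "P = Q"
proof (rule ccontr)
  assume "P \<noteq> Q"
  then have "finite {x. poly (P - Q) x = 0}" by (intro poly_roots_finite) simp
  moreover obtain N where "\<And>k. k \<ge> N \<Longrightarrow> poly P (real k) = poly Q (real k)"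
    using assms by (auto simp: eventually_sequentially)
  then have "real ` {N..} \<subseteq> {x. poly (P - Q) x = 0}" by auto
  ultimately have "finite (real ` {N..})" by (rule finite_subset[rotated])
  then have "finite {N..}" by (rule finite_imageD) (auto simp: inj_on_def)
  then show False using infinite_Ici by blast
qed

lemma hilbert_poly_eq_spencer_poly:
  fixes g :: "nat \<Rightarrow> (real^'n \<Rightarrow> real^'m) set"
  assumes "symbolic_system g" "\<And>i j. i \<ge> 1 \<Longrightarrow> spencer_vanishes g i j"
  shows "hilbert_poly g = spencer_poly g"
  unfolding hilbert_poly_def
proof (rule the_equality)
  show *: "\<forall>\<^sub>F k in sequentially. poly (spencer_poly g) (real k) = (\<Sum>i\<le>k. real (dim (g i)))"
    using eventually_ge_at_top[of "CARD('n)"]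
    by eventually_elim (rule poly_spencer_poly[OF assms])
  fix P :: "real poly"
  assume "\<forall>\<^sub>F k in sequentially. poly P (real k) = (\<Sum>i\<le>k. real (dim (g i)))"
  with * have "\<forall>\<^sub>F k in sequentially. poly P (real k) = poly (spencer_poly g) (real k)"
    by eventually_elim simp
  then show "P = spencer_poly g" by (rule poly_eq_if_eventually_eq)
qed

lemma dim_sym_maps_0: "dim (sym_maps 0 :: (real^'n \<Rightarrow> real^'m) set) > 0"
proof -
  have "(\<lambda>_. axis undefined 1) \<in> (sym_maps 0 :: (real^'n \<Rightarrow> real^'m) set)" by (auto simp: sym_maps_0_iff)
  moreover have "(\<lambda>_. axis undefined 1) \<noteq> (0 :: real^'n \<Rightarrow> real^'m)"
    by (auto simp: zero_fun_def fun_eq_iff)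
  ultimately have "sym_maps 0 \<noteq> {0 :: real^'n \<Rightarrow> real^'m}" by blast
  then show ?thesis using dim_zero_iff_fin_dim[OF subspace_sym_maps fin_dim_sym_maps] by blast
qed

text \<open>The summand dim g_0 = m is positive and the others are nonnegative.\<close>

lemma spencer_poly_nonzero:
  fixes g :: "nat \<Rightarrow> (real^'n \<Rightarrow> real^'m) set"
  assumes "symbolic_system g" "\<And>i j. i \<ge> 1 \<Longrightarrow> spencer_vanishes g i j"
  shows "spencer_poly g \<noteq> 0"
proof
  assume "spencer_poly g = 0"
  then have "(\<Sum>i\<le>CARD('n). real (dim (g i))) = 0"
    using poly_spencer_poly[OF assms, of "CARD('n)"] by simp
  then have "dim (g 0) = 0" by (subst (asm) sum_nonneg_eq_0_iff) auto
  then show False using dim_sym_maps_0 symbolic_system_facts(4)[OF assms(1)] by (metis less_irrefl)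
qed

section \<open>Moments and the leading coefficient\<close>

definition spencer_moment :: "(nat \<Rightarrow> (real^'n \<Rightarrow> real^'m) set) \<Rightarrow> nat \<Rightarrow> real" where
  "spencer_moment g s = (\<Sum>i\<le>CARD('n). (-1) ^ i * real (spencer_dim g 0 i) * (- real i) ^ s)"

lemma coeff_spencer_poly:
  "coeff (spencer_poly (g :: nat \<Rightarrow> (real^'n \<Rightarrow> real^'m) set)) r =
    (\<Sum>j\<le>CARD('n). coeff (shifted_binom CARD('n)) j * real (j choose r) * spencer_moment g (j - r))"
proof -
  let ?n = "CARD('n)"
  have "coeff (spencer_poly g) r = (\<Sum>i\<le>?n. \<Sum>j\<le>?n. (-1) ^ i * real (spencer_dim g 0 i) *
     (coeff (shifted_binom ?n) j * (real (j choose r) * (- real i) ^ (j - r))))"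
    unfolding spencer_poly_def coeff_sum coeff_smult
    by (subst coeff_pcompose_shift[of _ ?n]) (simp_all add: degree_shifted_binom sum_distrib_left)
  also have "\<dots> = (\<Sum>j\<le>?n. \<Sum>i\<le>?n. (-1) ^ i * real (spencer_dim g 0 i) *
     (coeff (shifted_binom ?n) j * (real (j choose r) * (- real i) ^ (j - r))))"
    by (rule sum.swap)
  also have "\<dots> = (\<Sum>j\<le>?n. coeff (shifted_binom ?n) j * real (j choose r) * spencer_moment g (j - r))"
    by (intro sum.cong refl) (simp add: spencer_moment_def sum_distrib_left mult_ac)
  finally show ?thesis .
qed

lemma functional_rank_eq_moment:
  fixes g :: "nat \<Rightarrow> (real^'n \<Rightarrow> real^'m) set"
  assumes "symbolic_system g" "\<And>i j. i \<ge> 1 \<Longrightarrow> spencer_vanishes g i j"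
  shows "functional_dim g \<le> CARD('n)"
    and "functional_rank g = spencer_moment g (CARD('n) - functional_dim g) / fact (CARD('n) - functional_dim g)"
proof -
  let ?n = "CARD('n)"
  let ?P = "spencer_poly g"
  have P: "hilbert_poly g = ?P" by (rule hilbert_poly_eq_spencer_poly[OF assms])
  have "\<exists>s\<le>?n. spencer_moment g s \<noteq> 0"
  proof (rule ccontr)
    assume "\<not> ?thesis"
    then have "coeff ?P r = 0" for r unfolding coeff_spencer_poly by (intro sum.neutral) auto
    then show False using spencer_poly_nonzero[OF assms] by (simp add: poly_eq_iff)
  qed
  then obtain s where s: "s \<le> ?n" "spencer_moment g s \<noteq> 0" "\<And>t. t < s \<Longrightarrow> spencer_moment g t = 0"
    using exists_least_iff[of "\<lambda>s. s \<le> ?n \<and> spencer_moment g s \<noteq> 0"] by (metis less_imp_le_nat order_trans)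
  let ?r = "?n - s"
  \<comment> \<open>The coefficient of degree \<open>r\<close> involves moments of order at most n -
    r, which is below \<open>s\<close> for \<open>r > ?r\<close>.\<close>
  have above: "coeff ?P r = 0" if "r > ?r" for r
    unfolding coeff_spencer_poly
  proof (intro sum.neutral ballI)
    fix j assume j: "j \<in> {..?n}"
    show "coeff (shifted_binom ?n) j * real (j choose r) * spencer_moment g (j - r) = 0"
    proof (cases "j < r")
      case False
      then have "j - r < s" using j that s(1) by simp
      then show ?thesis using s(3) by simp
    qed (simp add: binomial_eq_0)
  qed
  \<comment> \<open>In degree n - s only the index \<open>j = n\<close> reaches the moment of order
    \<open>s\<close>; smaller indices give vanishing moments.\<close>
  have vanish: "coeff (shifted_binom ?n) j * real (j choose ?r) * spencer_moment g (j - ?r) = 0" if "j < ?n" for j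
  proof (cases "j < ?r")
    case False
    then have "j - ?r < s" using that s(1) by simp
    then show ?thesis using s(3) by simp
  qed (simp add: binomial_eq_0)
  have "coeff ?P ?r = (\<Sum>j\<in>{?n}. coeff (shifted_binom ?n) j * real (j choose ?r) * spencer_moment g (j - ?r))"
    unfolding coeff_spencer_poly by (rule sum.mono_neutral_right) (use vanish in auto)
  also have "\<dots> = spencer_moment g s / (fact ?r * fact s)"
    using s(1) by (simp add: coeff_shifted_binom binomial_fact)
  finally have lead: "coeff ?P ?r = spencer_moment g s / (fact ?r * fact s)" .
  then have "coeff ?P ?r \<noteq> 0" using s(2) by simp
  then have deg: "degree ?P = ?r"
    using above by (metis le_degree leading_coeff_neq_0 le_neq_implies_less coeff_0)
  then have fd: "functional_dim g = ?r" by (simp add: functional_dim_def P)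
  then show "functional_dim g \<le> ?n" by simp
  have "functional_rank g = fact ?r * coeff ?P ?r"
    by (simp add: functional_rank_def fd P poly_0_coeff_0 coeff_higher_pderiv pochhammer_fact[symmetric])
  then show "functional_rank g = spencer_moment g (?n - functional_dim g) / fact (?n - functional_dim g)"
    using s(1) by (simp add: lead fd)
qed


lemma scaleR_fun_apply: "(c *\<^sub>R f) x = c *\<^sub>R f x"
  by (simp add: scaleR_fun_def)

section \<open>The annihilator ideal\<close>

definition op_ideal :: "(nat \<Rightarrow> (real^'n \<Rightarrow> real^'m) set) \<Rightarrow> (('n \<Rightarrow>\<^sub>0 nat) \<Rightarrow>\<^sub>0 real) set" where
  "op_ideal g = {F. \<forall>i. \<forall>q\<in>g i. diff_op F q = 0}"

text \<open>A coordinate of a derivative at 0 is a functional that sees one degree only, hence lies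
  in the graded dual, and these functionals separate polynomial maps.\<close>

lemma annihilator_eq_op_ideal:
  assumes sys: "symbolic_system g"
  shows "annihilator g = op_ideal g"
proof
  show "op_ideal g \<subseteq> annihilator g"
    by (auto simp: op_ideal_def annihilator_def dual_act_def graded_dual_def linear_0)
  show "annihilator g \<subseteq> op_ideal g"
  proof
    fix F assume F: "F \<in> annihilator g"
    show "F \<in> op_ideal g" unfolding op_ideal_def
    proof (intro CollectI allI ballI, rule ccontr)
      fix i q assume q: "q \<in> g i" and nz: "diff_op F q \<noteq> 0"
      note g = symbolic_system_facts[OF sys]
      have "diff_op F q \<in> poly_maps" using g(6)[OF q] by simp
      then obtain \<alpha> where "partial_deriv \<alpha> (diff_op F q) 0 \<noteq> 0"
        using ex_partial_deriv_nonzero_poly_maps nz by blast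
      then obtain j where j: "partial_deriv \<alpha> (diff_op F q) 0 $ j \<noteq> 0" by (metis vec_eq_iff zero_index)
      \<comment> \<open>\<open>graded_dual\<close> asks for functionals on all maps, so the one
        defined on polynomial maps is extended.\<close>
      have "lin_on poly_maps (\<lambda>p. partial_deriv \<alpha> p 0 $ j)"
        by (simp add: lin_on_def partial_deriv_add partial_deriv_scale plus_fun_apply scaleR_fun_apply)
      then obtain \<phi> where \<phi>: "linear \<phi>" "\<And>p. p \<in> poly_maps \<Longrightarrow> \<phi> p = partial_deriv \<alpha> p 0 $ j"
        using lin_on_linear_ext[OF subspace_poly_maps] by blast
      have "{i. \<exists>q\<in>g i. \<phi> q \<noteq> 0} \<subseteq> {mdeg \<alpha>}"
      proof safe
        fix i q assume "q \<in> g i" "\<phi> q \<noteq> 0"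
        then show "i = mdeg \<alpha>" using \<phi>(2)[OF g(6)] partial_deriv_sym_maps_at_0[of q i \<alpha>] g(2)[of i] by fastforce
      qed
      then have "\<phi> \<in> graded_dual g" unfolding graded_dual_def using \<phi>(1) finite_subset by blast
      then have "\<phi> (diff_op F q) = 0" using F q unfolding annihilator_def dual_act_def by blast
      then show False using j \<phi>(2) g(6)[OF q] by simp
    qed
  qed
qed

lemma partial_deriv_system:
  assumes sys: "symbolic_system g" and "q \<in> g (mdeg \<alpha> + l)"
  shows "partial_deriv \<alpha> q \<in> g l"
  using assms(2)
proof (induction \<alpha> arbitrary: l rule: expo_induct)
  case zero
  then show ?case using symbolic_system_facts(6)[OF sys] by fastforce
next
  case (add i \<alpha>)
  then have "q \<in> g (mdeg \<alpha> + Suc l)" by (simp add: mdeg_add)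
  then show ?case using add(1) symbolic_system_facts(5,6)[OF sys]
    by (metis partial_deriv_add_single)
qed

lemma op_ideal_add: "F \<in> op_ideal g \<Longrightarrow> G \<in> op_ideal g \<Longrightarrow> F + G \<in> op_ideal g"
  by (simp add: op_ideal_def diff_op_add)

lemma op_ideal_zero: "0 \<in> op_ideal g"
  by (simp add: op_ideal_def)

lemma op_ideal_mult:
  assumes "symbolic_system g" "F \<in> op_ideal g"
  shows "G * F \<in> op_ideal g"
  using assms symbolic_system_facts(6)[OF assms(1)] by (simp add: op_ideal_def diff_op_mult)

text \<open>The ideal is homogeneous because each \<open>g i\<close> consists of maps of a single
  degree.\<close>

lemma op_ideal_component:
  assumes "symbolic_system g" "\<And>k. hom_poly k (G k)" "(\<Sum>k<K. G k) \<in> op_ideal g" "k < K"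
  shows "G k \<in> op_ideal g"
  unfolding op_ideal_def
proof (intro CollectI allI ballI)
  fix i q assume q: "q \<in> g i"
  then have "q \<in> sym_maps i" using symbolic_system_facts(2)[OF assms(1)] by blast
  moreover have "diff_op (\<Sum>k<K. G k) q = 0" using assms(3) q by (simp add: op_ideal_def)
  ultimately show "diff_op (G k) q = 0" using diff_op_component_zero assms(2,4) by blast
qed

text \<open>Constants act as scalars on g_0 = N, which is not zero; the ideal is therefore
  proper.\<close>

lemma one_notin_op_ideal:
  fixes g :: "nat \<Rightarrow> (real^'n \<Rightarrow> real^'m) set"
  assumes "symbolic_system g"
  shows "pconst c \<in> op_ideal g \<longleftrightarrow> c = 0"
proof
  assume c: "pconst c \<in> op_ideal g"
  note g = symbolic_system_facts[OF assms]
  have "g 0 \<noteq> {0}" using dim_sym_maps_0[where ?'n = 'n and ?'m = 'm] g(4) by (metis dim_zero_set less_irrefl)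
  then obtain q where q: "q \<in> g 0" "q \<noteq> 0" using g(7) by blast
  then have "c *\<^sub>R q = 0" using c diff_op_pconst[OF g(6)[OF q(1)], of c] by (simp add: op_ideal_def)
  then show "c = 0" using q(2) by simp
next
  assume "c = 0"
  then show "pconst c \<in> op_ideal g" by (simp add: pconst_def op_ideal_zero)
qed

text \<open>A nonzero \<open>diff_op F q\<close> can be differentiated further down to a nonzero constant.\<close>

lemma op_ideal_hom_iff:
  assumes sys: "symbolic_system g" and F: "hom_poly k F" and z: "\<And>q. q \<in> g k \<Longrightarrow> diff_op F q = 0"
  shows "F \<in> op_ideal g"
  unfolding op_ideal_def
proof (intro CollectI allI ballI, rule ccontr)
  fix i q assume q: "q \<in> g i" and nz: "diff_op F q \<noteq> 0"
  note g = symbolic_system_facts[OF sys]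
  have qs: "q \<in> sym_maps i" using q g(2) by blast
  then have "k \<le> i" using nz diff_op_hom_less[OF F] by (metis not_less)
  then obtain l where l: "i = k + l" using le_Suc_ex by blast
  have "diff_op F q \<in> sym_maps l" using diff_op_hom_sym_maps[OF F, of q l] qs l by simp
  then obtain \<beta> where \<beta>: "mdeg \<beta> = l" "partial_deriv \<beta> (diff_op F q) 0 \<noteq> 0"
    using ex_partial_deriv_nonzero nz by blast
  have "partial_deriv \<beta> q \<in> g k" using partial_deriv_system[OF sys, of q \<beta> k] q \<beta> l by (simp add: add.commute)
  then have "diff_op F (partial_deriv \<beta> q) = 0" by (rule z)
  moreover have "diff_op F (partial_deriv \<beta> q) = partial_deriv \<beta> (diff_op F q)"
  proof -
    have q: "q \<in> poly_maps" using g(6) q by blast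
    have "partial_deriv \<beta> p = diff_op (Poly_Mapping.single \<beta> 1) p" if "p \<in> poly_maps" for p
      by (simp add: diff_op_single)
    then show ?thesis using q diff_op_mult[OF q] by (metis diff_op_poly_maps mult.commute)
  qed
  ultimately show False using \<beta>(2) by (simp add: zero_fun_apply)
qed

section \<open>Complex polynomial functions\<close>

definition real_eval :: "(('n::finite \<Rightarrow>\<^sub>0 nat) \<Rightarrow>\<^sub>0 real) \<Rightarrow> complex^'n \<Rightarrow> complex" where
  "real_eval F = mpoly_eval (Poly_Mapping.map complex_of_real F)"

abbreviation coord :: "'n \<Rightarrow> complex^'n \<Rightarrow> complex" where
  "coord i \<equiv> (\<lambda>\<xi>. \<xi> $ i)"

abbreviation cfun :: "complex \<Rightarrow> complex^'n \<Rightarrow> complex" where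
  "cfun c \<equiv> (\<lambda>_. c)"

lemma mpoly_eval_coeff_sum: "mpoly_eval F \<xi> = coeff_sum (\<lambda>\<alpha> c. c * monom_eval \<xi> \<alpha>) F"
  by (simp add: mpoly_eval_def coeff_sum_def)

lemma mpoly_eval_add: "mpoly_eval (F + G) = mpoly_eval F + mpoly_eval G"
  unfolding fun_eq_iff plus_fun_apply mpoly_eval_coeff_sum
  by (intro allI coeff_sum_add) (simp_all add: distrib_right)

lemma mpoly_eval_pconst: "mpoly_eval (pconst c) = cfun c"
  unfolding fun_eq_iff mpoly_eval_coeff_sum pconst_def by (simp add: coeff_sum_single)

lemma mpoly_eval_zero [simp]: "mpoly_eval 0 = 0"
  by (simp add: fun_eq_iff mpoly_eval_def zero_fun_apply)

lemma mpoly_eval_single: "mpoly_eval (Poly_Mapping.single \<alpha> c) \<xi> = c * monom_eval \<xi> \<alpha>"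
  unfolding mpoly_eval_coeff_sum by (simp add: coeff_sum_single)

lemma mpoly_eval_pvar_mult: "mpoly_eval (pvar i * F) = coord i * mpoly_eval F"
proof (induction F rule: poly_mapping_induct_single)
  case (single \<alpha> c)
  show ?case
    by (rule ext) (simp add: single_pvar_mult[symmetric] mpoly_eval_single monom_eval_add times_fun_apply)
next
  case (add F G)
  then show ?case by (simp add: distrib_left mpoly_eval_add)
qed

lemma map_of_real_add: "Poly_Mapping.map complex_of_real (F + G) = Poly_Mapping.map complex_of_real F + Poly_Mapping.map complex_of_real G"
  by (rule poly_mapping_eqI) (simp add: lookup_add map.rep_eq when_def flip: of_real_add)

lemma map_of_real_zero: "Poly_Mapping.map complex_of_real 0 = 0"
  by (rule poly_mapping_eqI) (simp add: map.rep_eq)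

lemma map_of_real_single: "Poly_Mapping.map complex_of_real (Poly_Mapping.single \<alpha> c) = Poly_Mapping.single \<alpha> (complex_of_real c)"
  by (rule poly_mapping_eqI) (simp add: lookup_single map.rep_eq when_def)

lemma real_eval_add: "real_eval (F + G) = real_eval F + real_eval G"
  by (simp add: real_eval_def map_of_real_add mpoly_eval_add)

lemma real_eval_single: "real_eval (Poly_Mapping.single \<alpha> c) \<xi> = complex_of_real c * monom_eval \<xi> \<alpha>"
  by (simp add: real_eval_def map_of_real_single mpoly_eval_single)

lemma real_eval_pconst: "real_eval (pconst c) = cfun (complex_of_real c)"
  by (rule ext) (simp add: pconst_def real_eval_single)

lemma real_eval_zero [simp]: "real_eval 0 = 0"
  using real_eval_pconst[of 0] by (simp add: pconst_def zero_fun_def)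

lemma real_eval_pvar_mult: "real_eval (pvar i * F) = coord i * real_eval F"
proof (induction F rule: poly_mapping_induct_single)
  case (single \<alpha> c)
  show ?case
    by (rule ext) (simp add: single_pvar_mult[symmetric] real_eval_single monom_eval_add times_fun_apply)
next
  case (add F G)
  then show ?case by (simp add: distrib_left real_eval_add)
qed

lemma real_eval_sum: "real_eval (\<Sum>i\<in>A. F i) = (\<Sum>i\<in>A. real_eval (F i))"
  by (induction A rule: infinite_finite_induct) (simp_all add: real_eval_add)

section \<open>Polynomial functions and forms\<close>

text \<open>Complex polynomials are handled as functions generated from constants and coordinates,
  since from here on their values on sets are what matters.\<close>

inductive pfun :: "(complex^'n \<Rightarrow> complex) \<Rightarrow> bool" where
  pfun_const: "pfun (cfun c)"
| pfun_coord: "pfun f \<Longrightarrow> pfun (coord i * f)"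
| pfun_add: "pfun f \<Longrightarrow> pfun h \<Longrightarrow> pfun (f + h)"

inductive hfun :: "nat \<Rightarrow> (complex^'n \<Rightarrow> complex) \<Rightarrow> bool" where
  hfun_const: "hfun 0 (cfun c)"
| hfun_zero: "hfun k 0"
| hfun_coord: "hfun k f \<Longrightarrow> hfun (Suc k) (coord i * f)"
| hfun_add: "hfun k f \<Longrightarrow> hfun k h \<Longrightarrow> hfun k (f + h)"

lemma hfun_pfun: "hfun k f \<Longrightarrow> pfun f"
  by (induction rule: hfun.induct) (auto intro: pfun.intros simp: zero_fun_def)

lemma cfun_mult: "cfun c * cfun d = cfun (c * d)"
  by (simp add: fun_eq_iff times_fun_apply)

lemma pfun_mult:
  assumes "pfun f" "pfun h"
  shows "pfun (f * h)"
  using assms(1)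
proof (induction rule: pfun.induct)
  case (pfun_const c)
  show ?case using assms(2)
  proof (induction rule: pfun.induct)
    case (pfun_const d)
    show ?case unfolding cfun_mult by (rule pfun.pfun_const)
  next
    case (pfun_coord f i)
    then show ?case using pfun.pfun_coord by (metis mult.left_commute)
  qed (simp add: distrib_left pfun.pfun_add)
next
  case (pfun_coord f i)
  then show ?case by (simp add: mult.assoc pfun.pfun_coord)
qed (simp add: distrib_right pfun.pfun_add)

lemma hfun_cmult:
  assumes "hfun k f"
  shows "hfun k (cfun c * f)"
  using assms
proof (induction rule: hfun.induct)
  case (hfun_const d)
  show ?case unfolding cfun_mult by (rule hfun.hfun_const)
next
  case (hfun_coord k f i)
  then show ?case using hfun.hfun_coord by (metis mult.left_commute)
qed (simp_all add: distrib_left hfun.intros)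

lemma hfun_mult:
  assumes "hfun k f" "hfun l h"
  shows "hfun (k + l) (f * h)"
  using assms(1)
proof (induction rule: hfun.induct)
  case (hfun_const c)
  then show ?case using hfun_cmult[OF assms(2)] by simp
next
  case (hfun_coord k f i)
  then show ?case using hfun.hfun_coord by (simp add: mult.assoc)
qed (simp_all add: distrib_right hfun.intros)

lemma hfun_monom: "hfun (mdeg \<alpha>) (\<lambda>\<xi>. monom_eval \<xi> \<alpha>)"
proof (induction \<alpha> rule: expo_induct)
  case zero
  show ?case using hfun_const[of 1] by simp
next
  case (add i \<alpha>)
  have "(\<lambda>\<xi>. monom_eval \<xi> (Poly_Mapping.single i 1 + \<alpha>)) = coord i * (\<lambda>\<xi>. monom_eval \<xi> \<alpha>)"
    by (simp add: fun_eq_iff monom_eval_add times_fun_apply)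
  then show ?case using hfun_coord[OF add] by (simp add: mdeg_add)
qed

lemma hfun_mpoly_eval: "hom_poly k F \<Longrightarrow> hfun k (mpoly_eval F)"
proof (induction rule: hom_poly_induct)
  case (single \<alpha> c)
  have "mpoly_eval (Poly_Mapping.single \<alpha> c) = cfun c * (\<lambda>\<xi>. monom_eval \<xi> \<alpha>)"
    by (simp add: fun_eq_iff mpoly_eval_single times_fun_apply)
  then show ?case using hfun_cmult[OF hfun_monom[of \<alpha>]] single by simp
qed (simp_all add: mpoly_eval_add hfun.intros)

lemma hfun_ex_mpoly: "hfun k f \<Longrightarrow> \<exists>F. hom_poly k F \<and> f = mpoly_eval F"
proof (induction rule: hfun.induct)
  case (hfun_const c)
  show ?case by (rule exI[of _ "pconst c"]) (simp add: hom_poly_pconst mpoly_eval_pconst)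
next
  case (hfun_zero k)
  show ?case by (rule exI[of _ 0]) simp
next
  case (hfun_coord k f i)
  then obtain F where "hom_poly k F" "f = mpoly_eval F" by blast
  then show ?case using hom_poly_mult[OF hom_poly_pvar[of i]]
    by (intro exI[of _ "pvar i * F"]) (simp add: mpoly_eval_pvar_mult)
next
  case (hfun_add k f h)
  then obtain F H where "hom_poly k F" "f = mpoly_eval F" "hom_poly k H" "h = mpoly_eval H" by blast
  then show ?case by (intro exI[of _ "F + H"]) (simp add: mpoly_eval_add hom_poly_add)
qed

lemma pfun_mpoly_eval: "pfun (mpoly_eval F)"
  by (induction F rule: poly_induct) (simp_all add: mpoly_eval_pconst mpoly_eval_pvar_mult mpoly_eval_add pfun.intros)

lemma pfun_real_eval: "pfun (real_eval F)"
  unfolding real_eval_def by (rule pfun_mpoly_eval)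

lemma map_of_real_hom_poly: "hom_poly k F \<Longrightarrow> hom_poly k (Poly_Mapping.map complex_of_real F)"
proof (induction rule: hom_poly_induct)
  case zero
  show ?case by (simp add: map_of_real_zero)
qed (simp_all add: map_of_real_single hom_poly_single map_of_real_add hom_poly_add)

lemma hfun_real_eval: "hom_poly k F \<Longrightarrow> hfun k (real_eval F)"
  unfolding real_eval_def by (intro hfun_mpoly_eval map_of_real_hom_poly)

lemma hfun_scale: "hfun k f \<Longrightarrow> f (c *s \<xi>) = c ^ k * f \<xi>"
  by (induction rule: hfun.induct) (auto simp: times_fun_apply plus_fun_apply zero_fun_apply algebra_simps)

lemma mpoly_homogeneous_hfun: "mpoly_homogeneous F \<longleftrightarrow> (\<exists>k. hom_poly k F)"
  by (simp add: mpoly_homogeneous_def hom_poly_def)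

lemma span_singleton_iff: "\<eta> \<in> vec.span {\<xi>} \<longleftrightarrow> (\<exists>c. \<eta> = c *s (\<xi> :: complex^'n))"
  by (auto simp: vec.span_singleton)

text \<open>\<open>zero_locus\<close> tests every point of a line; for forms one nonzero point
  decides.\<close>

lemma zero_locus_homogeneous:
  assumes "\<And>f. f \<in> F \<Longrightarrow> mpoly_homogeneous f" "\<xi> \<noteq> 0"
  shows "vec.span {\<xi>} \<in> zero_locus F \<longleftrightarrow> (\<forall>f\<in>F. mpoly_eval f \<xi> = 0)"
proof
  assume "vec.span {\<xi>} \<in> zero_locus F"
  then show "\<forall>f\<in>F. mpoly_eval f \<xi> = 0"
    unfolding zero_locus_def using vec.span_base[of \<xi> "{\<xi>}"] by blast
next
  assume z: "\<forall>f\<in>F. mpoly_eval f \<xi> = 0"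
  have "mpoly_eval f \<eta> = 0" if f: "f \<in> F" and \<eta>: "\<eta> \<in> vec.span {\<xi>}" for f \<eta>
  proof -
    obtain k where "hfun k (mpoly_eval f)" using assms(1)[OF f] hfun_mpoly_eval mpoly_homogeneous_hfun by blast
    moreover obtain c where "\<eta> = c *s \<xi>" using \<eta> span_singleton_iff by blast
    ultimately show ?thesis using z f hfun_scale[of k "mpoly_eval f" c \<xi>] by simp
  qed
  then show "vec.span {\<xi>} \<in> zero_locus F"
    unfolding zero_locus_def proj_points_def using assms(2) by auto
qed

section \<open>Growth of polynomial functions on a cone\<close>

text \<open>Functions on \<open>Z\<close> are represented by extension by 0, so that those on
  different sets share one vector space.\<close>

definition restr :: "('x set) \<Rightarrow> ('x \<Rightarrow> complex) \<Rightarrow> 'x \<Rightarrow> complex" where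
  "restr Z f = (\<lambda>\<xi>. if \<xi> \<in> Z then f \<xi> else 0)"

lemma linear_restr: "linear (restr Z)"
  by (rule linearI) (auto simp: restr_def fun_eq_iff plus_fun_apply scaleR_fun_def)

lemma subspace_hfun: "subspace {f. hfun k f}"
proof (rule subspaceI)
  fix c f assume "f \<in> {f. hfun k f}"
  moreover have "c *\<^sub>R f = cfun (complex_of_real c) * f" by (simp add: fun_eq_iff scaleR_fun_def times_fun_apply scaleR_conv_of_real)
  ultimately show "c *\<^sub>R f \<in> {f. hfun k f}" using hfun_cmult by simp
qed (auto intro: hfun.intros)

text \<open>Dimensions are real throughout, hence two generators, 1 and i, for each
  monomial.\<close>

lemma fin_dim_hfun: "fin_dim {f :: complex^'n \<Rightarrow> complex. hfun k f}"
proof (rule fin_dimI)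
  let ?B = "(\<lambda>(\<alpha>, c) \<xi>. c * monom_eval \<xi> \<alpha>) ` ({\<alpha>. mdeg \<alpha> = k} \<times> {1, \<i>}) :: (complex^'n \<Rightarrow> complex) set"
  show "finite ?B" by simp
  show "{f. hfun k f} \<subseteq> span ?B"
  proof
    fix f :: "complex^'n \<Rightarrow> complex" assume "f \<in> {f. hfun k f}"
    then obtain F where F: "hom_poly k F" "f = mpoly_eval F" using hfun_ex_mpoly by auto
    have "mpoly_eval F \<in> span ?B"
      using F(1)
    proof (induction rule: hom_poly_induct)
      case (single \<alpha> c)
      have "mpoly_eval (Poly_Mapping.single \<alpha> c) = Re c *\<^sub>R (\<lambda>\<xi>. 1 * monom_eval \<xi> \<alpha>) + Im c *\<^sub>R (\<lambda>\<xi>. \<i> * monom_eval \<xi> \<alpha>)"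
      proof
        fix \<xi>
        have "c * monom_eval \<xi> \<alpha> = (complex_of_real (Re c) + \<i> * complex_of_real (Im c)) * monom_eval \<xi> \<alpha>"
          using complex_eq[of c] by simp
        then show "mpoly_eval (Poly_Mapping.single \<alpha> c) \<xi> =
          (Re c *\<^sub>R (\<lambda>\<xi>. 1 * monom_eval \<xi> \<alpha>) + Im c *\<^sub>R (\<lambda>\<xi>. \<i> * monom_eval \<xi> \<alpha>)) \<xi>"
          by (simp add: mpoly_eval_single plus_fun_apply scaleR_fun_def scaleR_conv_of_real algebra_simps)
      qed
      moreover have "(\<lambda>\<xi>. 1 * monom_eval \<xi> \<alpha>) \<in> ?B" "(\<lambda>\<xi>. \<i> * monom_eval \<xi> \<alpha>) \<in> ?B"
        using single by (force intro: image_eqI)+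
      ultimately show ?case using span_add span_scale span_base by metis
    next
      case zero
      then show ?case using span_zero by simp
    next
      case (add F G)
      then show ?case using span_add by (simp add: mpoly_eval_add)
    qed
    then show "f \<in> span ?B" using F by simp
  qed
qed

text \<open>For a cone \<open>Z\<close>, the piece of degree \<open>k\<close> of its homogeneous
  coordinate ring.\<close>

definition hfuns_on :: "(complex^'n) set \<Rightarrow> nat \<Rightarrow> (complex^'n \<Rightarrow> complex) set" where
  "hfuns_on Z k = restr Z ` {f. hfun k f}"

lemma hfuns_on_subspace [simp]: "subspace (hfuns_on Z k)" "fin_dim (hfuns_on Z k)"
  unfolding hfuns_on_def
  using subspace_image_lin_on[OF subspace_hfun linear_lin_on[OF linear_restr]]
    fin_dim_image[OF subspace_hfun linear_lin_on[OF linear_restr] fin_dim_hfun] by auto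

lemma hfuns_on_restrict: "X \<subseteq> Y \<Longrightarrow> restr X ` hfuns_on Y k = hfuns_on X k"
  unfolding hfuns_on_def image_image
  by (rule image_cong) (auto simp: restr_def fun_eq_iff)

lemma dim_hfuns_on_mono:
  assumes "X \<subseteq> Y"
  shows "dim (hfuns_on X k) \<le> dim (hfuns_on Y k)"
  using dim_image_le_lin_on[OF hfuns_on_subspace(1) linear_lin_on[OF linear_restr] hfuns_on_subspace(2), of X Y k]
  unfolding hfuns_on_restrict[OF assms] .

lemma dim_hfuns_on_pos:
  assumes "\<xi> \<in> Z" "\<xi> \<noteq> 0"
  shows "dim (hfuns_on Z k) \<ge> 1"
proof -
  obtain i where i: "\<xi> $ i \<noteq> 0" using assms(2) by (metis vec_eq_iff zero_index)
  have "hfun k (\<lambda>\<xi>. \<xi> $ i ^ k)"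
  proof (induction k)
    case 0
    show ?case using hfun_const[of 1] by simp
  next
    case (Suc k)
    have "(\<lambda>\<xi>. \<xi> $ i ^ Suc k) = coord i * (\<lambda>\<xi>::complex^'a. \<xi> $ i ^ k)" by (simp add: fun_eq_iff times_fun_apply)
    then show ?case using hfun_coord[OF Suc] by metis
  qed
  then have "restr Z (\<lambda>\<xi>. \<xi> $ i ^ k) \<in> hfuns_on Z k" by (simp add: hfuns_on_def)
  moreover have "restr Z (\<lambda>\<xi>. \<xi> $ i ^ k) \<noteq> 0"
    using assms i by (auto simp: restr_def fun_eq_iff zero_fun_apply intro!: exI[of _ \<xi>])
  ultimately have "hfuns_on Z k \<noteq> {0}" by blast
  then have "dim (hfuns_on Z k) \<noteq> 0" using dim_zero_iff_fin_dim[OF hfuns_on_subspace] by blast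
  then show ?thesis by simp
qed

text \<open>
  A form that vanishes on \<open>X\<close> but not on the irreducible set \<open>Y\<close> is a nonzerodivisor on the
  functions on \<open>Y\<close>.
\<close>

lemma irreducible_hfuns_drop:
  assumes Y: "irreducible_closed Y" and X: "zariski_closed X" "X \<subset> Y" "X \<noteq> {}"
  shows "\<exists>e\<ge>1. \<forall>k. dim (hfuns_on (\<Union>Y) k) + dim (hfuns_on (\<Union>X) (k + e)) \<le> dim (hfuns_on (\<Union>Y) (k + e))"
proof -
  obtain F where F: "\<And>f. f \<in> F \<Longrightarrow> mpoly_homogeneous f" "X = zero_locus F" using X(1) by (auto simp: zariski_closed_def)
  have "zariski_closed Y" using Y by (simp add: irreducible_closed_def)
  then obtain FY where FY: "\<And>f. f \<in> FY \<Longrightarrow> mpoly_homogeneous f" "Y = zero_locus FY"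
    by (auto simp: zariski_closed_def)
  have lines: "\<exists>\<xi>. L = vec.span {\<xi>} \<and> \<xi> \<noteq> 0" if "L \<in> Y" for L
    using that FY(2) by (auto simp: zero_locus_def proj_points_def)
  obtain L where L: "L \<in> Y" "L \<notin> X" using X(2) by blast
  obtain \<xi> where \<xi>: "L = vec.span {\<xi>}" "\<xi> \<noteq> 0" using lines L by blast
  then obtain f where f: "f \<in> F" "mpoly_eval f \<xi> \<noteq> 0" using L F zero_locus_homogeneous[OF F(1)] by blast
  then obtain e where e: "hom_poly e f" using F(1) mpoly_homogeneous_hfun by blast
  define \<phi> where "\<phi> = mpoly_eval f"
  have he: "hfun e \<phi>" unfolding \<phi>_def using e by (rule hfun_mpoly_eval)
  have \<xi>L: "\<xi> \<in> L" using \<xi> vec.span_base[of \<xi> "{\<xi>}"] by simp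
  have \<phi>X: "\<phi> \<eta> = 0" if "\<eta> \<in> \<Union>X" for \<eta>
    using that f(1) F(2) unfolding \<phi>_def zero_locus_def by blast
  \<comment> \<open>A constant that vanishes on the nonempty \<open>X\<close> vanishes at
    \<open>\<xi>\<close> too; the two values are compared through the origin.\<close>
  have e1: "e \<ge> 1"
  proof (rule ccontr)
    assume "\<not> e \<ge> 1"
    then have e0: "hfun 0 \<phi>" using he by (simp add: not_le)
    obtain M where M: "M \<in> X" using X(3) by blast
    obtain \<mu> where "M = vec.span {\<mu>}" using M X(2) lines by blast
    then have "\<mu> \<in> \<Union>X" using M vec.span_base[of \<mu> "{\<mu>}"] by blast
    then have "\<phi> (0 *s \<mu>) = 0" using \<phi>X hfun_scale[OF e0, of 0 \<mu>] by simp
    then have "\<phi> (0 *s \<xi>) = 0" by simp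
    then show False using hfun_scale[OF e0, of 0 \<xi>] f(2) unfolding \<phi>_def by simp
  qed
  \<comment> \<open>\<open>Y\<close> is the union of its closed subsets where \<open>f\<close> and
    where \<open>h\<close> vanish. Irreducibility makes one of them all of \<open>Y\<close>, and
    \<open>f\<close> is nonzero at \<open>\<xi>\<close>.\<close>
  have nzd: "h \<eta> = 0" if h: "hfun k h" "\<And>\<eta>. \<eta> \<in> \<Union>Y \<Longrightarrow> \<phi> \<eta> * h \<eta> = 0" and \<eta>: "\<eta> \<in> \<Union>Y" for h k \<eta>
  proof -
    obtain H where H: "hom_poly k H" "h = mpoly_eval H" using hfun_ex_mpoly[OF h(1)] by blast
    let ?A = "zero_locus (insert f FY)" and ?B = "zero_locus (insert H FY)"
    have hom: "mpoly_homogeneous f" "mpoly_homogeneous H" using e H(1) mpoly_homogeneous_hfun by blast+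
    have cl: "zariski_closed ?A" "zariski_closed ?B"
      unfolding zariski_closed_def using hom FY(1) by blast+
    have "Y \<subseteq> ?A \<union> ?B"
    proof
      fix M assume M: "M \<in> Y"
      obtain \<mu> where \<mu>: "M = vec.span {\<mu>}" "\<mu> \<noteq> 0" using lines M by blast
      then have "\<mu> \<in> \<Union>Y" using M vec.span_base[of \<mu> "{\<mu>}"] by blast
      then have z: "mpoly_eval f \<mu> = 0 \<or> mpoly_eval H \<mu> = 0" using h(2)[of \<mu>] H(2) unfolding \<phi>_def by simp
      have y: "\<forall>f\<in>FY. mpoly_eval f \<mu> = 0" using M \<mu> FY zero_locus_homogeneous[of FY \<mu>] by blast
      show "M \<in> ?A \<union> ?B"
        using z y zero_locus_homogeneous[of "insert f FY" \<mu>] zero_locus_homogeneous[of "insert H FY" \<mu>] hom FY(1) \<mu> by blast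
    qed
    moreover have "?A \<subseteq> Y" "?B \<subseteq> Y" unfolding FY(2) zero_locus_def by blast+
    ultimately have "Y = ?A \<union> ?B" by blast
    then have "Y = ?A \<or> Y = ?B" using Y cl unfolding irreducible_closed_def by blast
    moreover have "L \<notin> ?A" using \<xi>L f(2) unfolding zero_locus_def by blast
    ultimately have "Y = ?B" using L by blast
    then show ?thesis using \<eta> H(2) unfolding zero_locus_def by blast
  qed
  have "dim (hfuns_on (\<Union>Y) k) + dim (hfuns_on (\<Union>X) (k + e)) \<le> dim (hfuns_on (\<Union>Y) (k + e))" for k
  proof -
    let ?W = "hfuns_on (\<Union>Y) (k + e)"
    have lin: "lin_on S (\<lambda>u. \<phi> * u)" for S
      by (simp add: lin_on_def distrib_left) (simp add: fun_eq_iff times_fun_apply scaleR_fun_def)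
    \<comment> \<open>Multiplication by \<open>\<phi>\<close> embeds degree \<open>k\<close> on
      \<open>Y\<close> into the kernel of restriction to \<open>X\<close> in degree
      \<open>k + e\<close>.\<close>
    have rn: "dim ?W = dim {u \<in> ?W. restr (\<Union>X) u = 0} + dim (restr (\<Union>X) ` ?W)"
      by (rule rank_nullity[OF hfuns_on_subspace(1) linear_lin_on[OF linear_restr] hfuns_on_subspace(2)])
    have "restr (\<Union>X) ` ?W = hfuns_on (\<Union>X) (k + e)"
      by (rule hfuns_on_restrict) (use X in blast)
    note rn = rn[unfolded this]
    have a: "dim (hfuns_on (\<Union>Y) k) = dim ((\<lambda>u. \<phi> * u) ` hfuns_on (\<Union>Y) k)"
    proof (rule dim_inj_lin_on[OF hfuns_on_subspace(1) lin hfuns_on_subspace(2), symmetric])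
      fix u assume u: "u \<in> hfuns_on (\<Union>Y) k" "\<phi> * u = 0"
      then obtain h where h: "hfun k h" "u = restr (\<Union>Y) h" by (auto simp: hfuns_on_def)
      have "\<phi> \<eta> * h \<eta> = 0" if "\<eta> \<in> \<Union>Y" for \<eta>
        using fun_cong[OF u(2), of \<eta>] that h(2) by (simp add: times_fun_apply zero_fun_apply restr_def)
      then have "h \<eta> = 0" if "\<eta> \<in> \<Union>Y" for \<eta> using nzd[OF h(1) _ that] by blast
      then show "u = 0" unfolding h(2) restr_def by (auto simp: fun_eq_iff zero_fun_apply)
    qed
    have "(\<lambda>u. \<phi> * u) ` hfuns_on (\<Union>Y) k \<subseteq> {u \<in> ?W. restr (\<Union>X) u = 0}"
    proof
      fix w assume "w \<in> (\<lambda>u. \<phi> * u) ` hfuns_on (\<Union>Y) k"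
      then obtain h where h: "hfun k h" "w = \<phi> * restr (\<Union>Y) h" by (auto simp: hfuns_on_def)
      have "w = restr (\<Union>Y) (\<phi> * h)" unfolding h(2) by (auto simp: restr_def fun_eq_iff times_fun_apply)
      moreover have "hfun (k + e) (\<phi> * h)" using hfun_mult[OF he h(1)] by (simp add: add.commute)
      moreover have "restr (\<Union>X) w = 0" unfolding h(2) using \<phi>X
        by (auto simp: restr_def fun_eq_iff times_fun_apply zero_fun_apply)
      ultimately show "w \<in> {u \<in> ?W. restr (\<Union>X) u = 0}" by (simp add: hfuns_on_def)
    qed
    then have "dim ((\<lambda>u. \<phi> * u) ` hfuns_on (\<Union>Y) k) \<le> dim {u \<in> ?W. restr (\<Union>X) u = 0}"
      by (rule dim_le_fin_dim[rotated]) (rule fin_dim_subset[OF hfuns_on_subspace(2)], blast)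
    then have "dim (hfuns_on (\<Union>Y) k) \<le> dim {u \<in> ?W. restr (\<Union>X) u = 0}"
      by (rule order_trans[OF eq_refl[OF a]])
    then show ?thesis unfolding rn by simp
  qed
  then show ?thesis using e1 by blast
qed

section \<open>Growth along chains of irreducible sets\<close>

definition hgrowth :: "(complex^'n) set set \<Rightarrow> nat \<Rightarrow> nat" where
  "hgrowth X K = (\<Sum>k\<le>K. dim (hfuns_on (\<Union>X) k))"

lemma hgrowth_mono: "K \<le> L \<Longrightarrow> hgrowth X K \<le> hgrowth X L"
  unfolding hgrowth_def by (rule sum_mono2) auto

text \<open>The inequality is summed over all degrees; those below \<open>e\<close>, which it does
  not reach, are covered by restriction from \<open>Y\<close> to \<open>X\<close>.\<close>

lemma hgrowth_drop:
  assumes "irreducible_closed Y" "zariski_closed X" "X \<subset> Y" "X \<noteq> {}"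
  obtains e where "e \<ge> 1" "\<And>K. hgrowth Y K + hgrowth X (K + e) \<le> hgrowth Y (K + e)"
proof -
  obtain e where e: "e \<ge> 1" "\<And>k. dim (hfuns_on (\<Union>Y) k) + dim (hfuns_on (\<Union>X) (k + e)) \<le> dim (hfuns_on (\<Union>Y) (k + e))"
    using irreducible_hfuns_drop[OF assms] by blast
  have split: "(\<Sum>k\<le>K + e. f k) = (\<Sum>k<e. f k) + (\<Sum>k\<le>K. f (k + e))" for f :: "nat \<Rightarrow> nat" and K
    by (induction K) (simp_all add: lessThan_Suc_atMost[symmetric])
  have "hgrowth Y K + hgrowth X (K + e) \<le> hgrowth Y (K + e)" for K
  proof -
    have "(\<Sum>k<e. dim (hfuns_on (\<Union>X) k)) \<le> (\<Sum>k<e. dim (hfuns_on (\<Union>Y) k))"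
      using assms(3) by (intro sum_mono dim_hfuns_on_mono) blast
    moreover have "(\<Sum>k\<le>K. dim (hfuns_on (\<Union>Y) k)) + (\<Sum>k\<le>K. dim (hfuns_on (\<Union>X) (k + e))) \<le> (\<Sum>k\<le>K. dim (hfuns_on (\<Union>Y) (k + e)))"
      unfolding sum.distrib[symmetric] by (intro sum_mono e(2))
    ultimately show ?thesis unfolding hgrowth_def split by linarith
  qed
  then show ?thesis using that e(1) by blast
qed

lemma hgrowth_lower:
  assumes "X \<noteq> {}" "X \<subseteq> proj_points"
  shows "hgrowth X K \<ge> K + 1"
proof -
  obtain \<xi> where \<xi>: "vec.span {\<xi>} \<in> X" "\<xi> \<noteq> 0" using assms by (auto simp: proj_points_def)
  then have "\<xi> \<in> \<Union>X" using vec.span_base[of \<xi> "{\<xi>}"] by blast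
  then have "(\<Sum>k\<le>K. dim (hfuns_on (\<Union>X) k)) \<ge> (\<Sum>k\<le>K. 1)"
    by (intro sum_mono dim_hfuns_on_pos[OF _ \<xi>(2)])
  then show ?thesis by (simp add: hgrowth_def)
qed

text \<open>Iterating \<open>s\<close> times gives \<open>s * HX K \<le> HY (K + s * e)\<close>. For
  s = K + 1 the bound on the right is a power of (K + 1)(e + 1), and dividing by K + 1 lowers the
  exponent by one.\<close>

lemma growth_exponent_drop:
  fixes HX HY :: "nat \<Rightarrow> nat"
  assumes mono: "\<And>K L. K \<le> L \<Longrightarrow> HX K \<le> HX L"
    and drop: "\<And>K. HY K + HX (K + e) \<le> HY (K + e)"
    and bound: "\<And>K. HY K \<le> C * (K + 1) ^ Suc d"
  shows "HX K \<le> (C * (e + 1) ^ Suc d) * (K + 1) ^ d"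
proof -
  have "s * HX K \<le> HY (K + s * e)" for s
  proof (induction s)
    case (Suc s)
    have "HX K \<le> HX (K + s * e + e)" by (rule mono) simp
    then show ?case using Suc drop[of "K + s * e"] by (simp add: algebra_simps)
  qed simp
  then have "(K + 1) * HX K \<le> HY (K + (K + 1) * e)" .
  also have "\<dots> \<le> C * (K + (K + 1) * e + 1) ^ Suc d" by (rule bound)
  also have "K + (K + 1) * e + 1 = (K + 1) * (e + 1)" by (simp add: algebra_simps)
  finally have "(K + 1) * HX K \<le> (K + 1) * ((C * (e + 1) ^ Suc d) * (K + 1) ^ d)"
    by (simp only: power_mult_distrib power_Suc mult_ac)
  then show ?thesis by (simp only: mult_le_cancel1)
qed

text \<open>Each step down the chain costs one exponent, and at the bottom the exponent must still
  be positive because a nonempty set has at least one function in every degree.\<close>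

lemma irreducible_chain_length:
  assumes "\<And>i. i \<le> l \<Longrightarrow> irreducible_closed (D i)" "\<And>i. i < l \<Longrightarrow> D i \<subset> D (Suc i)"
    "\<And>K. hgrowth (D l) K \<le> C * (K + 1) ^ d"
  shows "l < d"
  using assms
proof (induction l arbitrary: C d)
  case 0
  have ne: "D 0 \<noteq> {}" "D 0 \<subseteq> proj_points"
    using 0(1)[of 0] by (auto simp: irreducible_closed_def zariski_closed_def zero_locus_def)
  show ?case
  proof (rule ccontr)
    assume "\<not> 0 < d"
    \<comment> \<open>At \<open>K = C\<close> the growth would be at least C + 1 and at most
      C.\<close>
    then show False using 0(3)[of C] hgrowth_lower[OF ne, of C] by simp
  qed
next
  case (Suc l)
  have irr: "irreducible_closed (D (Suc l))" "irreducible_closed (D l)" using Suc.prems(1) by auto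
  have ne: "D (Suc l) \<noteq> {}" "D (Suc l) \<subseteq> proj_points"
    using irr(1) by (auto simp: irreducible_closed_def zariski_closed_def zero_locus_def)
  have "d \<noteq> 0"
  proof
    assume "d = 0"
    then show False using Suc.prems(3)[of C] hgrowth_lower[OF ne, of C] by simp
  qed
  then obtain d' where d: "d = Suc d'" by (cases d) auto
  have cl: "zariski_closed (D l)" "D l \<noteq> {}" using irr(2) by (simp_all add: irreducible_closed_def)
  have sub: "D l \<subset> D (Suc l)" using Suc.prems(2) by simp
  obtain e where e: "\<And>K. hgrowth (D (Suc l)) K + hgrowth (D l) (K + e) \<le> hgrowth (D (Suc l)) (K + e)"
    by (rule hgrowth_drop[OF irr(1) cl(1) sub cl(2)]) auto
  have "l < d'"
  proof (rule Suc.IH)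
    show "hgrowth (D l) K \<le> (C * (e + 1) ^ Suc d') * (K + 1) ^ d'" for K
      by (rule growth_exponent_drop[where HY = "hgrowth (D (Suc l))", OF hgrowth_mono e]) (use Suc.prems(3) d in auto)
  qed (use Suc.prems in auto)
  then show ?case using d by simp
qed

section \<open>Growth of the characteristic variety\<close>

lemma hfun_real_decomp:
  "hfun k f \<Longrightarrow> \<exists>A B. hom_poly k A \<and> hom_poly k B \<and> f = real_eval A + cfun \<i> * real_eval B"
proof (induction rule: hfun.induct)
  case (hfun_const c)
  show ?case
    by (rule exI[of _ "pconst (Re c)"], rule exI[of _ "pconst (Im c)"])
      (simp add: hom_poly_pconst real_eval_pconst fun_eq_iff plus_fun_apply times_fun_apply complex_eq[symmetric])
next
  case (hfun_zero k)
  show ?case by (rule exI[of _ 0], rule exI[of _ 0]) simp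
next
  case (hfun_coord k f i)
  then obtain A B where AB: "hom_poly k A" "hom_poly k B" "f = real_eval A + cfun \<i> * real_eval B" by blast
  then show ?case using hom_poly_mult[OF hom_poly_pvar[of i] AB(1)] hom_poly_mult[OF hom_poly_pvar[of i] AB(2)]
    by (intro exI[of _ "pvar i * A"] exI[of _ "pvar i * B"])
      (simp add: real_eval_pvar_mult distrib_left mult.left_commute)
next
  case (hfun_add k f h)
  then obtain A B where AB: "hom_poly k A" "hom_poly k B" "f = real_eval A + cfun \<i> * real_eval B" by blast
  obtain A' B' where AB': "hom_poly k A'" "hom_poly k B'" "h = real_eval A' + cfun \<i> * real_eval B'" using hfun_add by blast
  show ?case
    by (rule exI[of _ "A + A'"], rule exI[of _ "B + B'"])
      (simp add: AB AB' hom_poly_add real_eval_add distrib_left add_ac)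
qed

lemma real_eval_char_variety:
  assumes "symbolic_system g" "F \<in> op_ideal g" "\<xi> \<in> \<Union>(char_variety g)"
  shows "real_eval F \<xi> = 0"
  using assms unfolding char_variety_def zero_locus_def annihilator_eq_op_ideal[OF assms(1)] real_eval_def by blast

lemma fin_dim_UNIV: "fin_dim (UNIV :: 'a::euclidean_space set)"
  by (rule fin_dimI[of Basis]) auto

text \<open>A real form of degree k whose operator kills a basis of g_k annihilates g, hence
  vanishes on Char. So its restriction to Char depends on at most m dim g_k real numbers; the factor
  2 accounts for real and imaginary parts.\<close>

lemma dim_hfuns_char_variety:
  fixes g :: "nat \<Rightarrow> (real^'n \<Rightarrow> real^'m) set"
  assumes sys: "symbolic_system g"
  shows "dim (hfuns_on (\<Union>(char_variety g)) k) \<le> 2 * (CARD('m) * dim (g k))"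
proof -
  note g = symbolic_system_facts[OF sys]
  define Z where "Z = \<Union>(char_variety g)"
  define I where "I = {\<alpha> :: 'n \<Rightarrow>\<^sub>0 nat. mdeg \<alpha> = k}"
  have finI: "finite I" by (simp add: I_def)
  define U where "U = supp_funs I (UNIV :: real set)"
  define P where "P c = (\<Sum>\<alpha>\<in>I. Poly_Mapping.single \<alpha> (c \<alpha> :: real))" for c
  obtain B where B: "B \<subseteq> g k" "finite B" "independent B" "g k \<subseteq> span B" "card B = dim (g k)"
    using fin_dim_basis[OF g(3)] by metis
  have homP: "hom_poly k (P c)" for c
  proof -
    have "J \<subseteq> I \<Longrightarrow> hom_poly k (\<Sum>\<alpha>\<in>J. Poly_Mapping.single \<alpha> (c \<alpha> :: real))" for J
      by (induction J rule: infinite_finite_induct) (auto simp: I_def intro!: hom_poly_add hom_poly_single)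
    then show ?thesis unfolding P_def by blast
  qed
  have dP: "diff_op (P c) q = (\<Sum>\<alpha>\<in>I. c \<alpha> *\<^sub>R partial_deriv \<alpha> q)" for c and q :: "real^'n \<Rightarrow> real^'m"
    by (simp add: P_def diff_op_sum diff_op_single)
  have eP: "real_eval (P c) \<xi> = (\<Sum>\<alpha>\<in>I. complex_of_real (c \<alpha>) * monom_eval \<xi> \<alpha>)" for c \<xi>
    by (simp add: P_def real_eval_sum sum_fun_apply real_eval_single)
  define \<theta> where "\<theta> c = restr Z (real_eval (P c))" for c
  define \<Phi> where "\<Phi> c = (\<lambda>b. if b \<in> B then diff_op (P c) b 0 else 0)" for c
  have subU: "subspace U" and finU: "fin_dim U"
    unfolding U_def using subspace_supp_funs[of UNIV I] fin_dim_supp_funs[OF finI fin_dim_UNIV] by simp_all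
  have lin\<theta>: "lin_on U \<theta>"
    unfolding lin_on_def \<theta>_def restr_def
    by (simp add: fun_eq_iff eP plus_fun_apply scaleR_fun_def distrib_right sum.distrib sum_distrib_left scaleR_conv_of_real mult.assoc)
  have lin\<Phi>: "lin_on U \<Phi>"
    unfolding lin_on_def \<Phi>_def
    by (simp add: fun_eq_iff dP plus_fun_apply scaleR_fun_def scaleR_left_distrib sum.distrib scaleR_sum_right sum_fun_apply)
  have "dim (\<theta> ` U) \<le> dim (\<Phi> ` U)"
  proof (rule dim_kernel_mono[OF subU lin\<Phi> lin\<theta> finU])
    fix c assume "c \<in> U" "\<Phi> c = 0"
    \<comment> \<open>The operator lowers the degree to 0, so the value at 0 determines the
      result.\<close>
    have zB: "diff_op (P c) b = 0" if b: "b \<in> B" for b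
    proof -
      have "b \<in> sym_maps (k + 0)" using b B(1) g(2)[of k] by auto
      then have "diff_op (P c) b \<in> sym_maps 0" by (rule diff_op_hom_sym_maps[OF homP])
      moreover have "diff_op (P c) b 0 = 0"
        using fun_cong[OF \<open>\<Phi> c = 0\<close>, of b] b by (simp add: \<Phi>_def zero_fun_apply)
      ultimately show ?thesis by (auto simp: sym_maps_0_iff zero_fun_def)
    qed
    have "diff_op (P c) q = 0" if "q \<in> g k" for q
    proof -
      have "q \<in> span B" using that B(4) by blast
      then have "diff_op (P c) q = 0 \<and> q \<in> poly_maps"
      proof (induction rule: real_vector.span_induct_alt)
        case base
        then show ?case by (simp add: subspace_0)
      next
        case (step r x y)
        then have "x \<in> poly_maps" using B(1) g(6) by blast
        then have "r *\<^sub>R x \<in> poly_maps" by (simp add: subspace_scale)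
        moreover have "lin_on poly_maps (diff_op (P c) :: (real^'n \<Rightarrow> real^'m) \<Rightarrow> _)" by (rule lin_on_diff_op)
        ultimately show ?case using step \<open>x \<in> poly_maps\<close> zB[of x]
          by (simp add: lin_on_def subspace_add)
      qed
      then show ?thesis by simp
    qed
    then have "P c \<in> op_ideal g" by (rule op_ideal_hom_iff[OF sys homP])
    then show "\<theta> c = 0"
      using real_eval_char_variety[OF sys, of "P c"] by (auto simp: \<theta>_def Z_def restr_def fun_eq_iff zero_fun_apply)
  qed
  also have "\<dots> \<le> dim (supp_funs B (UNIV :: (real^'m) set))"
    by (rule dim_le_fin_dim[OF fin_dim_supp_funs[OF B(2) fin_dim_UNIV]]) (auto simp: \<Phi>_def supp_funs_def)
  also have "\<dots> = CARD('m) * dim (g k)"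
    using dim_supp_funs[OF B(2) fin_dim_UNIV[where 'a = "real^'m"]] B(5) by simp
  finally have \<theta>: "dim (\<theta> ` U) \<le> CARD('m) * dim (g k)" .
  let ?V = "supp_funs (UNIV :: bool set) (\<theta> ` U)"
  let ?\<Theta> = "\<lambda>f :: bool \<Rightarrow> complex^'n \<Rightarrow> complex. f True + cfun \<i> * f False"
  have sub\<theta>: "subspace (\<theta> ` U)" "fin_dim (\<theta> ` U)"
    using subspace_image_lin_on[OF subU lin\<theta>] fin_dim_image[OF subU lin\<theta> finU] by auto
  have "hfuns_on Z k \<subseteq> ?\<Theta> ` ?V"
  proof
    fix u assume "u \<in> hfuns_on Z k"
    then obtain f where f: "hfun k f" "u = restr Z f" by (auto simp: hfuns_on_def)
    obtain A A' where A: "hom_poly k A" "hom_poly k A'" "f = real_eval A + cfun \<i> * real_eval A'"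
      using hfun_real_decomp[OF f(1)] by blast
    have *: "restr Z (real_eval A) \<in> \<theta> ` U" if "hom_poly k A" for A
    proof -
      define c where "c = (\<lambda>\<alpha>. if \<alpha> \<in> I then Poly_Mapping.lookup A \<alpha> else 0)"
      have "P c = A"
      proof (rule poly_mapping_eqI)
        fix \<alpha>
        have "Poly_Mapping.lookup (P c) \<alpha> = (if \<alpha> \<in> I then c \<alpha> else 0)"
          unfolding P_def lookup_sum using finI by (simp add: lookup_single when_def)
        also have "\<dots> = Poly_Mapping.lookup A \<alpha>"
          using that by (auto simp: c_def I_def hom_poly_def in_keys_iff)
        finally show "Poly_Mapping.lookup (P c) \<alpha> = Poly_Mapping.lookup A \<alpha>" .
      qed
      moreover have "c \<in> U" by (simp add: U_def supp_funs_def c_def)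
      ultimately show ?thesis unfolding \<theta>_def by blast
    qed
    define w where "w = (\<lambda>t. if t then restr Z (real_eval A) else restr Z (real_eval A'))"
    have "u = ?\<Theta> w" unfolding w_def
      unfolding f(2) A(3) by (auto simp: restr_def fun_eq_iff plus_fun_apply times_fun_apply)
    moreover have "w \<in> ?V"
      using *[OF A(1)] *[OF A(2)] by (simp add: supp_funs_def w_def)
    ultimately show "u \<in> ?\<Theta> ` ?V" by (rule image_eqI)
  qed
  moreover have lin: "lin_on ?V ?\<Theta>"
    by (simp add: lin_on_def plus_fun_apply[of _ _ True] plus_fun_apply[of _ _ False]
        scaleR_fun_apply[of _ _ True] scaleR_fun_apply[of _ _ False] distrib_left add_ac)
      (simp add: fun_eq_iff plus_fun_apply times_fun_apply scaleR_fun_def algebra_simps)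
  moreover have fin: "fin_dim ?V" and sub: "subspace ?V"
    by (rule fin_dim_supp_funs[OF finite sub\<theta>(2)], rule subspace_supp_funs[OF sub\<theta>(1)])
  ultimately have "dim (hfuns_on Z k) \<le> dim (?\<Theta> ` ?V)"
    by (intro dim_le_fin_dim fin_dim_image) auto
  also have "\<dots> \<le> dim ?V" by (rule dim_image_le_lin_on[OF sub lin fin])
  also have "\<dots> = 2 * dim (\<theta> ` U)" using dim_supp_funs[OF _ sub\<theta>(2,1), of "UNIV :: bool set"] by simp
  finally show ?thesis using \<theta> unfolding Z_def by simp
qed

lemma poly_growth_bound:
  fixes P :: "real poly"
  obtains C where "\<And>K::nat. \<bar>poly P (real K)\<bar> \<le> C * (real K + 1) ^ degree P"
proof -
  have "\<bar>poly P (real K)\<bar> \<le> (\<Sum>i\<le>degree P. \<bar>coeff P i\<bar>) * (real K + 1) ^ degree P" for K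
  proof -
    have "\<bar>poly P (real K)\<bar> \<le> (\<Sum>i\<le>degree P. \<bar>coeff P i * real K ^ i\<bar>)"
      unfolding poly_altdef by (rule sum_abs)
    also have "\<dots> \<le> (\<Sum>i\<le>degree P. \<bar>coeff P i\<bar> * (real K + 1) ^ degree P)"
    proof (rule sum_mono)
      fix i assume "i \<in> {..degree P}"
      then have "real K ^ i \<le> (real K + 1) ^ i" "(real K + 1) ^ i \<le> (real K + 1) ^ degree P"
        by (auto intro: power_mono power_increasing)
      then show "\<bar>coeff P i * real K ^ i\<bar> \<le> \<bar>coeff P i\<bar> * (real K + 1) ^ degree P"
        by (simp add: abs_mult mult_left_mono)
    qed
    finally show ?thesis by (simp add: sum_distrib_right)
  qed
  then show ?thesis using that by blast
qed

lemma hgrowth_char_variety: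
  fixes g :: "nat \<Rightarrow> (real^'n \<Rightarrow> real^'m) set"
  assumes sys: "symbolic_system g" and van: "\<And>i j. i \<ge> 1 \<Longrightarrow> spencer_vanishes g i j"
  obtains C where "\<And>K. hgrowth (char_variety g) K \<le> C * (K + 1) ^ functional_dim g"
proof -
  let ?d = "functional_dim g"
  obtain C where C: "\<And>K. \<bar>poly (spencer_poly g) (real K)\<bar> \<le> C * (real K + 1) ^ degree (spencer_poly g)"
    using poly_growth_bound by blast
  have d: "?d = degree (spencer_poly g)"
    by (simp add: functional_dim_def hilbert_poly_eq_spencer_poly[OF assms])
  \<comment> \<open>The extra sum covers small \<open>K\<close>, where the partial sums need not
    follow the polynomial.\<close>
  define C' where "C' = nat \<lceil>C\<rceil> + (\<Sum>i\<le>CARD('n). dim (g i))"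
  have S: "(\<Sum>i\<le>K. dim (g i)) \<le> C' * (K + 1) ^ ?d" for K
  proof (cases "K \<ge> CARD('n)")
    case True
    have "real (\<Sum>i\<le>K. dim (g i)) = poly (spencer_poly g) (real K)"
      using poly_spencer_poly[OF assms True] by simp
    also have "\<dots> \<le> C * (real K + 1) ^ ?d" using C[of K] d by simp
    also have "\<dots> \<le> real (nat \<lceil>C\<rceil>) * (real K + 1) ^ ?d"
      by (rule mult_right_mono) (simp_all add: real_nat_ceiling_ge)
    also have "\<dots> \<le> real C' * (real K + 1) ^ ?d"
      by (rule mult_right_mono) (simp_all add: C'_def sum_nonneg)
    also have "\<dots> = real (C' * (K + 1) ^ ?d)" by (simp add: add.commute)
    finally show ?thesis by (simp only: of_nat_le_iff)
  next
    case False
    then have "(\<Sum>i\<le>K. dim (g i)) \<le> (\<Sum>i\<le>CARD('n). dim (g i))" by (intro sum_mono2) auto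
    also have "\<dots> \<le> C' * 1" by (simp add: C'_def)
    also have "\<dots> \<le> C' * (K + 1) ^ ?d" by (rule mult_le_mono2) simp
    finally show ?thesis .
  qed
  have "hgrowth (char_variety g) K \<le> (2 * CARD('m) * C') * (K + 1) ^ ?d" for K
  proof -
    have "hgrowth (char_variety g) K \<le> (\<Sum>k\<le>K. 2 * (CARD('m) * dim (g k)))"
      unfolding hgrowth_def by (intro sum_mono dim_hfuns_char_variety[OF sys])
    also have "\<dots> = 2 * CARD('m) * (\<Sum>k\<le>K. dim (g k))" by (simp add: sum_distrib_left mult.assoc)
    also have "\<dots> \<le> 2 * CARD('m) * (C' * (K + 1) ^ ?d)" by (rule mult_le_mono2[OF S])
    finally show ?thesis by (simp only: mult.assoc)
  qed
  then show ?thesis using that by blast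
qed

lemma hgrowth_subset: "X \<subseteq> Y \<Longrightarrow> hgrowth X K \<le> hgrowth Y K"
  unfolding hgrowth_def by (intro sum_mono dim_hfuns_on_mono) blast

lemma char_variety_chain_length:
  fixes g :: "nat \<Rightarrow> (real^'n \<Rightarrow> real^'m) set"
  assumes sys: "symbolic_system g" and van: "\<And>i j. i \<ge> 1 \<Longrightarrow> spencer_vanishes g i j"
    and D: "\<forall>i\<le>l. irreducible_closed (D i) \<and> D i \<subseteq> char_variety g" "\<forall>i<l. D i \<subset> D (Suc i)"
  shows "l < functional_dim g"
proof -
  obtain C where C: "\<And>K. hgrowth (char_variety g) K \<le> C * (K + 1) ^ functional_dim g"
    using hgrowth_char_variety[OF sys van] by blast
  show ?thesis
  proof (rule irreducible_chain_length[of l D C])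
    show "hgrowth (D l) K \<le> C * (K + 1) ^ functional_dim g" for K
      using order_trans[OF hgrowth_subset C] D(1) by blast
  qed (use D in auto)
qed

text \<open>Functional dimension 0 bounds the growth, while a nonempty variety grows at least
  linearly.\<close>

lemma char_variety_empty:
  fixes g :: "nat \<Rightarrow> (real^'n \<Rightarrow> real^'m) set"
  assumes sys: "symbolic_system g" and van: "\<And>i j. i \<ge> 1 \<Longrightarrow> spencer_vanishes g i j"
    and "functional_dim g = 0"
  shows "char_variety g = {}"
proof (rule ccontr)
  assume ne: "char_variety g \<noteq> {}"
  obtain C where C: "\<And>K. hgrowth (char_variety g) K \<le> C * (K + 1) ^ functional_dim g"
    using hgrowth_char_variety[OF sys van] by blast
  have "char_variety g \<subseteq> proj_points" by (auto simp: char_variety_def zero_locus_def)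
  then show False using hgrowth_lower[OF ne, of C] C[of C] assms(3) by simp
qed


section \<open>Noether normalization\<close>

text \<open>A vector of T as an element of degree 1 of \<open>ST\<close>.\<close>

definition linp :: "real^'n \<Rightarrow> ('n \<Rightarrow>\<^sub>0 nat) \<Rightarrow>\<^sub>0 real" where
  "linp w = (\<Sum>j\<in>UNIV. pconst (w $ j) * pvar j)"

lemma pconst_add: "pconst (a + b) = pconst a + pconst b"
  by (simp add: pconst_def single_add)

lemma pconst_mult: "pconst (a * b) = pconst a * pconst b"
  by (simp add: pconst_def mult_single)

lemma pconst_zero [simp]: "pconst 0 = 0"
  by (simp add: pconst_def)

lemma pconst_uminus: "pconst (- c) = - pconst (c :: 'c::comm_ring_1)"
  by (simp add: pconst_def single_uminus)

lemma pconst_one [simp]: "pconst 1 = 1"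
  by (simp add: pconst_def)

lemma linp_add: "linp (v + w) = linp v + linp w"
  by (simp add: linp_def pconst_add distrib_right sum.distrib)

lemma linp_scale: "linp (c *\<^sub>R w) = pconst c * linp w"
  by (simp add: linp_def pconst_mult mult.assoc sum_distrib_left)

lemma linp_axis: "linp (axis j 1) = pvar j"
proof -
  have "linp (axis j 1) = (\<Sum>i\<in>UNIV. if i = j then pvar j else 0)"
    unfolding linp_def by (rule sum.cong) (auto simp: axis_def)
  then show ?thesis by simp
qed

lemma hom_poly_sum:
  fixes F :: "'i \<Rightarrow> ('n::finite \<Rightarrow>\<^sub>0 nat) \<Rightarrow>\<^sub>0 'c::comm_monoid_add"
  shows "(\<And>i. i \<in> A \<Longrightarrow> hom_poly k (F i)) \<Longrightarrow> hom_poly k (\<Sum>i\<in>A. F i)"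
  by (induction A rule: infinite_finite_induct) (auto intro: hom_poly_add)

lemma hom_poly_linp: "hom_poly 1 (linp w)"
  unfolding linp_def
  by (intro hom_poly_sum) (use hom_poly_mult[OF hom_poly_pconst hom_poly_pvar] in \<open>simp add: One_nat_def[symmetric] del: One_nat_def\<close>)

lemma hom_poly_power:
  fixes F :: "('n::finite \<Rightarrow>\<^sub>0 nat) \<Rightarrow>\<^sub>0 'c::comm_semiring_1"
  assumes "hom_poly k F"
  shows "hom_poly (e * k) (F ^ e)"
proof (induction e)
  case 0
  show ?case using hom_poly_pconst[of 1] by (simp add: pconst_def)
next
  case (Suc e)
  then show ?case using hom_poly_mult[OF assms Suc] by simp
qed

lemma diff_op_linp:
  assumes "q \<in> poly_maps"
  shows "diff_op (linp w) q = dir_deriv w q"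
proof -
  have "diff_op (linp w) q = (\<Sum>j\<in>UNIV. w $ j *\<^sub>R dir_deriv (axis j 1) q)"
  proof -
    have "diff_op (pvar j) q = dir_deriv (axis j 1) q" for j
      using diff_op_pvar_mult[OF assms, of j "pconst 1"] assms by (simp add: diff_op_pconst[of q 1, simplified])
    then show ?thesis
      using assms by (simp add: linp_def diff_op_sum diff_op_mult diff_op_pconst)
  qed
  also have "\<dots> = dir_deriv (\<Sum>j\<in>UNIV. w $ j *\<^sub>R axis j 1) q"
    using linear_sum[OF linear_dir_deriv_dir[OF assms], of "\<lambda>j. w $ j *\<^sub>R axis j 1" UNIV]
    by (simp add: linear_scale[OF linear_dir_deriv_dir[OF assms]])
  also have "(\<Sum>j\<in>UNIV. w $ j *\<^sub>R axis j 1) = w"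
    using basis_expansion[of w] by (simp add: scalar_mult_eq_scaleR)
  finally show ?thesis .
qed

lemma real_eval_mult: "real_eval (F * G) = real_eval F * real_eval G"
proof (induction F rule: poly_induct)
  case (const c)
  show ?case
  proof (induction G rule: poly_mapping_induct_single)
    case (single \<alpha> d)
    show ?case
      by (rule ext) (simp add: pconst_def mult_single real_eval_single times_fun_apply)
  qed (simp add: distrib_left real_eval_add)
qed (simp_all add: mult.assoc real_eval_pvar_mult distrib_right real_eval_add)

section \<open>Evaluation at real points\<close>

definition cvec :: "real^'n \<Rightarrow> complex^'n" where
  "cvec x = (\<chi> i. complex_of_real (x $ i))"

definition cform :: "real^'n \<Rightarrow> complex^'n \<Rightarrow> complex" where
  "cform w = real_eval (linp w)"

lemma real_eval_pvar: "real_eval (pvar j) = coord j"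
proof -
  have "real_eval (pvar j * pconst 1) = coord j * real_eval (pconst 1)" by (rule real_eval_pvar_mult)
  then show ?thesis by (simp add: real_eval_pconst[of 1, simplified] fun_eq_iff times_fun_apply)
qed

lemma cform_eq: "cform w \<xi> = (\<Sum>j\<in>UNIV. complex_of_real (w $ j) * \<xi> $ j)"
  unfolding cform_def linp_def
  by (simp add: real_eval_sum sum_fun_apply real_eval_mult real_eval_pconst real_eval_pvar times_fun_apply)

lemma cform_cvec: "cform w (cvec x) = complex_of_real (w \<bullet> x)"
  by (simp add: cform_eq cvec_def inner_vec_def)

text \<open>Defined through complex evaluation, so that the ring laws are inherited from
  \<open>real_eval\<close>.\<close>

definition reval :: "(('n::finite \<Rightarrow>\<^sub>0 nat) \<Rightarrow>\<^sub>0 real) \<Rightarrow> real^'n \<Rightarrow> real" where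
  "reval F x = Re (real_eval F (cvec x))"

lemma real_eval_cvec: "real_eval F (cvec x) = complex_of_real (reval F x)"
proof -
  have "Im (real_eval F (cvec x)) = 0"
  proof (induction F rule: poly_induct)
    case (const c)
    show ?case by (simp add: real_eval_pconst)
  next
    case (mult i F)
    then show ?case by (simp add: real_eval_pvar_mult times_fun_apply cvec_def)
  qed (simp add: real_eval_add plus_fun_apply)
  then show ?thesis unfolding reval_def by (simp add: complex_eq_iff)
qed

lemma reval_mult: "reval (F * G) x = reval F x * reval G x"
  unfolding reval_def by (simp add: real_eval_mult times_fun_apply real_eval_cvec)

lemma reval_add: "reval (F + G) x = reval F x + reval G x"
  unfolding reval_def by (simp add: real_eval_add plus_fun_apply)

lemma reval_pconst [simp]: "reval (pconst c) x = c"
  unfolding reval_def by (simp add: real_eval_pconst)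

lemma reval_zero [simp]: "reval 0 x = 0"
  unfolding reval_def by (simp add: zero_fun_apply)

lemma reval_linp [simp]: "reval (linp w) x = w \<bullet> x"
  unfolding reval_def using cform_cvec[of w x] by (simp add: cform_def)

lemma reval_single: "reval (Poly_Mapping.single \<alpha> c) x = c * monom_eval x \<alpha>"
proof -
  have "monom_eval (cvec x) \<alpha> = complex_of_real (monom_eval x \<alpha>)"
    by (simp add: monom_eval_def cvec_def)
  then show ?thesis by (simp add: reval_def real_eval_single)
qed

text \<open>\<open>F\<close> becomes a polynomial map with a fixed direction as value; its
  derivatives at 0 are nonzero multiples of the coefficients of \<open>F\<close>.\<close>

lemma reval_eq_0:
  fixes F :: "('n::finite \<Rightarrow>\<^sub>0 nat) \<Rightarrow>\<^sub>0 real"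
  assumes "\<And>x. reval F x = 0"
  shows "F = 0"
proof (rule poly_mapping_eqI)
  fix \<alpha>
  have F: "F = (\<Sum>\<beta>\<in>Poly_Mapping.keys F. Poly_Mapping.single \<beta> (Poly_Mapping.lookup F \<beta>))"
    by (rule poly_mapping_eqI) (auto simp: lookup_sum lookup_single when_def in_keys_iff)
  have rs: "reval (\<Sum>\<beta>\<in>A. G \<beta>) x = (\<Sum>\<beta>\<in>A. reval (G \<beta>) x)" for A and G :: "('n \<Rightarrow>\<^sub>0 nat) \<Rightarrow> _" and x
    by (induction A rule: infinite_finite_induct) (simp_all add: reval_add)
  define q :: "real^'n \<Rightarrow> real^'n" where
    "q = (\<Sum>\<beta>\<in>Poly_Mapping.keys F. vmon \<beta> (Poly_Mapping.lookup F \<beta> *\<^sub>R axis undefined 1))"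
  have "q x = reval F x *\<^sub>R axis undefined 1" for x
    by (subst F, subst rs) (simp add: q_def sum_fun_apply vmon_def reval_single scaleR_sum_left mult.commute)
  then have "q = 0" using assms by (simp add: fun_eq_iff zero_fun_apply)
  then have z: "partial_deriv \<alpha> q 0 = 0" by (simp add: zero_fun_apply)
  obtain r where r: "r \<noteq> 0" "\<And>\<beta>. partial_deriv \<alpha> (vmon \<beta> (axis undefined 1 :: real^'n)) 0 = (if \<alpha> = \<beta> then r *\<^sub>R axis undefined 1 else (0::real^'n))"
    using partial_deriv_vmon_at_0[of \<alpha> "axis undefined 1 :: real^'n"] by blast
  have "partial_deriv \<alpha> q 0 = (\<Sum>\<beta>\<in>Poly_Mapping.keys F. Poly_Mapping.lookup F \<beta> *\<^sub>R partial_deriv \<alpha> (vmon \<beta> (axis undefined 1)) 0)"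
    unfolding q_def by (subst partial_deriv_sum) (simp_all add: sum_fun_apply vmon_scale partial_deriv_scale scaleR_fun_apply subspace_scale)
  also have "\<dots> = (\<Sum>\<beta>\<in>Poly_Mapping.keys F. if \<alpha> = \<beta> then (Poly_Mapping.lookup F \<alpha> * r) *\<^sub>R axis undefined 1 else (0::real^'n))"
    unfolding r(2) by (rule sum.cong) auto
  also have "\<dots> = (Poly_Mapping.lookup F \<alpha> * r) *\<^sub>R axis undefined 1"
    by (simp add: in_keys_iff)
  finally have "(Poly_Mapping.lookup F \<alpha> * r) *\<^sub>R axis undefined 1 = (0::real^'n)" using z by simp
  then show "Poly_Mapping.lookup F \<alpha> = Poly_Mapping.lookup 0 \<alpha>" using r(1) by simp
qed

section \<open>Reducing the subspace of linear forms\<close>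

text \<open>For an ideal \<open>I\<close>, the elements of degree \<open>k\<close> obtained from
  homogeneous members of \<open>I\<close> and multiples of linear forms in \<open>W\<close>: the
  ideal I + (W), with degrees tracked.\<close>

inductive qideal :: "(('n::finite \<Rightarrow>\<^sub>0 nat) \<Rightarrow>\<^sub>0 real) set \<Rightarrow> (real^'n) set \<Rightarrow> nat \<Rightarrow> (('n \<Rightarrow>\<^sub>0 nat) \<Rightarrow>\<^sub>0 real) \<Rightarrow> bool"
  for I W where
  qideal_base: "F \<in> I \<Longrightarrow> hom_poly k F \<Longrightarrow> qideal I W k F"
| qideal_lin: "w \<in> W \<Longrightarrow> hom_poly k G \<Longrightarrow> qideal I W (Suc k) (linp w * G)"
| qideal_add: "qideal I W k F \<Longrightarrow> qideal I W k G \<Longrightarrow> qideal I W k (F + G)"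

lemma qideal_hom: "qideal I W k F \<Longrightarrow> hom_poly k F"
proof (induction rule: qideal.induct)
  case (qideal_lin w k G)
  then show ?case using hom_poly_mult[OF hom_poly_linp[of w], of k G] by simp
qed (auto intro: hom_poly_add)

lemma qideal_mult:
  assumes "qideal I W k F" "hom_poly l G" and I: "\<And>F G. F \<in> I \<Longrightarrow> G * F \<in> I"
  shows "qideal I W (l + k) (G * F)"
  using assms(1)
proof (induction rule: qideal.induct)
  case (qideal_base F k)
  then show ?case using I hom_poly_mult[OF assms(2)] by (intro qideal.qideal_base)
next
  case (qideal_lin w k H)
  then show ?case using qideal.qideal_lin[OF qideal_lin(1) hom_poly_mult[OF assms(2) qideal_lin(2)]]
    by (simp add: mult.left_commute)
qed (simp add: distrib_left qideal.qideal_add)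

text \<open>The homogeneous elements of the subalgebra S(W) of \<open>ST\<close>.\<close>

inductive swpoly :: "(real^'n) set \<Rightarrow> nat \<Rightarrow> (('n::finite \<Rightarrow>\<^sub>0 nat) \<Rightarrow>\<^sub>0 real) \<Rightarrow> bool" for W where
  swpoly_const: "swpoly W 0 (pconst c)"
| swpoly_zero: "swpoly W k 0"
| swpoly_lin: "w \<in> W \<Longrightarrow> swpoly W k F \<Longrightarrow> swpoly W (Suc k) (linp w * F)"
| swpoly_add: "swpoly W k F \<Longrightarrow> swpoly W k G \<Longrightarrow> swpoly W k (F + G)"

lemma swpoly_hom: "swpoly W k F \<Longrightarrow> hom_poly k F"
proof (induction rule: swpoly.induct)
  case (swpoly_lin w k F)
  then show ?case using hom_poly_mult[OF hom_poly_linp[of w], of k F] by simp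
qed (auto intro: hom_poly_add hom_poly_pconst)

lemma hom_poly_0_pconst:
  assumes "hom_poly 0 (F :: ('n::finite \<Rightarrow>\<^sub>0 nat) \<Rightarrow>\<^sub>0 'c::comm_semiring_1)"
  shows "\<exists>c. F = pconst c"
  using assms
proof (induction rule: hom_poly_induct)
  case (single \<alpha> c)
  then have "\<alpha> = 0" by (intro poly_mapping_eqI) (simp add: mdeg_def)
  then show ?case by (auto simp: pconst_def)
next
  case zero
  show ?case by (rule exI[of _ 0]) (simp add: pconst_def)
next
  case (add F G)
  then show ?case by (auto simp: pconst_def single_add[symmetric])
qed

text \<open>Modulo the hyperplane of \<open>W\<close> orthogonal to \<open>x\<close>, each
  \<open>w\<close> becomes \<open>w \<bullet> x\<close> times \<open>w0\<close>. An element of S(W)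
  of degree \<open>k\<close> thus becomes its value at \<open>x\<close> times the k-th power of
  \<open>w0\<close>.\<close>

lemma swpoly_mod_hyperplane:
  assumes W: "subspace W" and w0: "w0 \<in> W" "w0 \<bullet> x = 1" and F: "swpoly W k F"
    and I: "\<And>F G. F \<in> I \<Longrightarrow> G * F \<in> I" "0 \<in> I"
  shows "qideal I {w \<in> W. w \<bullet> x = 0} k (F - pconst (reval F x) * linp w0 ^ k)"
  using F
proof (induction rule: swpoly.induct)
  case (swpoly_const c)
  show ?case using I(2) by (auto intro: qideal_base)
next
  case (swpoly_zero k)
  show ?case using I(2) by (auto intro: qideal_base)
next
  case (swpoly_lin w k F)
  let ?W = "{w \<in> W. w \<bullet> x = 0}" and ?r = "reval F x"
  let ?v = "w + (- (w \<bullet> x)) *\<^sub>R w0"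
  have v: "?v \<in> ?W" using swpoly_lin(1) w0 W by (simp add: subspace_add subspace_scale inner_add_left del: scaleR_minus_left)
  have A: "qideal I ?W (Suc k) (linp w * (F - pconst ?r * linp w0 ^ k))"
    using qideal_mult[OF swpoly_lin(3) hom_poly_linp I(1), of w] by simp
  have "hom_poly k (pconst ?r * linp w0 ^ k)"
    using hom_poly_mult[OF hom_poly_pconst hom_poly_power[OF hom_poly_linp[of w0], of k], of ?r] by simp
  then have B: "qideal I ?W (Suc k) (linp ?v * (pconst ?r * linp w0 ^ k))" by (rule qideal.qideal_lin[OF v])
  have eq: "linp w * (F - pconst ?r * linp w0 ^ k) + linp ?v * (pconst ?r * linp w0 ^ k)
    = linp w * F - pconst (reval (linp w * F) x) * linp w0 ^ Suc k"
  proof -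
    have "linp ?v = linp w - pconst (w \<bullet> x) * linp w0"
      by (simp add: linp_add linp_scale pconst_uminus del: scaleR_minus_left)
    then show ?thesis by (simp only: reval_mult pconst_mult reval_linp) (simp add: algebra_simps)
  qed
  from qideal.qideal_add[OF A B] show ?case unfolding eq .
next
  case (swpoly_add k F G)
  have eq: "F + G - pconst (reval (F + G) x) * linp w0 ^ k =
    (F - pconst (reval F x) * linp w0 ^ k) + (G - pconst (reval G x) * linp w0 ^ k)"
    by (simp add: reval_add pconst_add algebra_simps)
  show ?case unfolding eq by (rule qideal.qideal_add[OF swpoly_add(3,4)])
qed

text \<open>The same substitution splits every generator from \<open>W\<close> into a hyperplane
  part and a multiple of \<open>w0\<close>.\<close>

lemma qideal_split:
  assumes W: "subspace W" and w0: "w0 \<in> W" "w0 \<bullet> x = 1" and F: "qideal I W (Suc k) F"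
    and I: "0 \<in> I"
  shows "\<exists>G H. qideal I {w \<in> W. w \<bullet> x = 0} (Suc k) G \<and> hom_poly k H \<and> F = G + linp w0 * H"
  using F
proof (induction "Suc k" F arbitrary: k rule: qideal.induct)
  case (qideal_base F)
  then show ?case by (intro exI[of _ F] exI[of _ 0]) (auto intro: qideal.qideal_base)
next
  case (qideal_lin w k' G)
  let ?v = "w + (- (w \<bullet> x)) *\<^sub>R w0"
  have v: "?v \<in> {w \<in> W. w \<bullet> x = 0}" using qideal_lin(1) w0 W
    by (simp add: subspace_add subspace_scale inner_add_left del: scaleR_minus_left)
  have "linp w = linp ?v + pconst (w \<bullet> x) * linp w0"
    by (simp add: linp_add linp_scale pconst_uminus del: scaleR_minus_left)
  then have "linp w * G = linp ?v * G + linp w0 * (pconst (w \<bullet> x) * G)" by (simp add: algebra_simps)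
  moreover have "hom_poly k' (pconst (w \<bullet> x) * G)"
    using hom_poly_mult[OF hom_poly_pconst qideal_lin(2)] by simp
  ultimately show ?case using qideal.qideal_lin[OF v qideal_lin(2)] by blast
next
  case (qideal_add F F')
  obtain G H where "qideal I {w \<in> W. w \<bullet> x = 0} (Suc k) G" "hom_poly k H" "F = G + linp w0 * H"
    using qideal_add(2) by blast
  moreover obtain G' H' where "qideal I {w \<in> W. w \<bullet> x = 0} (Suc k) G'" "hom_poly k H'" "F' = G' + linp w0 * H'"
    using qideal_add(4) by blast
  ultimately show ?case
    by (intro exI[of _ "G + G'"] exI[of _ "H + H'"]) (auto simp: algebra_simps intro: qideal.qideal_add hom_poly_add)
qed

text \<open>Writing F = G + w0 H with G in the smaller ideal, the e-th power of F is congruent to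
  that of w0 H, which lies in the smaller ideal because the e-th power of w0 does.\<close>

lemma qideal_power:
  assumes W: "subspace W" and w0: "w0 \<in> W" "w0 \<bullet> x = 1" and F: "qideal I W (Suc k) F"
    and I: "\<And>F G. F \<in> I \<Longrightarrow> G * F \<in> I" "0 \<in> I"
    and e: "qideal I {w \<in> W. w \<bullet> x = 0} e (linp w0 ^ e)"
  shows "qideal I {w \<in> W. w \<bullet> x = 0} (e * Suc k) (F ^ e)"
proof -
  let ?W = "{w \<in> W. w \<bullet> x = 0}"
  obtain G H where GH: "qideal I ?W (Suc k) G" "hom_poly k H" "F = G + linp w0 * H"
    using qideal_split[OF W w0 F I(2)] by blast
  have "\<exists>R. qideal I ?W (e * Suc k) R \<and> F ^ e = R + linp w0 ^ e * H ^ e" for e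
  proof (induction e)
    case 0
    show ?case by (rule exI[of _ 0]) (auto intro: qideal_base I(2))
  next
    case (Suc e)
    then obtain R where R: "qideal I ?W (e * Suc k) R" "F ^ e = R + linp w0 ^ e * H ^ e" by blast
    have A: "qideal I ?W (Suc e * Suc k) (F * R)" using qideal_mult[OF R(1) qideal_hom[OF F] I(1)] by (simp add: ac_simps)
    have hp: "hom_poly (e * Suc k) (linp w0 ^ e * H ^ e)"
      using hom_poly_mult[OF hom_poly_power[OF hom_poly_linp[of w0], of e] hom_poly_power[OF GH(2), of e]] by simp
    have B: "qideal I ?W (Suc e * Suc k) (linp w0 ^ e * H ^ e * G)"
      using qideal_mult[OF GH(1) hp I(1)] by (simp add: ac_simps)
    have eq: "F ^ Suc e = (F * R + linp w0 ^ e * H ^ e * G) + linp w0 ^ Suc e * H ^ Suc e"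
      unfolding power_Suc[of F] R(2) distrib_left by (subst (2) GH(3)) (simp add: algebra_simps)
    show ?case
      by (rule exI[of _ "F * R + linp w0 ^ e * H ^ e * G"], rule conjI[OF qideal.qideal_add[OF A B] eq])
  qed
  then obtain R where R: "qideal I ?W (e * Suc k) R" "F ^ e = R + linp w0 ^ e * H ^ e" by blast
  have "qideal I ?W (e * Suc k) (linp w0 ^ e * H ^ e)"
    using qideal_mult[OF e hom_poly_power[OF GH(2)] I(1)] by (simp add: ac_simps)
  then show ?thesis unfolding R(2) by (rule qideal.qideal_add[OF R(1)])
qed

text \<open>Each variable is nilpotent modulo I + (W): the graded way to say that \<open>ST\<close>
  modulo \<open>I\<close> is finite over S(W). \<open>Suc k\<close> excludes the power 0.\<close>

definition finite_over :: "(('n::finite \<Rightarrow>\<^sub>0 nat) \<Rightarrow>\<^sub>0 real) set \<Rightarrow> (real^'n) set \<Rightarrow> bool" where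
  "finite_over I W \<longleftrightarrow> (\<forall>j. \<exists>k. qideal I W (Suc k) (pvar j ^ Suc k))"

lemma finite_over_UNIV: "finite_over I UNIV"
  unfolding finite_over_def
proof
  fix j
  have "qideal I UNIV (Suc 0) (linp (axis j 1) * pconst 1)" by (rule qideal_lin[OF UNIV_I hom_poly_pconst])
  then show "\<exists>k. qideal I UNIV (Suc k) (pvar j ^ Suc k)" by (intro exI[of _ 0]) (simp add: linp_axis)
qed

lemma finite_over_reduce:
  fixes W :: "(real^'n) set"
  assumes W: "subspace W" "finite_over I W"
    and I: "\<And>F G. F \<in> I \<Longrightarrow> G * F \<in> I" "0 \<in> I" "\<And>F G. F \<in> I \<Longrightarrow> G \<in> I \<Longrightarrow> F + G \<in> I" "\<And>c. pconst c \<in> I \<Longrightarrow> c = 0"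
    and F: "swpoly W k F" "F \<in> I" "F \<noteq> 0"
  obtains W' where "subspace W'" "finite_over I W'" "dim W' < dim W"
proof -
  obtain x where x: "reval F x \<noteq> 0" using reval_eq_0 F(3) by blast
  have "k \<noteq> 0"
  proof
    assume "k = 0"
    then obtain c where "F = pconst c" using swpoly_hom[OF F(1)] hom_poly_0_pconst by blast
    then have "c = 0" using I(4) F(2) by metis
    then show False using F(3) \<open>F = pconst c\<close> by simp
  qed
  \<comment> \<open>Were all of \<open>W\<close> orthogonal to \<open>x\<close>, every element of
    S(W) of positive degree would vanish there.\<close>
  have "\<exists>w\<in>W. w \<bullet> x \<noteq> 0"
  proof (rule ccontr)
    assume no: "\<not> ?thesis"
    have "k \<noteq> 0 \<Longrightarrow> reval F x = 0"
      using F(1) by (induction rule: swpoly.induct) (use no in \<open>auto simp: reval_mult reval_add\<close>)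
    then show False using x \<open>k \<noteq> 0\<close> by simp
  qed
  then obtain w where w: "w \<in> W" "w \<bullet> x \<noteq> 0" by blast
  define w0 where "w0 = (1 / (w \<bullet> x)) *\<^sub>R w"
  have w0: "w0 \<in> W" "w0 \<bullet> x = 1" using w W(1) by (auto simp: w0_def subspace_scale)
  let ?W = "{w \<in> W. w \<bullet> x = 0}"
  have "qideal I ?W k (F - pconst (reval F x) * linp w0 ^ k)"
    by (rule swpoly_mod_hyperplane[OF W(1) w0 F(1) I(1,2)])
  then have "qideal I ?W (0 + k) (pconst (-1) * (F - pconst (reval F x) * linp w0 ^ k))"
    by (rule qideal_mult[OF _ hom_poly_pconst I(1)])
  moreover have "qideal I ?W k F" by (rule qideal_base[OF F(2) swpoly_hom[OF F(1)]])
  ultimately have "qideal I ?W k (pconst (-1) * (F - pconst (reval F x) * linp w0 ^ k) + F)"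
    by (auto intro: qideal_add)
  moreover have "pconst (-1) * (F - pconst (reval F x) * linp w0 ^ k) + F = pconst (reval F x) * linp w0 ^ k"
    by (simp add: pconst_def single_uminus algebra_simps)
  ultimately have "qideal I ?W (0 + k) (pconst (1 / reval F x) * (pconst (reval F x) * linp w0 ^ k))"
    by (intro qideal_mult[OF _ hom_poly_pconst I(1)]) simp_all
  then have e: "qideal I ?W k (linp w0 ^ k)"
    using x by (simp add: mult.assoc[symmetric] pconst_mult[symmetric])
  have "finite_over I ?W" unfolding finite_over_def
  proof
    fix j
    obtain l where l: "qideal I W (Suc l) (pvar j ^ Suc l)" using W(2) unfolding finite_over_def by blast
    have "qideal I ?W (k * Suc l) (pvar j ^ (k * Suc l))"
      using qideal_power[OF W(1) w0 l I(1,2) e] unfolding power_mult[symmetric] mult.commute[of "Suc l" k] .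
    moreover obtain m where "k * Suc l = Suc m" using \<open>k \<noteq> 0\<close> by (cases "k * Suc l") auto
    ultimately show "\<exists>k. qideal I ?W (Suc k) (pvar j ^ Suc k)" by (intro exI[of _ m]) (simp only:)
  qed
  moreover have sub: "subspace ?W"
    using W(1) by (auto simp: subspace_def inner_add_left)
  moreover have "dim ?W < dim W"
  proof (rule dim_psubset)
    have "w0 \<notin> ?W" using w0 by simp
    then have "?W \<subset> W" using w0(1) by blast
    then show "span ?W \<subset> span W" using sub W(1) by (simp add: span_eq_iff[THEN iffD2])
  qed
  ultimately show ?thesis using that by blast
qed

text \<open>Take \<open>W\<close> of least dimension among the subspaces that work; the whole space
  is one of them.\<close>

lemma noether_normalization:
  assumes I: "\<And>F G. F \<in> I \<Longrightarrow> G * F \<in> I" "0 \<in> I" "\<And>F G. F \<in> I \<Longrightarrow> G \<in> I \<Longrightarrow> F + G \<in> I" "\<And>c. pconst c \<in> I \<Longrightarrow> c = 0"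
  obtains W :: "(real^'n) set" where "subspace W" "finite_over I W" "\<And>k F. swpoly W k F \<Longrightarrow> F \<in> I \<Longrightarrow> F = 0"
proof -
  have "\<exists>W::(real^'n) set. (subspace W \<and> finite_over I W) \<and> (\<forall>V. subspace V \<and> finite_over I V \<longrightarrow> dim W \<le> dim V)"
    by (rule ex_has_least_nat[of _ UNIV]) (simp add: finite_over_UNIV)
  then obtain W :: "(real^'n) set" where W: "subspace W" "finite_over I W" "\<And>V. subspace V \<Longrightarrow> finite_over I V \<Longrightarrow> dim W \<le> dim V"
    by blast
  have "F = 0" if "swpoly W k F" "F \<in> I" for k F
  proof (rule ccontr)
    assume "F \<noteq> 0"
    from finite_over_reduce[OF W(1,2) I that this] W(3) show False by (metis not_less)
  qed
  then show ?thesis using that W by blast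
qed

lemma pvar_power: "pvar j ^ e = Poly_Mapping.single (Poly_Mapping.single j e) 1"
proof (induction e)
  case (Suc e)
  then show ?case by (simp add: pvar_def mult_single single_add[symmetric])
qed simp

text \<open>Pigeonhole: a monomial whose degree reaches the sum of the exponents contains one of the
  given powers in full.\<close>

lemma finite_over_degree:
  assumes "finite_over I W" and I: "\<And>F G. F \<in> I \<Longrightarrow> G * F \<in> I" "0 \<in> I"
  obtains E where "\<And>k F. k \<ge> E \<Longrightarrow> hom_poly k F \<Longrightarrow> qideal I W k (F :: ('n::finite \<Rightarrow>\<^sub>0 nat) \<Rightarrow>\<^sub>0 real)"
proof -
  obtain e where e: "\<And>j. qideal I W (Suc (e j)) (pvar j ^ Suc (e j))"
    using assms(1) unfolding finite_over_def by metis
  define E where "E = (\<Sum>j\<in>UNIV. Suc (e j))"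
  have "qideal I W k F" if "k \<ge> E" "hom_poly k F" for k F
    using that(2)
  proof (induction rule: hom_poly_induct)
    case (single \<alpha> c)
    have "\<exists>j. Poly_Mapping.lookup \<alpha> j \<ge> Suc (e j)"
    proof (rule ccontr)
      assume "\<not> ?thesis"
      then have "mdeg \<alpha> < E" unfolding mdeg_def E_def by (intro sum_strict_mono) (auto simp: not_le)
      then show False using single that(1) by simp
    qed
    then obtain j where j: "Poly_Mapping.lookup \<alpha> j \<ge> Suc (e j)" by blast
    define \<beta> where "\<beta> = \<alpha> - Poly_Mapping.single j (Suc (e j))"
    have \<alpha>: "\<alpha> = \<beta> + Poly_Mapping.single j (Suc (e j))"
      unfolding \<beta>_def by (rule poly_mapping_eqI) (use j in \<open>auto simp: lookup_add lookup_minus lookup_single when_def\<close>)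
    then have "Poly_Mapping.single \<alpha> c = Poly_Mapping.single \<beta> c * pvar j ^ Suc (e j)"
      unfolding pvar_power by (simp add: mult_single)
    moreover have "qideal I W (mdeg \<beta> + Suc (e j)) (Poly_Mapping.single \<beta> c * pvar j ^ Suc (e j))"
      by (rule qideal_mult[OF e hom_poly_single I(1)]) simp
    moreover have "mdeg \<beta> + Suc (e j) = k" using single \<alpha> by (simp add: mdeg_add)
    ultimately show ?case by metis
  next
    case zero
    show ?case by (auto intro: qideal_base I(2))
  qed (rule qideal_add)
  then show ?thesis using that by blast
qed

section \<open>Growth of a system that is finite over a subspace of operators\<close>

lemma qideal_kills:
  assumes sys: "symbolic_system g" and F: "qideal (op_ideal g) W k F" and q: "q \<in> g i" "\<And>w. w \<in> W \<Longrightarrow> dir_deriv w q = 0"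
  shows "diff_op F q = 0"
  using F
proof (induction rule: qideal.induct)
  case (qideal_base F k)
  then show ?case using q by (simp add: op_ideal_def)
next
  case (qideal_lin w k G)
  have "q \<in> poly_maps" using symbolic_system_facts(6)[OF sys] q(1) by blast
  then show ?case using q(2)[OF qideal_lin(1)] by (simp add: mult.commute[of "linp w"] diff_op_mult diff_op_linp)
qed (simp add: diff_op_add)

text \<open>In degree at least \<open>E\<close> all operators of degree \<open>k\<close> lie in Ann
  + (W), hence kill \<open>q\<close>, whereas a nonzero form of degree \<open>k\<close> has a
  nonzero derivative of order \<open>k\<close>.\<close>

lemma system_eventually_determined:
  assumes sys: "symbolic_system g" and E: "\<And>k F. k \<ge> E \<Longrightarrow> hom_poly k F \<Longrightarrow> qideal (op_ideal g) W k F"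
    and q: "q \<in> g k" "k \<ge> E" "\<And>w. w \<in> W \<Longrightarrow> dir_deriv w q = 0"
  shows "q = 0"
proof (rule ccontr)
  assume "q \<noteq> 0"
  then obtain \<alpha> where \<alpha>: "mdeg \<alpha> = k" "partial_deriv \<alpha> q 0 \<noteq> 0"
    using ex_partial_deriv_nonzero symbolic_system_facts(2)[OF sys] q(1) by blast
  have "qideal (op_ideal g) W k (Poly_Mapping.single \<alpha> 1)" by (rule E[OF q(2)]) (simp add: hom_poly_single \<alpha>(1))
  from qideal_kills[OF sys this q(1,3)] have "partial_deriv \<alpha> q = 0" by (simp add: diff_op_single)
  then show False using \<alpha>(2) by (simp add: zero_fun_apply)
qed

text \<open>The part of \<open>g k\<close> that is constant along the directions in
  \<open>T\<close>, dual to the quotient of the module by the multiples of \<open>T\<close>.\<close>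

definition killed :: "(nat \<Rightarrow> (real^'n \<Rightarrow> real^'m) set) \<Rightarrow> (real^'n) set \<Rightarrow> nat \<Rightarrow> (real^'n \<Rightarrow> real^'m) set" where
  "killed g T k = {q \<in> g k. \<forall>w\<in>T. dir_deriv w q = 0}"

lemma subspace_killed:
  assumes sys: "symbolic_system g"
  shows "subspace (killed g T k)" "fin_dim (killed g T k)"
proof -
  note g = symbolic_system_facts[OF sys]
  show "subspace (killed g T k)"
    using g(1)[of k] g(6)
    by (auto simp: subspace_def killed_def dir_deriv_add dir_deriv_scale)
  show "fin_dim (killed g T k)" by (rule fin_dim_subset[OF g(3)]) (auto simp: killed_def)
qed

text \<open>Rank-nullity for the derivative along \<open>w\<close>, which maps into the next lower
  degree.\<close>

lemma dim_killed_step: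
  assumes sys: "symbolic_system g"
  shows "dim (killed g T (Suc k)) \<le> dim (killed g T k) + dim (killed g (insert w T) (Suc k))"
proof -
  note g = symbolic_system_facts[OF sys] and s = subspace_killed[OF sys]
  have lin: "lin_on (killed g T (Suc k)) (dir_deriv w)"
    by (rule lin_on_subset[OF lin_on_dir_deriv]) (auto simp: killed_def g(6))
  have "dim (killed g T (Suc k)) = dim {q \<in> killed g T (Suc k). dir_deriv w q = 0} + dim (dir_deriv w ` killed g T (Suc k))"
    by (rule rank_nullity[OF s(1) lin s(2)])
  moreover have "{q \<in> killed g T (Suc k). dir_deriv w q = 0} = killed g (insert w T) (Suc k)"
    by (auto simp: killed_def)
  moreover have "dim (dir_deriv w ` killed g T (Suc k)) \<le> dim (killed g T k)"
  proof (rule dim_le_fin_dim[OF s(2)])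
    show "dir_deriv w ` killed g T (Suc k) \<subseteq> killed g T k"
    proof
      fix p assume "p \<in> dir_deriv w ` killed g T (Suc k)"
      then obtain q where q: "q \<in> g (Suc k)" "\<forall>w\<in>T. dir_deriv w q = 0" "p = dir_deriv w q" by (auto simp: killed_def)
      have "dir_deriv v p = 0" if "v \<in> T" for v
        unfolding q(3) using dir_deriv_commute[OF g(6)[OF q(1)], of v w] q(2) that by simp
      then show "p \<in> killed g T k" using g(5)[OF q(1)] q(3) by (simp add: killed_def)
    qed
  qed
  ultimately show ?thesis by simp
qed

text \<open>Directions of \<open>B\<close> are set free one at a time. With all of them imposed, the
  spaces vanish from degree \<open>E\<close> on; freeing one bounds each dimension by the previous
  partial sum, so the partial sums gain one exponent.\<close>

lemma killed_growth:
  fixes B :: "(real^'n) set"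
  assumes sys: "symbolic_system g" and E: "\<And>k F. k \<ge> E \<Longrightarrow> hom_poly k F \<Longrightarrow> qideal (op_ideal g) (span B) k F"
    and S: "finite S" "S \<subseteq> B"
  shows "\<exists>C. \<forall>K. (\<Sum>k\<le>K. dim (killed g (B - S) k)) \<le> C * (K + 1) ^ card S"
  using S
proof (induction S)
  case empty
  have z: "dim (killed g B k) = 0" if "k \<ge> E" for k
  proof -
    have "q = 0" if q: "q \<in> killed g B k" for q
    proof (rule system_eventually_determined[OF sys E])
      show "q \<in> g k" using q by (simp add: killed_def)
      then have p: "q \<in> poly_maps" by (rule symbolic_system_facts(6)[OF sys])
      show "dir_deriv w q = 0" if "w \<in> span B" for w
        using linear_eq_0_on_span[OF linear_dir_deriv_dir[OF p] _ that] q by (simp add: killed_def)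
    qed (use \<open>k \<ge> E\<close> in auto)
    then have "killed g B k \<subseteq> {0}" by blast
    then show ?thesis using dim_le_fin_dim[OF fin_dim_zero, of "killed g B k"] by simp
  qed
  have "(\<Sum>k\<le>K. dim (killed g B k)) \<le> (\<Sum>k<E. dim (killed g B k))" for K
  proof -
    have "(\<Sum>k\<le>K. dim (killed g B k)) = (\<Sum>k\<in>{..K} \<inter> {..<E}. dim (killed g B k))"
    proof (rule sum.mono_neutral_right)
      show "\<forall>k\<in>{..K} - {..K} \<inter> {..<E}. dim (killed g B k) = 0"
        by (intro ballI z) auto
    qed auto
    also have "\<dots> \<le> (\<Sum>k<E. dim (killed g B k))" by (rule sum_mono2) auto
    finally show ?thesis .
  qed
  then show ?case by (intro exI[of _ "\<Sum>k<E. dim (killed g B k)"]) simp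
next
  case (insert b S)
  then obtain C where C: "\<And>K. (\<Sum>k\<le>K. dim (killed g (B - S) k)) \<le> C * (K + 1) ^ card S" by auto
  let ?T = "B - insert b S"
  have T: "insert b ?T = B - S" using insert by blast
  let ?D = "dim (killed g ?T 0)"
  have step: "dim (killed g ?T k) \<le> ?D + (\<Sum>j\<le>k. dim (killed g (B - S) j))" for k
  proof (induction k)
    case (Suc k)
    then show ?case using dim_killed_step[OF sys, of ?T k b] unfolding T by simp
  qed simp
  have "(\<Sum>k\<le>K. dim (killed g ?T k)) \<le> (?D + C) * (K + 1) ^ card (insert b S)" for K
  proof -
    have "dim (killed g ?T k) \<le> (?D + C) * (K + 1) ^ card S" if "k \<le> K" for k
    proof -
      have "dim (killed g ?T k) \<le> ?D + C * (k + 1) ^ card S" using step[of k] C[of k] by linarith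
      also have "\<dots> \<le> ?D * (K + 1) ^ card S + C * (K + 1) ^ card S"
      proof (rule add_mono)
        show "?D \<le> ?D * (K + 1) ^ card S" by simp
        show "C * (k + 1) ^ card S \<le> C * (K + 1) ^ card S"
          using that by (intro mult_le_mono2 power_mono) auto
      qed
      finally show ?thesis by (simp add: algebra_simps)
    qed
    then have "(\<Sum>k\<le>K. dim (killed g ?T k)) \<le> (\<Sum>k\<le>K. (?D + C) * (K + 1) ^ card S)" by (intro sum_mono) auto
    also have "\<dots> = (?D + C) * (K + 1) ^ card (insert b S)" using insert(1,2) by (simp add: algebra_simps)
    finally show ?thesis .
  qed
  then show ?case by blast
qed

text \<open>The upper bound excludes a positive leading coefficient in degree above
  \<open>r\<close>, and nonnegativity excludes a negative one.\<close>

lemma degree_le_if_growth: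
  fixes P :: "real poly"
  assumes "\<And>K. K \<ge> N \<Longrightarrow> 0 \<le> poly P (real K)" "\<And>K. K \<ge> N \<Longrightarrow> poly P (real K) \<le> C * (real K + 1) ^ r"
  shows "degree P \<le> r"
proof (rule ccontr)
  assume d: "\<not> degree P \<le> r"
  define Q where "Q = smult C ([:1, 1:] ^ r)"
  have dQ: "degree Q < degree P"
    using d degree_smult_le[of C "[:1, 1:] ^ r"] degree_power_le[of "[:1::real, 1:]" r] unfolding Q_def by simp
  have big: "\<exists>K\<ge>N. poly R (real K) > 0" if "lead_coeff R > 0" for R :: "real poly"
  proof -
    obtain n where n: "\<And>x. x \<ge> n \<Longrightarrow> poly R x \<ge> lead_coeff R" using poly_pinfty_gt_lc[OF \<open>lead_coeff R > 0\<close>] by blast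
    have "n \<le> real (max N (nat \<lceil>n\<rceil>))" using real_nat_ceiling_ge[of n] by linarith
    then show ?thesis
      using n[of "real (max N (nat \<lceil>n\<rceil>))"] that by (intro exI[of _ "max N (nat \<lceil>n\<rceil>)"]) auto
  qed
  have "P \<noteq> 0" using d by auto
  then consider "lead_coeff P > 0" | "lead_coeff (- P) > 0" by (metis lead_coeff_minus leading_coeff_0_iff linorder_neqE_linordered_idom neg_0_less_iff_less)
  then show False
  proof cases
    case 1
    have "degree (P + - Q) = degree P" by (rule degree_add_eq_left) (simp add: dQ)
    then have "lead_coeff (P - Q) = lead_coeff P" using dQ by (simp add: coeff_eq_0)
    then obtain K where "K \<ge> N" "poly (P - Q) (real K) > 0" using big[of "P - Q"] 1 by auto
    then show False using assms(2)[of K] by (simp add: Q_def add.commute)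
  next
    case 2
    then obtain K where "K \<ge> N" "poly (- P) (real K) > 0" using big[of "- P"] by auto
    then show False using assms(1)[of K] by simp
  qed
qed

lemma functional_dim_le:
  fixes g :: "nat \<Rightarrow> (real^'n \<Rightarrow> real^'m) set"
  assumes sys: "symbolic_system g" and van: "\<And>i j. i \<ge> 1 \<Longrightarrow> spencer_vanishes g i j"
    and W: "subspace W" "finite_over (op_ideal g) W"
  shows "functional_dim g \<le> dim W"
proof -
  obtain B where B: "B \<subseteq> W" "independent B" "W \<subseteq> span B" "card B = dim W" using basis_exists[of W] by metis
  have sp: "span B = W" using B W(1) by (metis span_subspace)
  have finB: "finite B" using B(2) by (rule finiteI_independent)
  obtain E where E: "\<And>k F. k \<ge> E \<Longrightarrow> hom_poly k F \<Longrightarrow> qideal (op_ideal g) W k F"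
    using finite_over_degree[OF W(2) op_ideal_mult[OF sys] op_ideal_zero] by blast
  obtain C where C: "\<And>K. (\<Sum>k\<le>K. dim (killed g (B - B) k)) \<le> C * (K + 1) ^ card B"
    using killed_growth[OF sys, of E B B] E finB unfolding sp by auto
  have "killed g {} k = g k" for k by (simp add: killed_def)
  then have C: "(\<Sum>k\<le>K. dim (g k)) \<le> C * (K + 1) ^ dim W" for K using C[of K] B(4) by simp
  have "degree (spencer_poly g) \<le> dim W"
  proof (rule degree_le_if_growth[of "CARD('n)"])
    fix K assume K: "K \<ge> CARD('n)"
    note pK = poly_spencer_poly[OF sys van K]
    show "0 \<le> poly (spencer_poly g) (real K)" by (simp add: pK sum_nonneg)
    have "real (\<Sum>k\<le>K. dim (g k)) \<le> real (C * (K + 1) ^ dim W)" using C[of K] by (simp only: of_nat_le_iff)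
    then show "poly (spencer_poly g) (real K) \<le> real C * (real K + 1) ^ dim W"
      by (simp add: pK add.commute)
  qed
  then show ?thesis by (simp add: functional_dim_def hilbert_poly_eq_spencer_poly[OF sys van])
qed


section \<open>Lying over\<close>

text \<open>The complexification of S(W): the polynomial functions pulled back along the projection
  to the dual of W.\<close>

inductive scfun :: "(real^'n) set \<Rightarrow> (complex^'n \<Rightarrow> complex) \<Rightarrow> bool" for W where
  scfun_const: "scfun W (cfun c)"
| scfun_lin: "w \<in> W \<Longrightarrow> scfun W s \<Longrightarrow> scfun W (cform w * s)"
| scfun_add: "scfun W s \<Longrightarrow> scfun W t \<Longrightarrow> scfun W (s + t)"

lemma scfun_pfun: "scfun W s \<Longrightarrow> pfun s"
  by (induction rule: scfun.induct) (auto intro: pfun.intros pfun_mult simp: cform_def pfun_real_eval)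

lemma scfun_cmult: "scfun W s \<Longrightarrow> scfun W (cfun c * s)"
proof (induction rule: scfun.induct)
  case (scfun_const d)
  show ?case unfolding cfun_mult by (rule scfun.scfun_const)
next
  case (scfun_lin w s)
  then show ?case using scfun.scfun_lin by (metis mult.left_commute)
qed (simp add: distrib_left scfun.scfun_add)

lemma scfun_mult:
  assumes "scfun W s" "scfun W t"
  shows "scfun W (s * t)"
  using assms(1)
proof (induction rule: scfun.induct)
  case (scfun_const c)
  then show ?case using scfun_cmult[OF assms(2)] by simp
next
  case (scfun_lin w s)
  then show ?case using scfun.scfun_lin by (metis mult.assoc)
qed (simp add: distrib_right scfun.scfun_add)

lemma scfun_diff:
  assumes "scfun W s" "scfun W t"
  shows "scfun W (s - t)"
proof -
  have eq: "s - t = s + cfun (-1) * t" by (simp add: fun_eq_iff times_fun_apply plus_fun_apply)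
  show ?thesis unfolding eq by (rule scfun_add[OF assms(1) scfun_cmult[OF assms(2)]])
qed

text \<open>
  A point of the projection dual to \<open>W\<close> is represented by any point above it, and a subset of the
  projection by a set that is saturated for the following relation.
\<close>

definition fibre_eq :: "(real^'n) set \<Rightarrow> complex^'n \<Rightarrow> complex^'n \<Rightarrow> bool" where
  "fibre_eq W \<eta> \<xi> \<longleftrightarrow> (\<forall>w\<in>W. cform w \<eta> = cform w \<xi>)"

lemma scfun_fibre_eq: "scfun W s \<Longrightarrow> fibre_eq W \<eta> \<xi> \<Longrightarrow> s \<eta> = s \<xi>"
  by (induction rule: scfun.induct) (auto simp: times_fun_apply plus_fun_apply fibre_eq_def)

section \<open>Ideals of polynomial functions and modules over S(W)\<close>

definition pideal :: "(complex^'n \<Rightarrow> complex) set \<Rightarrow> bool" where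
  "pideal K \<longleftrightarrow> (\<forall>f\<in>K. pfun f) \<and> 0 \<in> K \<and> (\<forall>f\<in>K. \<forall>h\<in>K. f + h \<in> K) \<and> (\<forall>a f. pfun a \<longrightarrow> f \<in> K \<longrightarrow> a * f \<in> K)"

lemma pidealD:
  assumes "pideal K"
  shows "f \<in> K \<Longrightarrow> pfun f" "0 \<in> K" "f \<in> K \<Longrightarrow> h \<in> K \<Longrightarrow> f + h \<in> K" "pfun a \<Longrightarrow> f \<in> K \<Longrightarrow> a * f \<in> K"
  using assms by (auto simp: pideal_def)

lemma pideal_sum: "pideal K \<Longrightarrow> (\<And>i. i \<in> A \<Longrightarrow> f i \<in> K) \<Longrightarrow> (\<Sum>i\<in>A. f i) \<in> K"
  by (induction A rule: infinite_finite_induct) (auto simp: pidealD)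

lemma pideal_diff:
  assumes "pideal K" "f \<in> K" "h \<in> K"
  shows "f - h \<in> K"
proof -
  have eq: "f - h = f + cfun (-1) * h" by (simp add: fun_eq_iff times_fun_apply plus_fun_apply)
  show ?thesis unfolding eq
    by (rule pidealD(3)[OF assms(1,2) pidealD(4)[OF assms(1) pfun_const assms(3)]])
qed

text \<open>Two choices of \<open>M\<close> matter. With all of S(W), to contain every polynomial
  means that \<open>\<Gamma>\<close> generates the ring modulo \<open>J\<close>; with the maximal
  ideal of a point, it is the ideal of the fibre over that point.\<close>

definition module_span :: "(complex^'n \<Rightarrow> complex) set \<Rightarrow> (complex^'n \<Rightarrow> complex) set \<Rightarrow> (complex^'n \<Rightarrow> complex) set
    \<Rightarrow> (complex^'n \<Rightarrow> complex) set" where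
  "module_span J \<Gamma> M = {f. \<exists>j\<in>J. \<exists>\<mu>. (\<forall>\<gamma>\<in>\<Gamma>. \<mu> \<gamma> \<in> M) \<and> f = j + (\<Sum>\<gamma>\<in>\<Gamma>. \<mu> \<gamma> * \<gamma>)}"

lemma module_spanI: "j \<in> J \<Longrightarrow> (\<And>\<gamma>. \<gamma> \<in> \<Gamma> \<Longrightarrow> \<mu> \<gamma> \<in> M) \<Longrightarrow> j + (\<Sum>\<gamma>\<in>\<Gamma>. \<mu> \<gamma> * \<gamma>) \<in> module_span J \<Gamma> M"
  unfolding module_span_def by blast

lemma module_span_mono: "J \<subseteq> J' \<Longrightarrow> module_span J \<Gamma> M \<subseteq> module_span J' \<Gamma> M"
  unfolding module_span_def by blast

lemma module_span_add:
  assumes J: "pideal J" and M: "\<And>s t. s \<in> M \<Longrightarrow> t \<in> M \<Longrightarrow> s + t \<in> M"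
    and f: "f \<in> module_span J \<Gamma> M" and h: "h \<in> module_span J \<Gamma> M"
  shows "f + h \<in> module_span J \<Gamma> M"
proof -
  obtain j \<mu> where f: "j \<in> J" "\<And>\<gamma>. \<gamma> \<in> \<Gamma> \<Longrightarrow> \<mu> \<gamma> \<in> M" "f = j + (\<Sum>\<gamma>\<in>\<Gamma>. \<mu> \<gamma> * \<gamma>)"
    using f unfolding module_span_def by blast
  obtain k \<nu> where h: "k \<in> J" "\<And>\<gamma>. \<gamma> \<in> \<Gamma> \<Longrightarrow> \<nu> \<gamma> \<in> M" "h = k + (\<Sum>\<gamma>\<in>\<Gamma>. \<nu> \<gamma> * \<gamma>)"
    using h unfolding module_span_def by blast
  have eq: "f + h = (j + k) + (\<Sum>\<gamma>\<in>\<Gamma>. (\<mu> \<gamma> + \<nu> \<gamma>) * \<gamma>)"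
    unfolding f h by (simp add: distrib_right sum.distrib)
  show ?thesis unfolding eq by (rule module_spanI) (use f h M pidealD(3)[OF J] in auto)
qed

lemma module_span_mult:
  assumes J: "pideal J" and s: "pfun s" "\<And>t. t \<in> M \<Longrightarrow> s * t \<in> M'" and f: "f \<in> module_span J \<Gamma> M"
  shows "s * f \<in> module_span J \<Gamma> M'"
proof -
  obtain j \<mu> where f: "j \<in> J" "\<And>\<gamma>. \<gamma> \<in> \<Gamma> \<Longrightarrow> \<mu> \<gamma> \<in> M" "f = j + (\<Sum>\<gamma>\<in>\<Gamma>. \<mu> \<gamma> * \<gamma>)"
    using f unfolding module_span_def by blast
  have eq: "s * f = s * j + (\<Sum>\<gamma>\<in>\<Gamma>. (s * \<mu> \<gamma>) * \<gamma>)"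
    unfolding f by (simp add: distrib_left sum_distrib_left mult.assoc)
  show ?thesis unfolding eq by (rule module_spanI) (use f s pidealD(4)[OF J] in auto)
qed

text \<open>Nakayama's lemma, eliminating the generators one at a time instead of using a determinant.\<close>

lemma nakayama:
  fixes w :: "'i \<Rightarrow> 'r::comm_ring_1"
  assumes fin: "finite \<Gamma>"
    and J: "\<And>a b. a \<in> J \<Longrightarrow> b \<in> J \<Longrightarrow> a + b \<in> J" "\<And>s a. s \<in> S \<Longrightarrow> a \<in> J \<Longrightarrow> s * a \<in> J"
    and S: "1 \<in> S" "\<And>a b. a \<in> S \<Longrightarrow> b \<in> S \<Longrightarrow> a - b \<in> S" "\<And>a b. a \<in> S \<Longrightarrow> b \<in> S \<Longrightarrow> a + b \<in> S"
    and m: "m \<subseteq> S" "0 \<in> m" "\<And>a b. a \<in> m \<Longrightarrow> b \<in> m \<Longrightarrow> a + b \<in> m" "\<And>s a. s \<in> S \<Longrightarrow> a \<in> m \<Longrightarrow> s * a \<in> m"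
    and gen: "\<And>i. i \<in> \<Gamma> \<Longrightarrow> \<exists>j\<in>J. \<exists>\<mu>. (\<forall>k\<in>\<Gamma>. \<mu> k \<in> m) \<and> w i = j + (\<Sum>k\<in>\<Gamma>. \<mu> k * w k)"
  shows "\<exists>u. u - 1 \<in> m \<and> (\<forall>i\<in>\<Gamma>. u * w i \<in> J)"
proof -
  have "finite T \<Longrightarrow> T \<subseteq> \<Gamma> \<Longrightarrow> \<exists>u. u - 1 \<in> m \<and> (\<forall>i\<in>\<Gamma>. \<exists>j\<in>J. \<exists>\<mu>. (\<forall>k\<in>\<Gamma> - T. \<mu> k \<in> m) \<and> u * w i = j + (\<Sum>k\<in>\<Gamma> - T. \<mu> k * w k))" for T
  proof (induction T rule: finite_induct)
    case empty
    show ?case by (rule exI[of _ 1]) (use m(2) gen in simp)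
  next
    case (insert t T)
    then obtain u where u: "u - 1 \<in> m" "\<forall>i\<in>\<Gamma>. \<exists>j\<in>J. \<exists>\<mu>. (\<forall>k\<in>\<Gamma> - T. \<mu> k \<in> m) \<and> u * w i = j + (\<Sum>k\<in>\<Gamma> - T. \<mu> k * w k)" by blast
    let ?R = "\<Gamma> - insert t T"
    have split: "(\<Sum>k\<in>\<Gamma> - T. f k) = f t + (\<Sum>k\<in>?R. f k)" for f :: "'i \<Rightarrow> 'r"
    proof -
      have "\<Gamma> - T = insert t ?R" using insert by blast
      moreover have "sum f (insert t ?R) = f t + sum f ?R" using fin by (intro sum.insert) auto
      ultimately show ?thesis by (simp only:)
    qed
    obtain j \<mu> where t: "j \<in> J" "\<forall>k\<in>\<Gamma> - T. \<mu> k \<in> m" "u * w t = j + (\<Sum>k\<in>\<Gamma> - T. \<mu> k * w k)"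
      using u(2) insert.prems by blast
    have \<mu>t: "\<mu> t \<in> m" using t(2) insert by blast
    \<comment> \<open>The relation for \<open>w t\<close> is solved for \<open>w t\<close> itself;
      the factor \<open>v\<close> obtained is still 1 modulo \<open>m\<close>.\<close>
    define v where "v = u - \<mu> t"
    have vw: "v * w t = j + (\<Sum>k\<in>?R. \<mu> k * w k)" using t(3) unfolding split v_def by (simp add: algebra_simps)
    have neg: "- a \<in> m" if "a \<in> m" for a
    proof -
      have "0 - 1 \<in> S" using S(1,2) m(1,2) by blast
      then have "(0 - 1) * a \<in> m" using that m(4) by blast
      then show ?thesis by simp
    qed
    have v1: "v - 1 \<in> m" using m(3)[OF u(1) neg[OF \<mu>t]] unfolding v_def by (simp add: algebra_simps)
    have vS: "v \<in> S" using S(3)[OF S(1), of "v - 1"] v1 m(1) by auto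
    have uv_eq: "u * v - 1 = v * (u - 1) + (v - 1)" by (simp add: algebra_simps)
    have uv: "u * v - 1 \<in> m" unfolding uv_eq by (rule m(3)[OF m(4)[OF vS u(1)] v1])
    have "\<exists>j\<in>J. \<exists>\<mu>. (\<forall>k\<in>?R. \<mu> k \<in> m) \<and> u * v * w i = j + (\<Sum>k\<in>?R. \<mu> k * w k)" if i: "i \<in> \<Gamma>" for i
    proof -
      obtain j' \<mu>' where i: "j' \<in> J" "\<forall>k\<in>\<Gamma> - T. \<mu>' k \<in> m" "u * w i = j' + (\<Sum>k\<in>\<Gamma> - T. \<mu>' k * w k)"
        using u(2) i by blast
      have \<mu>'t: "\<mu>' t \<in> m" using i(2) insert by blast
      have "u * v * w i = v * (u * w i)" by (simp add: mult_ac)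
      also have "\<dots> = v * j' + \<mu>' t * (v * w t) + (\<Sum>k\<in>?R. v * \<mu>' k * w k)"
        unfolding i(3) split by (simp add: algebra_simps sum_distrib_left)
      also have "\<dots> = (v * j' + \<mu>' t * j) + (\<Sum>k\<in>?R. (v * \<mu>' k + \<mu>' t * \<mu> k) * w k)"
        unfolding vw by (simp add: algebra_simps sum_distrib_left sum.distrib)
      finally have "u * v * w i = (v * j' + \<mu>' t * j) + (\<Sum>k\<in>?R. (v * \<mu>' k + \<mu>' t * \<mu> k) * w k)" .
      moreover have "v * j' + \<mu>' t * j \<in> J" using J(1)[OF J(2)[OF vS i(1)] J(2)[OF _ t(1)]] \<mu>'t m(1) by blast
      moreover have "\<forall>k\<in>?R. v * \<mu>' k + \<mu>' t * \<mu> k \<in> m"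
        using m(3)[OF m(4)[OF vS] m(4)] i(2) t(2) \<mu>'t m(1) by blast
      ultimately show ?thesis by (intro bexI[of _ "v * j' + \<mu>' t * j"] exI[of _ "\<lambda>k. v * \<mu>' k + \<mu>' t * \<mu> k"]) auto
    qed
    then show ?case using uv by blast
  qed
  from this[OF fin order_refl] obtain u where "u - 1 \<in> m" "\<forall>i\<in>\<Gamma>. \<exists>j\<in>J. u * w i = j" by auto
  then show ?thesis by blast
qed

lemma pideal_extend:
  assumes K: "pideal K" and h: "pfun h"
  shows "pideal {k + h * a | k a. k \<in> K \<and> pfun a}" (is "pideal ?K") and "K \<subseteq> {k + h * a | k a. k \<in> K \<and> pfun a}"
    and "h \<in> {k + h * a | k a. k \<in> K \<and> pfun a}"
proof -
  have c: "0 = cfun 0" "1 = cfun 1" by (simp_all add: fun_eq_iff zero_fun_apply one_fun_apply)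
  have p: "pfun 0" "pfun 1" unfolding c by (rule pfun_const)+
  show "K \<subseteq> ?K"
  proof
    fix k assume "k \<in> K"
    then show "k \<in> ?K" using p(1) by (intro CollectI exI[of _ k] exI[of _ 0]) simp
  qed
  show "h \<in> ?K" using p(2) pidealD(2)[OF K] by (intro CollectI exI[of _ 0] exI[of _ 1]) simp
  show "pideal ?K" unfolding pideal_def
  proof (intro conjI ballI allI impI)
    show "pfun f" if "f \<in> ?K" for f using that pidealD(1)[OF K] h by (auto intro!: pfun_add pfun_mult)
    show "0 \<in> ?K" using p(1) pidealD(2)[OF K] by (intro CollectI exI[of _ 0]) simp
    show "f + f' \<in> ?K" if ff: "f \<in> ?K" "f' \<in> ?K" for f f'
    proof -
      obtain k a where 1: "f = k + h * a" "k \<in> K" "pfun a" using ff(1) by blast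
      obtain k' a' where 2: "f' = k' + h * a'" "k' \<in> K" "pfun a'" using ff(2) by blast
      have "f + f' = (k + k') + h * (a + a')" unfolding 1 2 by (simp add: algebra_simps)
      then show ?thesis using pidealD(3)[OF K 1(2) 2(2)] pfun_add[OF 1(3) 2(3)] by blast
    qed
    show "b * f \<in> ?K" if bf: "pfun b" "f \<in> ?K" for b f
    proof -
      obtain k a where 1: "f = k + h * a" "k \<in> K" "pfun a" using bf(2) by blast
      have "b * f = b * k + h * (b * a)" unfolding 1 by (simp add: algebra_simps)
      then show ?thesis using pidealD(4)[OF K bf(1) 1(2)] pfun_mult[OF bf(1) 1(3)] by blast
    qed
  qed
qed

section \<open>Proper ideals have zeros\<close>

lemma pfun_poly_coord: "pfun (\<lambda>\<xi>. poly p (\<xi> $ j))"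
proof (induction p)
  case 0
  show ?case using pfun_const[of 0] by simp
next
  case (pCons a p)
  have "(\<lambda>\<xi>. poly (pCons a p) (\<xi> $ j)) = cfun a + coord j * (\<lambda>\<xi>. poly p (\<xi> $ j))"
    by (simp add: fun_eq_iff plus_fun_apply times_fun_apply)
  then show ?case using pfun_add[OF pfun_const pfun_coord[OF pCons(2)]] by metis
qed

text \<open>Split off a linear factor of \<open>p\<close> over the complex numbers. If adjoining it
  gives the unit ideal, the cofactor already lies in \<open>K\<close>, and its degree is
  smaller.\<close>

lemma pideal_root:
  assumes "pideal K" "1 \<notin> K" "p \<noteq> 0" "(\<lambda>\<xi>. poly p (\<xi> $ j)) \<in> K"
  shows "\<exists>c K'. pideal K' \<and> K \<subseteq> K' \<and> 1 \<notin> K' \<and> (\<lambda>\<xi>. \<xi> $ j - c) \<in> K'"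
  using assms(3,4)
proof (induction "degree p" arbitrary: p)
  case 0
  then obtain a where a: "p = [:a:]" "a \<noteq> 0" by (metis degree_eq_zeroE pCons_0_0)
  then have "cfun (1 / a) * (\<lambda>\<xi>. poly p (\<xi> $ j)) = 1" by (simp add: fun_eq_iff times_fun_apply one_fun_apply)
  then have "1 \<in> K" using pidealD(4)[OF assms(1) pfun_const 0(3)] by metis
  then show ?case using assms(2) by simp
next
  case (Suc d)
  then have "\<not> constant (poly p)" using constant_degree by (metis nat.distinct(1))
  then obtain c where "poly p c = 0" using fundamental_theorem_of_algebra by blast
  then obtain q where q: "p = [:- c, 1:] * q" using poly_eq_0_iff_dvd by (metis dvd_def)
  define h where "h = (\<lambda>\<xi>::complex^'a. \<xi> $ j - c)"
  have h: "pfun h" unfolding h_def using pfun_poly_coord[of "[:- c, 1:]" j] by simp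
  let ?K = "{k + h * a | k a. k \<in> K \<and> pfun a}"
  note ext = pideal_extend[OF assms(1) h]
  show ?case
  proof (cases "1 \<in> ?K")
    case False
    then show ?thesis using ext unfolding h_def by blast
  next
    case True
    then obtain k a where ka: "1 = k + h * a" "k \<in> K" "pfun a" by blast
    define Q where "Q = (\<lambda>\<xi>::complex^'a. poly q (\<xi> $ j))"
    have P: "(\<lambda>\<xi>. poly p (\<xi> $ j)) = h * Q" unfolding q h_def Q_def by (simp add: fun_eq_iff times_fun_apply algebra_simps)
    have "Q = Q * (k + h * a)" using ka(1) by simp
    also have "\<dots> = Q * k + a * (h * Q)" by (simp add: algebra_simps)
    finally have "Q = Q * k + a * (h * Q)" .
    moreover have "Q * k + a * (h * Q) \<in> K"
      using pidealD(3)[OF assms(1) pidealD(4)[OF assms(1) _ ka(2)] pidealD(4)[OF assms(1) ka(3)]] Suc(4) P pfun_poly_coord[of q j]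
      unfolding Q_def by metis
    ultimately have "Q \<in> K" by simp
    moreover have "q \<noteq> 0" using Suc(3) q by auto
    moreover have "d = degree q" using Suc(2) q \<open>q \<noteq> 0\<close> by (simp add: degree_mult_eq del: mult_pCons_left)
    ultimately show ?thesis using Suc(1)[of q] unfolding Q_def by blast
  qed
qed

text \<open>Linear polynomials in the single coordinates are adjoined one by one while the ideal
  stays proper. Modulo all of them every function is congruent to its value at one point, so a
  nonzero value would put 1 into the ideal.\<close>

lemma pideal_point:
  assumes K: "pideal K" "1 \<notin> K"
    and p: "\<And>j. \<exists>p. p \<noteq> 0 \<and> (\<lambda>\<xi>. poly p (\<xi> $ j)) \<in> K"
  shows "\<exists>\<eta> :: complex^'n. \<forall>f\<in>K. f \<eta> = 0"
proof -
  have "finite T \<Longrightarrow> \<exists>K'. pideal K' \<and> K \<subseteq> K' \<and> 1 \<notin> K' \<and> (\<forall>j\<in>T. \<exists>c. (\<lambda>\<xi>. \<xi> $ j - c) \<in> K')" for T :: "'n set"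
  proof (induction T rule: finite_induct)
    case empty
    then show ?case using K by blast
  next
    case (insert j T)
    then obtain K' where K': "pideal K'" "K \<subseteq> K'" "1 \<notin> K'" "\<forall>j\<in>T. \<exists>c. (\<lambda>\<xi>. \<xi> $ j - c) \<in> K'" by blast
    obtain p where "p \<noteq> 0" "(\<lambda>\<xi>. poly p (\<xi> $ j)) \<in> K'" using p[of j] K'(2) by blast
    then obtain c K'' where "pideal K''" "K' \<subseteq> K''" "1 \<notin> K''" "(\<lambda>\<xi>. \<xi> $ j - c) \<in> K''"
      using pideal_root[OF K'(1,3)] by blast
    then show ?case using K' by (intro exI[of _ K'']) blast
  qed
  from this[of UNIV] obtain K' where K': "pideal K'" "K \<subseteq> K'" "1 \<notin> K'" "\<forall>j. \<exists>c. (\<lambda>\<xi>. \<xi> $ j - c) \<in> K'" by auto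
  from K'(4) obtain c where c: "\<And>j. (\<lambda>\<xi>. \<xi> $ j - c j) \<in> K'" by metis
  define \<eta> :: "complex^'n" where "\<eta> = (\<chi> j. c j)"
  have main: "f - cfun (f \<eta>) \<in> K'" if "pfun f" for f
    using that
  proof (induction rule: pfun.induct)
    case (pfun_const c)
    have "cfun c - cfun c = (0 :: complex^'n \<Rightarrow> complex)" by simp
    then show ?case using pidealD(2)[OF K'(1)] by simp
  next
    case (pfun_coord f i)
    have "coord i * f - cfun ((coord i * f) \<eta>) = coord i * (f - cfun (f \<eta>)) + cfun (f \<eta>) * (\<lambda>\<xi>. \<xi> $ i - c i)"
      by (simp add: fun_eq_iff times_fun_apply plus_fun_apply \<eta>_def algebra_simps)
    moreover have "pfun (coord i)"
      using pfun_poly_coord[of "[:0, 1:]" i] by simp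
    ultimately show ?case
      using pidealD(3)[OF K'(1) pidealD(4)[OF K'(1) _ pfun_coord(2)] pidealD(4)[OF K'(1) pfun_const c]] by metis
  next
    case (pfun_add f h)
    have "f + h - cfun ((f + h) \<eta>) = (f - cfun (f \<eta>)) + (h - cfun (h \<eta>))"
      by (simp add: fun_eq_iff plus_fun_apply)
    then show ?case using pidealD(3)[OF K'(1) pfun_add(3,4)] by metis
  qed
  have "f \<eta> = 0" if f: "f \<in> K" for f
  proof (rule ccontr)
    assume nz: "f \<eta> \<noteq> 0"
    have "f - (f - cfun (f \<eta>)) \<in> K'"
      using pideal_diff[OF K'(1) _ main] f K'(2) pidealD(1)[OF K(1) f] by blast
    then have "cfun (1 / f \<eta>) * (f - (f - cfun (f \<eta>))) \<in> K'" using pidealD(4)[OF K'(1) pfun_const] by blast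
    moreover have "cfun (1 / f \<eta>) * (f - (f - cfun (f \<eta>))) = 1"
      using nz by (simp add: fun_eq_iff times_fun_apply one_fun_apply)
    ultimately show False using K'(3) by simp
  qed
  then show ?thesis by blast
qed

text \<open>The maximal ideal of complexified S(W) at the projection of
  \<open>\<xi>0\<close>.\<close>

definition sc_max :: "(real^'n) set \<Rightarrow> complex^'n \<Rightarrow> (complex^'n \<Rightarrow> complex) set" where
  "sc_max W \<xi>0 = {s. scfun W s \<and> s \<xi>0 = 0}"

lemma scfun_zero: "scfun W 0"
  using scfun_const[of W 0] by (simp add: zero_fun_def)

lemma scfun_one: "scfun W 1"
  using scfun_const[of W 1] by (simp add: one_fun_def)

text \<open>Powers of a coordinate are combinations of \<open>\<Gamma>\<close> modulo
  \<open>J\<close>. The values of their coefficients at \<open>\<xi>0\<close> lie in a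
  finite-dimensional space, so some real combination has all coefficients vanishing there; its
  weights are the coefficients of \<open>p\<close>.\<close>

lemma fibre_polynomial:
  fixes J :: "(complex^'n \<Rightarrow> complex) set"
  assumes \<Gamma>: "finite \<Gamma>" and J: "pideal J" and gen: "{f. pfun f} \<subseteq> module_span J \<Gamma> {s. scfun W s}"
  shows "\<exists>p. p \<noteq> 0 \<and> (\<lambda>\<xi>. poly p (\<xi> $ j)) \<in> module_span J \<Gamma> (sc_max W \<xi>0)"
proof -
  have "\<exists>x. fst x \<in> J \<and> (\<forall>\<gamma>\<in>\<Gamma>. scfun W (snd x \<gamma>)) \<and> (\<lambda>\<xi>. \<xi> $ j ^ e) = fst x + (\<Sum>\<gamma>\<in>\<Gamma>. snd x \<gamma> * \<gamma>)" for e
  proof -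
    have "pfun (\<lambda>\<xi>. \<xi> $ j ^ e)" using pfun_poly_coord[of "monom 1 e" j] by (simp add: poly_monom)
    then have "(\<lambda>\<xi>. \<xi> $ j ^ e) \<in> module_span J \<Gamma> {s. scfun W s}" using gen by blast
    then obtain j' \<mu> where "j' \<in> J" "\<forall>\<gamma>\<in>\<Gamma>. scfun W (\<mu> \<gamma>)" "(\<lambda>\<xi>. \<xi> $ j ^ e) = j' + (\<Sum>\<gamma>\<in>\<Gamma>. \<mu> \<gamma> * \<gamma>)"
      unfolding module_span_def by blast
    then show ?thesis by (intro exI[of _ "(j', \<mu>)"]) simp
  qed
  then have "\<forall>e. \<exists>x. fst x \<in> J \<and> (\<forall>\<gamma>\<in>\<Gamma>. scfun W (snd x \<gamma>)) \<and> (\<lambda>\<xi>. \<xi> $ j ^ e) = fst x + (\<Sum>\<gamma>\<in>\<Gamma>. snd x \<gamma> * \<gamma>)" ..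
  from choice[OF this] obtain x where x: "\<forall>e. fst (x e) \<in> J \<and> (\<forall>\<gamma>\<in>\<Gamma>. scfun W (snd (x e) \<gamma>)) \<and> (\<lambda>\<xi>. \<xi> $ j ^ e) = fst (x e) + (\<Sum>\<gamma>\<in>\<Gamma>. snd (x e) \<gamma> * \<gamma>)" ..
  define y where "y e = fst (x e)" for e
  define \<mu> where "\<mu> e = snd (x e)" for e
  have y: "\<And>e. y e \<in> J" "\<And>e \<gamma>. \<gamma> \<in> \<Gamma> \<Longrightarrow> scfun W (\<mu> e \<gamma>)"
    "\<And>e. (\<lambda>\<xi>. \<xi> $ j ^ e) = y e + (\<Sum>\<gamma>\<in>\<Gamma>. \<mu> e \<gamma> * \<gamma>)"
    using x unfolding y_def \<mu>_def by blast+
  define v where "v e = (\<lambda>\<gamma>. if \<gamma> \<in> \<Gamma> then \<mu> e \<gamma> \<xi>0 else 0)" for e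
  have "fin_dim (supp_funs \<Gamma> (UNIV :: complex set))" by (rule fin_dim_supp_funs[OF \<Gamma> fin_dim_UNIV])
  then obtain B where B: "finite B" "supp_funs \<Gamma> (UNIV :: complex set) \<subseteq> span B" by (auto simp: fin_dim_def)
  have "v e \<in> span B" for e
  proof -
    have "v e \<in> supp_funs \<Gamma> UNIV" by (simp add: v_def supp_funs_def)
    then show ?thesis using B(2) by blast
  qed
  then obtain c where c: "\<exists>e\<le>card B. c e \<noteq> 0" "(\<Sum>e\<le>card B. c e *\<^sub>R v e) = 0"
    using sum_sq_dependent[OF B(1), of v] by blast
  define p where "p = (\<Sum>e\<le>card B. monom (complex_of_real (c e)) e)"
  have coeff: "coeff p e = complex_of_real (c e)" if "e \<le> card B" for e
    using that by (simp add: p_def coeff_sum)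
  then have "p \<noteq> 0" using c(1) by (metis coeff_0 of_real_eq_0_iff)
  let ?z = "\<lambda>e. cfun (complex_of_real (c e))"
  have "(\<lambda>\<xi>. poly p (\<xi> $ j)) = (\<Sum>e\<le>card B. ?z e * (\<lambda>\<xi>. \<xi> $ j ^ e))"
    by (simp add: fun_eq_iff p_def poly_sum poly_monom sum_fun_apply times_fun_apply)
  also have "\<dots> = (\<Sum>e\<le>card B. ?z e * y e + (\<Sum>\<gamma>\<in>\<Gamma>. ?z e * \<mu> e \<gamma> * \<gamma>))"
    unfolding y(3) by (simp only: distrib_left sum_distrib_left mult.assoc)
  also have "\<dots> = (\<Sum>e\<le>card B. ?z e * y e) + (\<Sum>\<gamma>\<in>\<Gamma>. (\<Sum>e\<le>card B. ?z e * \<mu> e \<gamma>) * \<gamma>)"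
    unfolding sum.distrib sum_distrib_right by (subst sum.swap) simp
  finally have eq: "(\<lambda>\<xi>. poly p (\<xi> $ j)) = (\<Sum>e\<le>card B. ?z e * y e) + (\<Sum>\<gamma>\<in>\<Gamma>. (\<Sum>e\<le>card B. ?z e * \<mu> e \<gamma>) * \<gamma>)" .
  have "(\<lambda>\<xi>. poly p (\<xi> $ j)) \<in> module_span J \<Gamma> (sc_max W \<xi>0)"
    unfolding eq
  proof (rule module_spanI)
    show "(\<Sum>e\<le>card B. ?z e * y e) \<in> J"
      by (intro pideal_sum[OF J] pidealD(4)[OF J] pfun_const y(1))
    fix \<gamma> assume \<gamma>: "\<gamma> \<in> \<Gamma>"
    have "scfun W (\<Sum>e\<in>A. ?z e * \<mu> e \<gamma>)" for A
      by (induction A rule: infinite_finite_induct) (auto intro: scfun_zero scfun_add scfun_cmult y(2)[OF \<gamma>])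
    moreover have "(\<Sum>e\<le>card B. ?z e * \<mu> e \<gamma>) \<xi>0 = (\<Sum>e\<le>card B. c e *\<^sub>R v e) \<gamma>"
      using \<gamma> by (simp add: sum_fun_apply times_fun_apply scaleR_fun_apply v_def scaleR_conv_of_real)
    then have "(\<Sum>e\<le>card B. ?z e * \<mu> e \<gamma>) \<xi>0 = 0" unfolding c(2) by (simp add: zero_fun_apply)
    ultimately show "(\<Sum>e\<le>card B. ?z e * \<mu> e \<gamma>) \<in> sc_max W \<xi>0" by (simp add: sc_max_def)
  qed
  then show ?thesis using \<open>p \<noteq> 0\<close> by blast
qed

lemma module_span_vanish:
  assumes "f \<in> module_span J \<Gamma> (sc_max W \<xi>0)" "fibre_eq W \<eta> \<xi>0" "\<And>f. f \<in> J \<Longrightarrow> f \<eta> = 0"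
  shows "f \<eta> = 0"
proof -
  obtain j \<mu> where f: "j \<in> J" "\<And>\<gamma>. \<gamma> \<in> \<Gamma> \<Longrightarrow> \<mu> \<gamma> \<in> sc_max W \<xi>0" "f = j + (\<Sum>\<gamma>\<in>\<Gamma>. \<mu> \<gamma> * \<gamma>)"
    using assms(1) unfolding module_span_def by blast
  have "\<mu> \<gamma> \<eta> = 0" if "\<gamma> \<in> \<Gamma>" for \<gamma>
    using f(2)[OF that] scfun_fibre_eq[of W "\<mu> \<gamma>" \<eta> \<xi>0] assms(2) by (simp add: sc_max_def)
  then show ?thesis unfolding f(3) using assms(3)[OF f(1)] by (simp add: plus_fun_apply sum_fun_apply times_fun_apply)
qed

text \<open>Each coordinate of a point of the fibre is a root of a fixed nonzero polynomial.\<close>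

lemma finite_fibre:
  fixes J :: "(complex^'n \<Rightarrow> complex) set"
  assumes \<Gamma>: "finite \<Gamma>" and J: "pideal J" and gen: "{f. pfun f} \<subseteq> module_span J \<Gamma> {s. scfun W s}"
  shows "finite {\<eta> :: complex^'n. fibre_eq W \<eta> \<xi>0 \<and> (\<forall>f\<in>J. f \<eta> = 0)}"
proof -
  have "\<forall>j. \<exists>p. p \<noteq> 0 \<and> (\<lambda>\<xi>. poly p (\<xi> $ j)) \<in> module_span J \<Gamma> (sc_max W \<xi>0)"
    by (intro allI fibre_polynomial[OF assms])
  from choice[OF this] obtain p where
    "\<forall>j. p j \<noteq> 0 \<and> (\<lambda>\<xi>. poly (p j) (\<xi> $ j)) \<in> module_span J \<Gamma> (sc_max W \<xi>0)" ..
  then have p: "p j \<noteq> 0" "(\<lambda>\<xi>. poly (p j) (\<xi> $ j)) \<in> module_span J \<Gamma> (sc_max W \<xi>0)" for j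
    by simp_all
  have "{\<eta>. fibre_eq W \<eta> \<xi>0 \<and> (\<forall>f\<in>J. f \<eta> = 0)} \<subseteq> vec_lambda ` (PiE UNIV (\<lambda>j. {x. poly (p j) x = 0}))"
  proof
    fix \<eta> assume \<eta>: "\<eta> \<in> {\<eta>. fibre_eq W \<eta> \<xi>0 \<and> (\<forall>f\<in>J. f \<eta> = 0)}"
    have "poly (p j) (\<eta> $ j) = 0" for j using module_span_vanish[OF p(2)] \<eta> by auto
    then have "vec_nth \<eta> \<in> PiE UNIV (\<lambda>j. {x. poly (p j) x = 0})" by auto
    then show "\<eta> \<in> vec_lambda ` (PiE UNIV (\<lambda>j. {x. poly (p j) x = 0}))"
      by (rule rev_image_eqI) simp
  qed
  moreover have "finite (PiE (UNIV :: 'n set) (\<lambda>j. {x. poly (p j) x = 0}))"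
    by (rule finite_PiE) (use p(1) poly_roots_finite in auto)
  ultimately show ?thesis using finite_subset by blast
qed

text \<open>A zero of the fibre ideal \<open>?K\<close> is a point as wanted. Were \<open>?K\<close>
  the unit ideal, Nakayama would give \<open>u\<close> with value 1 at \<open>\<xi>0\<close> that
  sends all generators into \<open>J\<close>; then \<open>u\<close> itself lies in \<open>J\<close>
  and in S(W), so it vanishes at \<open>\<xi>0\<close>.\<close>

lemma lying_over:
  fixes J :: "(complex^'n \<Rightarrow> complex) set"
  assumes \<Gamma>: "finite \<Gamma>" and J: "pideal J" and gen: "{f. pfun f} \<subseteq> module_span J \<Gamma> {s. scfun W s}"
    and \<Gamma>p: "\<And>\<gamma>. \<gamma> \<in> \<Gamma> \<Longrightarrow> pfun \<gamma>"
    and z: "\<And>s. scfun W s \<Longrightarrow> s \<in> J \<Longrightarrow> s \<xi>0 = 0"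
  shows "\<exists>\<eta>. fibre_eq W \<eta> \<xi>0 \<and> (\<forall>f\<in>J. f \<eta> = 0)"
proof -
  let ?m = "sc_max W \<xi>0"
  let ?S = "{s. scfun W s}"
  let ?K = "module_span J \<Gamma> ?m"
  have m: "?m \<subseteq> ?S" "0 \<in> ?m" "\<And>a b. a \<in> ?m \<Longrightarrow> b \<in> ?m \<Longrightarrow> a + b \<in> ?m" "\<And>s a. s \<in> ?S \<Longrightarrow> a \<in> ?m \<Longrightarrow> s * a \<in> ?m"
    by (auto simp: sc_max_def scfun_zero scfun_add scfun_mult zero_fun_apply plus_fun_apply times_fun_apply)
  have p1: "pfun 1" by (rule scfun_pfun[OF scfun_one])
  have K: "pideal ?K" unfolding pideal_def
  proof (intro conjI ballI allI impI)
    fix f assume "f \<in> ?K"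
    then obtain j \<mu> where f: "j \<in> J" "\<And>\<gamma>. \<gamma> \<in> \<Gamma> \<Longrightarrow> \<mu> \<gamma> \<in> ?m" "f = j + (\<Sum>\<gamma>\<in>\<Gamma>. \<mu> \<gamma> * \<gamma>)"
      unfolding module_span_def by blast
    have "A \<subseteq> \<Gamma> \<Longrightarrow> pfun (\<Sum>\<gamma>\<in>A. \<mu> \<gamma> * \<gamma>)" for A
    proof (induction A rule: infinite_finite_induct)
      case (insert \<gamma> A)
      then have "scfun W (\<mu> \<gamma>)" "pfun \<gamma>" using f(2) m(1) \<Gamma>p by auto
      then show ?case using insert by (simp add: pfun_add pfun_mult scfun_pfun)
    qed (use scfun_pfun[OF scfun_zero] in auto)
    then show "pfun f" unfolding f(3) using pidealD(1)[OF J f(1)] by (intro pfun_add) auto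
  next
    have "0 + (\<Sum>\<gamma>\<in>\<Gamma>. 0 * \<gamma>) \<in> ?K" by (rule module_spanI) (use pidealD(2)[OF J] m(2) in auto)
    then show "0 \<in> ?K" by simp
  next
    fix f h assume "f \<in> ?K" "h \<in> ?K"
    then show "f + h \<in> ?K" by (intro module_span_add[OF J m(3)])
  next
    fix a f :: "complex^'n \<Rightarrow> complex" assume a: "pfun a" and "f \<in> ?K"
    then obtain j \<mu> where f: "j \<in> J" "\<And>\<gamma>. \<gamma> \<in> \<Gamma> \<Longrightarrow> \<mu> \<gamma> \<in> ?m" "f = j + (\<Sum>\<gamma>\<in>\<Gamma>. \<mu> \<gamma> * \<gamma>)"
      unfolding module_span_def by blast
    have base: "b \<in> ?K" if "b \<in> J" for b
    proof -
      have "b + (\<Sum>\<gamma>\<in>\<Gamma>. 0 * \<gamma>) \<in> ?K" by (rule module_spanI) (use that m(2) in auto)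
      then show ?thesis by simp
    qed
    \<comment> \<open>\<open>a * \<gamma>\<close> need not be a generator. It is expanded over S(W)
      again, and the ideal \<open>?m\<close> absorbs the new coefficients.\<close>
    have t: "\<mu> \<gamma> * (a * \<gamma>) \<in> ?K" if "\<gamma> \<in> \<Gamma>" for \<gamma>
    proof (rule module_span_mult[OF J, where M = ?S])
      show "pfun (\<mu> \<gamma>)" using f(2)[OF that] m(1) scfun_pfun by blast
      show "\<mu> \<gamma> * s \<in> ?m" if "s \<in> ?S" for s using m(4)[OF that f(2)[OF \<open>\<gamma> \<in> \<Gamma>\<close>]] by (simp add: mult.commute)
      show "a * \<gamma> \<in> module_span J \<Gamma> ?S" using gen pfun_mult[OF a \<Gamma>p[OF that]] by blast
    qed
    have sum: "A \<subseteq> \<Gamma> \<Longrightarrow> (\<Sum>\<gamma>\<in>A. \<mu> \<gamma> * (a * \<gamma>)) \<in> ?K" for A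
    proof (induction A rule: infinite_finite_induct)
      case (insert \<gamma> A)
      then show ?case using module_span_add[OF J m(3)] t by simp
    qed (use base[OF pidealD(2)[OF J]] in auto)
    have "a * j + (\<Sum>\<gamma>\<in>\<Gamma>. \<mu> \<gamma> * (a * \<gamma>)) \<in> ?K"
      by (rule module_span_add[OF J m(3) base[OF pidealD(4)[OF J a f(1)]] sum[OF order_refl]])
    moreover have "a * f = a * j + (\<Sum>\<gamma>\<in>\<Gamma>. \<mu> \<gamma> * (a * \<gamma>))"
      unfolding f(3) by (simp add: distrib_left sum_distrib_left mult.left_commute)
    ultimately show "a * f \<in> ?K" by simp
  qed
  have "1 \<notin> ?K"
  proof
    assume one: "1 \<in> ?K"
    have "\<exists>u. u - 1 \<in> ?m \<and> (\<forall>\<gamma>\<in>\<Gamma>. u * \<gamma> \<in> J)"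
    proof (rule nakayama[where S = ?S])
      show "finite \<Gamma>" by fact
      show "a + b \<in> J" if "a \<in> J" "b \<in> J" for a b using pidealD(3)[OF J] that by blast
      show "s * a \<in> J" if "s \<in> ?S" "a \<in> J" for s a using pidealD(4)[OF J] that scfun_pfun by blast
      show "\<exists>j\<in>J. \<exists>\<mu>. (\<forall>k\<in>\<Gamma>. \<mu> k \<in> ?m) \<and> \<gamma> = j + (\<Sum>k\<in>\<Gamma>. \<mu> k * k)" if "\<gamma> \<in> \<Gamma>" for \<gamma>
        using pidealD(4)[OF K \<Gamma>p[OF that] one] unfolding module_span_def by simp
    qed (use m in \<open>auto simp: scfun_one scfun_add scfun_diff\<close>)
    then obtain u where u: "u - 1 \<in> ?m" "\<And>\<gamma>. \<gamma> \<in> \<Gamma> \<Longrightarrow> u * \<gamma> \<in> J" by blast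
    have us: "scfun W u"
    proof -
      have "scfun W ((u - 1) + 1)" using u(1) m(1) by (intro scfun_add scfun_one) auto
      then show ?thesis by simp
    qed
    obtain j \<mu> where one': "j \<in> J" "\<And>\<gamma>. \<gamma> \<in> \<Gamma> \<Longrightarrow> scfun W (\<mu> \<gamma>)" "1 = j + (\<Sum>\<gamma>\<in>\<Gamma>. \<mu> \<gamma> * \<gamma>)"
      using gen p1 unfolding module_span_def by blast
    have "u = u * (j + (\<Sum>\<gamma>\<in>\<Gamma>. \<mu> \<gamma> * \<gamma>))" using one'(3) by simp
    also have "\<dots> = u * j + (\<Sum>\<gamma>\<in>\<Gamma>. \<mu> \<gamma> * (u * \<gamma>))"
      by (simp add: distrib_left sum_distrib_left mult.left_commute)
    finally have eq: "u = u * j + (\<Sum>\<gamma>\<in>\<Gamma>. \<mu> \<gamma> * (u * \<gamma>))" .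
    have "u * j + (\<Sum>\<gamma>\<in>\<Gamma>. \<mu> \<gamma> * (u * \<gamma>)) \<in> J"
      by (intro pidealD(3)[OF J] pidealD(4)[OF J] pideal_sum[OF J] one'(1) u(2) scfun_pfun[OF us] scfun_pfun[OF one'(2)])
    then have "u \<in> J" using eq by simp
    then have "u \<xi>0 = 0" using z us by blast
    moreover have "u \<xi>0 - 1 = 0" using u(1) by (simp add: sc_max_def one_fun_apply)
    ultimately show False by simp
  qed
  then obtain \<eta> where \<eta>: "\<And>f. f \<in> ?K \<Longrightarrow> f \<eta> = 0"
    using pideal_point[OF K _ fibre_polynomial[OF \<Gamma> J gen]] by blast
  have "f \<eta> = 0" if "f \<in> J" for f
  proof -
    have "f + (\<Sum>\<gamma>\<in>\<Gamma>. 0 * \<gamma>) \<in> ?K" by (rule module_spanI) (use that m(2) in auto)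
    then show ?thesis using \<eta> by simp
  qed
  moreover have "fibre_eq W \<eta> \<xi>0" unfolding fibre_eq_def
  proof
    fix w assume "w \<in> W"
    then have "scfun W (cform w * 1 - cfun (cform w \<xi>0))" by (intro scfun_diff scfun_lin scfun_one scfun_const)
    then have s: "cform w * 1 - cfun (cform w \<xi>0) \<in> ?m" by (simp add: sc_max_def times_fun_apply one_fun_apply)
    have "(cform w * 1 - cfun (cform w \<xi>0)) * 1 \<in> ?K"
    proof (rule module_span_mult[OF J, where M = ?S])
      show "pfun (cform w * 1 - cfun (cform w \<xi>0))" using s m(1) scfun_pfun by blast
      show "(cform w * 1 - cfun (cform w \<xi>0)) * t \<in> ?m" if "t \<in> ?S" for t using m(4)[OF that s] by (simp add: mult.commute)
      show "1 \<in> module_span J \<Gamma> ?S" using gen p1 by blast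
    qed
    from \<eta>[OF this] show "cform w \<eta> = cform w \<xi>0" by (simp add: times_fun_apply one_fun_apply)
  qed
  ultimately show ?thesis by blast
qed


section \<open>Lifting a flag to the characteristic variety\<close>

text \<open>The vertex is included even over the empty set, so the fibre over the origin is never
  empty.\<close>

definition acone :: "(complex^'n) set set \<Rightarrow> (complex^'n) set" where
  "acone X = insert 0 (\<Union>X)"

lemma zariski_closed_proj: "zariski_closed X \<Longrightarrow> X \<subseteq> proj_points"
  by (auto simp: zariski_closed_def zero_locus_def)

lemma in_span_self: "\<xi> \<in> vec.span {\<xi> :: complex^'n}"
  by (rule vec.span_base) simp

lemma acone_iff:
  assumes "X \<subseteq> proj_points"
  shows "\<eta> \<in> acone X \<longleftrightarrow> \<eta> = 0 \<or> vec.span {\<eta>} \<in> X"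
proof
  assume "\<eta> \<in> acone X"
  then consider "\<eta> = 0" | L where "L \<in> X" "\<eta> \<in> L" "\<eta> \<noteq> 0" by (auto simp: acone_def)
  then show "\<eta> = 0 \<or> vec.span {\<eta>} \<in> X"
  proof cases
    case 2
    then obtain \<xi> where \<xi>: "L = vec.span {\<xi>}" using assms by (auto simp: proj_points_def)
    then obtain c where c: "\<eta> = c *s \<xi>" using 2 span_singleton_iff by blast
    have "c \<noteq> 0" using c 2(3) by auto
    have "vec.span {\<eta>} = vec.span {\<xi>}"
    proof (intro set_eqI iffI)
      fix \<mu> assume "\<mu> \<in> vec.span {\<eta>}"
      then obtain d where "\<mu> = d *s \<eta>" using span_singleton_iff by blast
      then have "\<mu> = (d * c) *s \<xi>" using c by (simp add: vector_smult_assoc)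
      then show "\<mu> \<in> vec.span {\<xi>}" using span_singleton_iff by blast
    next
      fix \<mu> assume "\<mu> \<in> vec.span {\<xi>}"
      then obtain d where "\<mu> = d *s \<xi>" using span_singleton_iff by blast
      then have "\<mu> = (d / c) *s \<eta>" using c \<open>c \<noteq> 0\<close> by (simp add: vector_smult_assoc)
      then show "\<mu> \<in> vec.span {\<eta>}" using span_singleton_iff by blast
    qed
    then show ?thesis using 2(1) \<xi> by simp
  qed simp
next
  assume "\<eta> = 0 \<or> vec.span {\<eta>} \<in> X"
  then show "\<eta> \<in> acone X" using in_span_self[of \<eta>] unfolding acone_def by blast
qed

lemma acone_mono: "X \<subseteq> Y \<Longrightarrow> acone X \<subseteq> acone Y"
  by (auto simp: acone_def)

lemma acone_Un: "acone (A \<union> B) = acone A \<union> acone B"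
  by (auto simp: acone_def)

text \<open>A canonical system of equations, so that the equations of a family of closed sets can be
  united.\<close>

definition hom_vanishing :: "(complex^'n) set set \<Rightarrow> (('n \<Rightarrow>\<^sub>0 nat) \<Rightarrow>\<^sub>0 complex) set" where
  "hom_vanishing X = {f. mpoly_homogeneous f \<and> (\<forall>L\<in>X. \<forall>\<xi>\<in>L. mpoly_eval f \<xi> = 0)}"

lemma zariski_closed_hom_vanishing:
  assumes "zariski_closed X"
  shows "X = zero_locus (hom_vanishing X)"
proof
  show "X \<subseteq> zero_locus (hom_vanishing X)"
    using zariski_closed_proj[OF assms] by (auto simp: zero_locus_def hom_vanishing_def)
  obtain F where F: "\<forall>f\<in>F. mpoly_homogeneous f" "X = zero_locus F" using assms by (auto simp: zariski_closed_def)
  then have "F \<subseteq> hom_vanishing X" by (auto simp: zero_locus_def hom_vanishing_def)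
  then show "zero_locus (hom_vanishing X) \<subseteq> X" unfolding F(2) by (auto simp: zero_locus_def)
qed

lemma zariski_closed_Inter:
  assumes "D \<noteq> {}" "\<And>X. X \<in> D \<Longrightarrow> zariski_closed X"
  shows "zariski_closed (\<Inter>D)"
proof -
  have D: "L \<in> X \<longleftrightarrow> L \<in> zero_locus (hom_vanishing X)" if "X \<in> D" for X L
    using zariski_closed_hom_vanishing[OF assms(2)[OF that]] by simp
  have "\<Inter>D = zero_locus (\<Union>X\<in>D. hom_vanishing X)"
  proof (rule set_eqI)
    fix L
    have "L \<in> \<Inter>D \<longleftrightarrow> (\<forall>X\<in>D. L \<in> zero_locus (hom_vanishing X))" using D by simp
    also have "\<dots> \<longleftrightarrow> L \<in> zero_locus (\<Union>X\<in>D. hom_vanishing X)"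
      using assms(1) by (auto simp: zero_locus_def)
    finally show "L \<in> \<Inter>D \<longleftrightarrow> L \<in> zero_locus (\<Union>X\<in>D. hom_vanishing X)" .
  qed
  then show ?thesis unfolding zariski_closed_def
    by (intro exI[of _ "\<Union>X\<in>D. hom_vanishing X"]) (auto simp: hom_vanishing_def)
qed

definition vanishing_ideal :: "(complex^'n) set set \<Rightarrow> (complex^'n \<Rightarrow> complex) set" where
  "vanishing_ideal X = {f. pfun f \<and> (\<forall>\<xi>\<in>acone X. f \<xi> = 0)}"

lemma pideal_vanishing_ideal: "pideal (vanishing_ideal X)"
proof -
  have "pfun (0 :: complex^'a \<Rightarrow> complex)" using pfun_const[of 0] by (simp add: zero_fun_def)
  then show ?thesis
    by (auto simp: pideal_def vanishing_ideal_def zero_fun_apply plus_fun_apply times_fun_apply intro: pfun_add pfun_mult)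
qed

lemma vanishing_ideal_zeros:
  assumes X: "zariski_closed X" and \<eta>: "\<And>f. f \<in> vanishing_ideal X \<Longrightarrow> f \<eta> = 0"
  shows "\<eta> \<in> acone X"
proof (cases "\<eta> = 0")
  case False
  then obtain j where j: "\<eta> $ j \<noteq> 0" by (metis vec_eq_iff zero_index)
  obtain F where F: "\<And>f. f \<in> F \<Longrightarrow> mpoly_homogeneous f" "X = zero_locus F" using X by (auto simp: zariski_closed_def)
  have "mpoly_eval f \<eta> = 0" if f: "f \<in> F" for f
  proof -
    have "mpoly_eval f \<xi> = 0" if "\<xi> \<in> acone X" "\<xi> \<noteq> 0" for \<xi>
    proof -
      have "vec.span {\<xi>} \<in> X" using that acone_iff[OF zariski_closed_proj[OF X]] by blast
      then have "\<forall>\<mu>\<in>vec.span {\<xi>}. mpoly_eval f \<mu> = 0" using f unfolding F(2) zero_locus_def by blast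
      then show ?thesis using in_span_self by blast
    qed
    \<comment> \<open>An equation may be a nonzero constant, which does not vanish at the vertex;
      the factor \<open>coord j\<close> repairs this and is nonzero at
      \<open>\<eta>\<close>.\<close>
    then have "(coord j * mpoly_eval f) \<xi> = 0" if "\<xi> \<in> acone X" for \<xi>
      using that by (cases "\<xi> = 0") (simp_all add: times_fun_apply)
    then have "coord j * mpoly_eval f \<in> vanishing_ideal X"
      unfolding vanishing_ideal_def using pfun_coord[OF pfun_mpoly_eval] by blast
    from \<eta>[OF this] show ?thesis using j by (simp add: times_fun_apply)
  qed
  then have "vec.span {\<eta>} \<in> X" unfolding F(2) using zero_locus_homogeneous[OF F(1) False] by blast
  then show ?thesis using in_span_self by (auto simp: acone_def)
qed (simp add: acone_def)

lemma pfun_line: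
  assumes "pfun f"
  shows "\<exists>p. \<forall>t. poly p t = f (\<xi> + t *s \<mu>)"
  using assms
proof (induction rule: pfun.induct)
  case (pfun_const c)
  show ?case by (rule exI[of _ "[:c:]"]) simp
next
  case (pfun_coord f i)
  then obtain p where "\<forall>t. poly p t = f (\<xi> + t *s \<mu>)" by blast
  then show ?case by (intro exI[of _ "[:\<xi> $ i, \<mu> $ i:] * p"]) (simp add: times_fun_apply algebra_simps)
next
  case (pfun_add f h)
  then obtain p q where "\<forall>t. poly p t = f (\<xi> + t *s \<mu>)" "\<forall>t. poly q t = h (\<xi> + t *s \<mu>)" by blast
  then show ?case by (intro exI[of _ "p + q"]) (simp add: plus_fun_apply)
qed

lemma cform_line: "cform w (\<xi> + t *s \<mu>) = cform w \<xi> + t * cform w \<mu>"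
  by (simp add: cform_eq distrib_left sum.distrib sum_distrib_left mult.left_commute)

lemma cform_zero [simp]: "cform w 0 = 0"
  by (simp add: cform_eq)

text \<open>The complexified annihilator, as an ideal of functions.\<close>

definition real_ideal :: "(nat \<Rightarrow> (real^'n \<Rightarrow> real^'m) set) \<Rightarrow> (complex^'n \<Rightarrow> complex) set" where
  "real_ideal g = {real_eval a + cfun \<i> * real_eval b | a b. a \<in> op_ideal g \<and> b \<in> op_ideal g}"

lemma pfun_real_decomp: "pfun f \<Longrightarrow> \<exists>A B. f = real_eval A + cfun \<i> * real_eval B"
proof (induction rule: pfun.induct)
  case (pfun_const c)
  show ?case
    by (rule exI[of _ "pconst (Re c)"], rule exI[of _ "pconst (Im c)"])
      (simp add: real_eval_pconst fun_eq_iff plus_fun_apply times_fun_apply complex_eq[symmetric])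
next
  case (pfun_coord f i)
  then obtain A B where AB: "f = real_eval A + cfun \<i> * real_eval B" by blast
  show ?case
    by (rule exI[of _ "pvar i * A"], rule exI[of _ "pvar i * B"])
      (simp add: AB real_eval_pvar_mult distrib_left mult.left_commute)
next
  case (pfun_add f h)
  then obtain A B A' B' where AB: "f = real_eval A + cfun \<i> * real_eval B" "h = real_eval A' + cfun \<i> * real_eval B'" by blast
  show ?case
    by (rule exI[of _ "A + A'"], rule exI[of _ "B + B'"])
      (simp add: AB real_eval_add distrib_left add_ac)
qed

lemma pideal_real_ideal:
  assumes sys: "symbolic_system g"
  shows "pideal (real_ideal g)"
  unfolding pideal_def
proof (intro conjI ballI allI impI)
  show "pfun f" if "f \<in> real_ideal g" for f
    using that by (auto simp: real_ideal_def intro!: pfun_add pfun_mult pfun_const pfun_real_eval)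
  show "0 \<in> real_ideal g" unfolding real_ideal_def
    by (intro CollectI exI[of _ 0]) (simp add: op_ideal_zero)
  show "f + h \<in> real_ideal g" if fh: "f \<in> real_ideal g" "h \<in> real_ideal g" for f h
  proof -
    obtain a b where 1: "f = real_eval a + cfun \<i> * real_eval b" "a \<in> op_ideal g" "b \<in> op_ideal g"
      using fh(1) by (auto simp: real_ideal_def)
    obtain a' b' where 2: "h = real_eval a' + cfun \<i> * real_eval b'" "a' \<in> op_ideal g" "b' \<in> op_ideal g"
      using fh(2) by (auto simp: real_ideal_def)
    have "f + h = real_eval (a + a') + cfun \<i> * real_eval (b + b')"
      unfolding 1 2 by (simp add: real_eval_add distrib_left add_ac)
    then show ?thesis unfolding real_ideal_def using op_ideal_add 1 2 by blast
  qed
  show "e * f \<in> real_ideal g" if e: "pfun e" and f: "f \<in> real_ideal g" for e f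
  proof -
    obtain A B where e: "e = real_eval A + cfun \<i> * real_eval B" using pfun_real_decomp[OF e] by blast
    obtain a b where 1: "f = real_eval a + cfun \<i> * real_eval b" "a \<in> op_ideal g" "b \<in> op_ideal g"
      using f by (auto simp: real_ideal_def)
    have "e * f = real_eval (A * a + (pconst (-1) * B) * b) + cfun \<i> * real_eval (A * b + B * a)"
      unfolding e 1 by (rule ext)
        (simp add: real_eval_add real_eval_mult real_eval_pconst plus_fun_apply times_fun_apply algebra_simps)
    moreover have "A * a + (pconst (-1) * B) * b \<in> op_ideal g" "A * b + B * a \<in> op_ideal g"
      by (intro op_ideal_add op_ideal_mult[OF sys] 1)+
    ultimately show ?thesis unfolding real_ideal_def by blast
  qed
qed

lemma op_ideal_homogeneous_components:
  assumes sys: "symbolic_system g" and a: "a \<in> op_ideal g"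
  obtains K G where "\<And>k. hom_poly k (G k)" "a = (\<Sum>k<K. G k)" "\<And>k. k < K \<Longrightarrow> G k \<in> op_ideal g"
proof -
  obtain K G where G: "\<And>k. hom_poly k (G k)" "a = (\<Sum>k<K. G k)" using homogeneous_decomp[of a] by blast
  moreover have "G k \<in> op_ideal g" if "k < K" for k
    by (rule op_ideal_component[OF sys G(1) _ that]) (use a G(2) in simp)
  ultimately show ?thesis using that by blast
qed

lemma real_eval_op_ideal_zero:
  assumes sys: "symbolic_system g" and a: "a \<in> op_ideal g" and hom: "\<And>k F. hom_poly k F \<Longrightarrow> F \<in> op_ideal g \<Longrightarrow> real_eval F \<xi> = 0"
  shows "real_eval a \<xi> = 0"
proof -
  obtain K G where G: "\<And>k. hom_poly k (G k)" "a = (\<Sum>k<K. G k)" "\<And>k. k < K \<Longrightarrow> G k \<in> op_ideal g"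
    using op_ideal_homogeneous_components[OF sys a] by blast
  have "real_eval (G k) \<xi> = 0" if "k < K" for k using hom[OF G(1) G(3)[OF that]] .
  then show ?thesis unfolding G(2) real_eval_sum sum_fun_apply by simp
qed

text \<open>\<open>zariski_closed\<close> asks for homogeneous equations; the annihilator is a
  homogeneous ideal, so its forms alone cut out the same set.\<close>

lemma char_variety_homogeneous:
  assumes sys: "symbolic_system g"
  shows "char_variety g = zero_locus (Poly_Mapping.map complex_of_real ` {a \<in> op_ideal g. \<exists>k. hom_poly k a})"
    (is "_ = zero_locus ?F")
proof
  show "char_variety g \<subseteq> zero_locus ?F"
    unfolding char_variety_def annihilator_eq_op_ideal[OF sys] by (auto simp: zero_locus_def)
  show "zero_locus ?F \<subseteq> char_variety g"
  proof
    fix L assume L: "L \<in> zero_locus ?F"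
    have "real_eval a \<xi> = 0" if a: "a \<in> op_ideal g" and \<xi>: "\<xi> \<in> L" for a \<xi>
    proof (rule real_eval_op_ideal_zero[OF sys a])
      fix k F assume "hom_poly k F" "F \<in> op_ideal g"
      then have "Poly_Mapping.map complex_of_real F \<in> ?F" by blast
      then show "real_eval F \<xi> = 0" using L \<xi> unfolding zero_locus_def real_eval_def by blast
    qed
    then show "L \<in> char_variety g"
      unfolding char_variety_def annihilator_eq_op_ideal[OF sys] zero_locus_def real_eval_def
      using L by (auto simp: zero_locus_def)
  qed
qed

lemma homogeneous_real_ideal:
  "f \<in> Poly_Mapping.map complex_of_real ` {a \<in> I. \<exists>k. hom_poly k a} \<Longrightarrow> mpoly_homogeneous f"
  using map_of_real_hom_poly mpoly_homogeneous_hfun by blast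

lemma zariski_closed_char_variety:
  assumes "symbolic_system g"
  shows "zariski_closed (char_variety g)"
  unfolding char_variety_homogeneous[OF assms] zariski_closed_def using homogeneous_real_ideal by blast

lemma real_ideal_vanishes:
  assumes sys: "symbolic_system g" and X: "X \<subseteq> char_variety g"
  shows "real_ideal g \<subseteq> vanishing_ideal X"
proof
  fix f assume f: "f \<in> real_ideal g"
  then obtain a b where ab: "f = real_eval a + cfun \<i> * real_eval b" "a \<in> op_ideal g" "b \<in> op_ideal g"
    by (auto simp: real_ideal_def)
  have "real_eval a \<xi> = 0" if a: "a \<in> op_ideal g" and \<xi>: "\<xi> \<in> acone X" for a \<xi>
  proof (cases "\<xi> \<in> \<Union>X")
    case True
    then show ?thesis using real_eval_char_variety[OF sys a] X by blast
  next
    case False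
    then have "\<xi> = 0" using \<xi> by (simp add: acone_def)
    show ?thesis unfolding \<open>\<xi> = 0\<close>
    \<comment> \<open>At the vertex only a component of degree 0 could survive, and the ideal
      contains no nonzero constant.\<close>
    proof (rule real_eval_op_ideal_zero[OF sys a])
      fix k F assume F: "hom_poly k F" "F \<in> op_ideal g"
      show "real_eval F 0 = 0"
      proof (cases k)
        case 0
        then obtain c where c: "F = pconst c" using F(1) hom_poly_0_pconst by blast
        then have "c = 0" using F(2) one_notin_op_ideal[OF sys] by blast
        then show ?thesis using c by (simp add: zero_fun_apply)
      next
        case (Suc l)
        then show ?thesis using hfun_scale[OF hfun_real_eval[OF F(1)], of 0 0] by simp
      qed
    qed
  qed
  then show "f \<in> vanishing_ideal X"
    unfolding vanishing_ideal_def using pidealD(1)[OF pideal_real_ideal[OF sys] f] ab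
    by (simp add: plus_fun_apply times_fun_apply)
qed

lemma real_ideal_zeros:
  assumes sys: "symbolic_system g" and \<eta>: "\<And>f. f \<in> real_ideal g \<Longrightarrow> f \<eta> = 0"
  shows "\<eta> \<in> acone (char_variety g)"
proof (cases "\<eta> = 0")
  case False
  have "real_eval a \<eta> = 0" if "a \<in> op_ideal g" for a
  proof -
    have "real_eval a + cfun \<i> * real_eval 0 \<in> real_ideal g" using that op_ideal_zero unfolding real_ideal_def by blast
    then show ?thesis using \<eta> by fastforce
  qed
  then have "vec.span {\<eta>} \<in> char_variety g"
    unfolding char_variety_homogeneous[OF sys]
    by (intro iffD2[OF zero_locus_homogeneous[OF homogeneous_real_ideal False]]) (auto simp: real_eval_def)
  then show ?thesis using in_span_self by (auto simp: acone_def)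
qed (simp add: acone_def)

text \<open>The outcome of Noether normalization: from degree \<open>E\<close> on all forms lie in
  Ann + (W), and S(W) meets Ann in 0. Orthonormality makes the points \<open>cvec (b j)\<close> dual
  to the forms \<open>cform (b i)\<close>.\<close>

locale normalized_system =
  fixes g :: "nat \<Rightarrow> (real^'n \<Rightarrow> real^'m) set" and W :: "(real^'n) set" and E :: nat
    and b :: "nat \<Rightarrow> real^'n" and r :: nat
  assumes sys: "symbolic_system g"
    and E: "\<And>k F. k \<ge> E \<Longrightarrow> hom_poly k F \<Longrightarrow> qideal (op_ideal g) W k F"
    and indep: "\<And>k F. swpoly W k F \<Longrightarrow> F \<in> op_ideal g \<Longrightarrow> F = 0"
    and bW: "\<And>i. i < r \<Longrightarrow> b i \<in> W"
    and orth: "\<And>i j. i < r \<Longrightarrow> j < r \<Longrightarrow> b i \<bullet> b j = (if i = j then 1 else 0)"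
begin

text \<open>Monomials of degree below \<open>E\<close> generate the polynomial functions over S(W)
  modulo the ideal.\<close>

definition gens :: "(complex^'n \<Rightarrow> complex) set" where
  "gens = (\<lambda>\<alpha> \<xi>. monom_eval \<xi> \<alpha>) ` {\<alpha>. mdeg \<alpha> < E}"

lemma finite_gens: "finite gens"
proof -
  have "{\<alpha>::'n \<Rightarrow>\<^sub>0 nat. mdeg \<alpha> < E} = (\<Union>k<E. {\<alpha>. mdeg \<alpha> = k})" by auto
  then show ?thesis unfolding gens_def by simp
qed

lemma pfun_gens: "\<gamma> \<in> gens \<Longrightarrow> pfun \<gamma>"
  unfolding gens_def using hfun_pfun[OF hfun_monom] by blast

abbreviation "M \<equiv> module_span (real_ideal g) gens {s. scfun W s}"

lemma M_add: "f \<in> M \<Longrightarrow> h \<in> M \<Longrightarrow> f + h \<in> M"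
  by (rule module_span_add[OF pideal_real_ideal[OF sys]]) (auto intro: scfun_add)

lemma M_mult: "scfun W s \<Longrightarrow> f \<in> M \<Longrightarrow> s * f \<in> M"
  by (rule module_span_mult[OF pideal_real_ideal[OF sys] scfun_pfun]) (auto intro: scfun_mult)

lemma M_base: "f \<in> real_ideal g \<Longrightarrow> f \<in> M"
proof -
  assume f: "f \<in> real_ideal g"
  have "f + (\<Sum>\<gamma>\<in>gens. 0 * \<gamma>) \<in> M" by (rule module_spanI) (use f scfun_zero in auto)
  then show ?thesis by simp
qed

lemma M_gens: "\<gamma> \<in> gens \<Longrightarrow> \<gamma> \<in> M"
proof -
  assume \<gamma>: "\<gamma> \<in> gens"
  have "0 + (\<Sum>\<delta>\<in>gens. (if \<delta> = \<gamma> then 1 else 0) * \<delta>) \<in> M"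
    by (rule module_spanI) (use pidealD(2)[OF pideal_real_ideal[OF sys]] scfun_zero scfun_one in auto)
  moreover have "(\<Sum>\<delta>\<in>gens. (if \<delta> = \<gamma> then 1 else 0) * \<delta>) = (\<Sum>\<delta>\<in>gens. if \<delta> = \<gamma> then \<gamma> else 0)"
    by (rule sum.cong) auto
  ultimately show ?thesis using \<gamma> finite_gens by simp
qed

lemma M_qideal:
  assumes "qideal (op_ideal g) W k F" "\<And>l G. l < k \<Longrightarrow> hom_poly l G \<Longrightarrow> real_eval G \<in> M"
  shows "real_eval F \<in> M"
  using assms
proof (induction rule: qideal.induct)
  case (qideal_base F k)
  have "real_eval F + cfun \<i> * real_eval 0 \<in> real_ideal g"
    unfolding real_ideal_def using qideal_base(1) op_ideal_zero by blast
  then show ?case using M_base by fastforce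
next
  case (qideal_lin w k G)
  have "real_eval G \<in> M" by (rule qideal_lin(3)[OF lessI qideal_lin(2)])
  moreover have "scfun W (cform w)" using scfun_lin[OF qideal_lin(1) scfun_one] by simp
  ultimately show ?case unfolding real_eval_mult cform_def[symmetric] by (intro M_mult)
next
  case (qideal_add k F G)
  then show ?case unfolding real_eval_add by (intro M_add) auto
qed

text \<open>From degree \<open>E\<close> on, a form is a sum of an element of Ann and multiples by
  elements of \<open>W\<close> of forms of lower degree, to which induction applies.\<close>

lemma M_hom: "hom_poly k F \<Longrightarrow> real_eval F \<in> M"
proof (induction k arbitrary: F rule: less_induct)
  case (less k)
  show ?case
  proof (cases "k \<ge> E")
    case True
    show ?thesis by (rule M_qideal[OF E[OF True less(2)] less(1)])
  next
    case False
    from less(2) show ?thesis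
    proof (induction rule: hom_poly_induct)
      case (single \<alpha> c)
      have "real_eval (Poly_Mapping.single \<alpha> c) = cfun (complex_of_real c) * (\<lambda>\<xi>. monom_eval \<xi> \<alpha>)"
        by (simp add: fun_eq_iff real_eval_single times_fun_apply)
      moreover have "(\<lambda>\<xi>. monom_eval \<xi> \<alpha>) \<in> gens" using single False by (auto simp: gens_def)
      ultimately show ?case using M_mult[OF scfun_const M_gens] by simp
    next
      case zero
      show ?case using M_base[OF pidealD(2)[OF pideal_real_ideal[OF sys]]] by simp
    next
      case (add F G)
      then show ?case unfolding real_eval_add by (intro M_add)
    qed
  qed
qed

lemma M_all: "{f. pfun f} \<subseteq> M"
proof
  fix f :: "complex^'n \<Rightarrow> complex" assume "f \<in> {f. pfun f}"
  then have "pfun f" by simp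
  from pfun_real_decomp[OF this] obtain A B where AB: "f = real_eval A + cfun \<i> * real_eval B" by blast
  have "real_eval A \<in> M" for A
  proof -
    obtain K G where G: "\<And>k. hom_poly k (G k)" "A = (\<Sum>k<K. G k)" using homogeneous_decomp[of A] by blast
    have "real_eval (\<Sum>k<L. G k) \<in> M" for L
    proof (induction L)
      case 0
      show ?case using M_base[OF pidealD(2)[OF pideal_real_ideal[OF sys]]] by simp
    next
      case (Suc L)
      then show ?case using M_hom[OF G(1)] by (simp add: real_eval_add M_add)
    qed
    then show ?thesis using G(2) by simp
  qed
  then show "f \<in> M" unfolding AB by (intro M_add M_mult scfun_const)
qed

text \<open>\<open>indep\<close> speaks of real homogeneous elements of S(W), so a complex function
  is split into real and imaginary parts and into degrees. Vanishing from \<open>K\<close> on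
  permits padding when two functions are added.\<close>

lemma scfun_real_decomp:
  "scfun W s \<Longrightarrow> \<exists>K P Q. (\<forall>k. swpoly W k (P k)) \<and> (\<forall>k. swpoly W k (Q k)) \<and> (\<forall>k\<ge>K. P k = 0 \<and> Q k = 0) \<and>
    s = real_eval (\<Sum>k<K. P k) + cfun \<i> * real_eval (\<Sum>k<K. Q k)"
proof (induction rule: scfun.induct)
  case (scfun_const c)
  show ?case
    by (rule exI[of _ "1"], rule exI[of _ "\<lambda>k. if k = 0 then pconst (Re c) else 0"], rule exI[of _ "\<lambda>k. if k = 0 then pconst (Im c) else 0"])
      (simp add: swpoly_const swpoly_zero real_eval_pconst fun_eq_iff plus_fun_apply times_fun_apply complex_eq[symmetric])
next
  case (scfun_lin w s)
  then obtain K P Q where PQ: "\<forall>k. swpoly W k (P k)" "\<forall>k. swpoly W k (Q k)" "\<forall>k\<ge>K. P k = 0 \<and> Q k = 0"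
    "s = real_eval (\<Sum>k<K. P k) + cfun \<i> * real_eval (\<Sum>k<K. Q k)" by blast
  let ?sh = "\<lambda>P k. case k of 0 \<Rightarrow> 0 | Suc k \<Rightarrow> linp w * P k"
  have sh: "(\<Sum>k<Suc K. ?sh P k) = linp w * (\<Sum>k<K. P k)" for P :: "nat \<Rightarrow> ('n \<Rightarrow>\<^sub>0 nat) \<Rightarrow>\<^sub>0 real"
    by (subst sum.lessThan_Suc_shift) (simp add: sum_distrib_left)
  show ?case
  proof (rule exI[of _ "Suc K"], rule exI[of _ "?sh P"], rule exI[of _ "?sh Q"], intro conjI allI impI)
    show "swpoly W k (?sh P k)" "swpoly W k (?sh Q k)" for k
      using PQ(1,2) by (auto split: nat.split intro: swpoly_zero swpoly_lin[OF scfun_lin(1)])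
    show "?sh P k = 0" "?sh Q k = 0" if "k \<ge> Suc K" for k using that PQ(3) by (auto split: nat.split)
    show "cform w * s = real_eval (\<Sum>k<Suc K. ?sh P k) + cfun \<i> * real_eval (\<Sum>k<Suc K. ?sh Q k)"
      unfolding sh PQ(4) real_eval_mult cform_def by (simp add: distrib_left mult.left_commute)
  qed
next
  case (scfun_add s t)
  obtain K P Q where PQ: "\<forall>k. swpoly W k (P k)" "\<forall>k. swpoly W k (Q k)" "\<forall>k\<ge>K. P k = 0 \<and> Q k = 0"
    "s = real_eval (\<Sum>k<K. P k) + cfun \<i> * real_eval (\<Sum>k<K. Q k)" using scfun_add by blast
  obtain L R S where RS: "\<forall>k. swpoly W k (R k)" "\<forall>k. swpoly W k (S k)" "\<forall>k\<ge>L. R k = 0 \<and> S k = 0"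
    "t = real_eval (\<Sum>k<L. R k) + cfun \<i> * real_eval (\<Sum>k<L. S k)" using scfun_add by blast
  have ext: "(\<Sum>k<K. P k) = (\<Sum>k<max K L. P k)" "(\<Sum>k<K. Q k) = (\<Sum>k<max K L. Q k)"
      "(\<Sum>k<L. R k) = (\<Sum>k<max K L. R k)" "(\<Sum>k<L. S k) = (\<Sum>k<max K L. S k)"
    by (rule sum.mono_neutral_left; use PQ(3) RS(3) in auto)+
  show ?case
  proof (rule exI[of _ "max K L"], rule exI[of _ "\<lambda>k. P k + R k"], rule exI[of _ "\<lambda>k. Q k + S k"], intro conjI allI impI)
    show "swpoly W k (P k + R k)" "swpoly W k (Q k + S k)" for k
      using PQ(1,2) RS(1,2) by (auto intro: swpoly_add)
    show "P k + R k = 0" "Q k + S k = 0" if "k \<ge> max K L" for k using that PQ(3) RS(3) by auto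
    show "s + t = real_eval (\<Sum>k<max K L. P k + R k) + cfun \<i> * real_eval (\<Sum>k<max K L. Q k + S k)"
      unfolding PQ(4) RS(4) ext sum.distrib real_eval_add by (simp add: distrib_left add_ac)
  qed
qed

lemma swpoly_sum_op_ideal:
  assumes "\<forall>k. swpoly W k (P k)" "(\<Sum>k<K. P k) \<in> op_ideal g"
  shows "(\<Sum>k<K. P k) = 0"
proof (rule sum.neutral, rule ballI)
  fix k assume k: "k \<in> {..<K}"
  have "P k \<in> op_ideal g"
    by (rule op_ideal_component[OF sys _ assms(2)]) (use assms(1) swpoly_hom k in auto)
  then show "P k = 0" using indep assms(1) by blast
qed

text \<open>At real points the real and imaginary parts separate, and values at real points
  determine a real polynomial; both parts of \<open>s\<close> thus lie in S(W) and in the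
  annihilator.\<close>

lemma scfun_real_ideal:
  assumes s: "scfun W s" "s \<in> real_ideal g"
  shows "s = 0"
proof -
  obtain K P Q where PQ: "\<forall>k. swpoly W k (P k)" "\<forall>k. swpoly W k (Q k)"
    "s = real_eval (\<Sum>k<K. P k) + cfun \<i> * real_eval (\<Sum>k<K. Q k)" using scfun_real_decomp[OF s(1)] by blast
  obtain a c where ac: "s = real_eval a + cfun \<i> * real_eval c" "a \<in> op_ideal g" "c \<in> op_ideal g"
    using s(2) by (auto simp: real_ideal_def)
  have "reval (\<Sum>k<K. P k) x = reval a x \<and> reval (\<Sum>k<K. Q k) x = reval c x" for x
  proof -
    have "complex_of_real (reval (\<Sum>k<K. P k) x) + \<i> * complex_of_real (reval (\<Sum>k<K. Q k) x)
      = complex_of_real (reval a x) + \<i> * complex_of_real (reval c x)"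
      using fun_cong[OF trans[OF PQ(3)[symmetric] ac(1)], of "cvec x"] by (simp add: plus_fun_apply times_fun_apply real_eval_cvec)
    then show ?thesis by (simp add: complex_eq_iff)
  qed
  then have eq: "reval (\<Sum>k<K. P k) x = reval a x" "reval (\<Sum>k<K. Q k) x = reval c x" for x by blast+
  have inj: "F = G" if "\<And>x. reval F x = reval G x" for F G :: "('n \<Rightarrow>\<^sub>0 nat) \<Rightarrow>\<^sub>0 real"
  proof -
    have "reval (F + pconst (-1) * G) x = 0" for x using that by (simp add: reval_add reval_mult del: pconst_one)
    then have "F + pconst (-1) * G = 0" by (rule reval_eq_0)
    then show ?thesis by (simp add: pconst_uminus)
  qed
  have "(\<Sum>k<K. P k) = a" "(\<Sum>k<K. Q k) = c" using inj eq by blast+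
  then have "(\<Sum>k<K. P k) = 0" "(\<Sum>k<K. Q k) = 0"
    using swpoly_sum_op_ideal PQ(1,2) ac(2,3) by metis+
  then show ?thesis using PQ(3) by simp
qed

section \<open>The flag and the sets over it\<close>

text \<open>The pullback of a linear subspace of the dual of W, of dimension \<open>i\<close> when
  \<open>b\<close> is a basis of \<open>W\<close>; \<open>flag r\<close> is the whole space.\<close>

definition flag :: "nat \<Rightarrow> (complex^'n) set" where
  "flag i = {\<xi>. \<forall>t. i \<le> t \<and> t < r \<longrightarrow> cform (b t) \<xi> = 0}"

definition covers :: "(complex^'n) set set \<Rightarrow> nat \<Rightarrow> bool" where
  "covers X i \<longleftrightarrow> (\<forall>\<xi>\<in>flag i. \<exists>\<eta>\<in>acone X. fibre_eq W \<eta> \<xi>)"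

lemma flag_mono: "i \<le> j \<Longrightarrow> flag i \<subseteq> flag j"
  by (auto simp: flag_def)

lemma flag_fibre_eq: "\<xi> \<in> flag i \<Longrightarrow> fibre_eq W \<eta> \<xi> \<Longrightarrow> \<eta> \<in> flag i"
  using bW by (auto simp: flag_def fibre_eq_def)

lemma flag_line: "\<xi> \<in> flag i \<Longrightarrow> \<mu> \<in> flag i \<Longrightarrow> \<xi> + t *s (\<mu> - \<xi>) \<in> flag i"
proof -
  assume "\<xi> \<in> flag i" "\<mu> \<in> flag i"
  moreover have "cform w (\<mu> - \<xi>) = cform w \<mu> - cform w \<xi>" for w
    using cform_line[of w \<mu> "-1" \<xi>] by simp
  ultimately show ?thesis by (simp only: flag_def mem_Collect_eq cform_line) simp
qed

lemma covers_char_variety: "covers (char_variety g) r"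
  unfolding covers_def
proof
  fix \<xi>
  have "\<exists>\<eta>. fibre_eq W \<eta> \<xi> \<and> (\<forall>f\<in>real_ideal g. f \<eta> = 0)"
  proof (rule lying_over[OF finite_gens pideal_real_ideal[OF sys] M_all pfun_gens])
    fix s assume "scfun W s" "s \<in> real_ideal g"
    then have "s = 0" by (rule scfun_real_ideal)
    then show "s \<xi> = 0" by (simp add: zero_fun_apply)
  qed
  then show "\<exists>\<eta>\<in>acone (char_variety g). fibre_eq W \<eta> \<xi>" using real_ideal_zeros[OF sys] by blast
qed

text \<open>Lying over for the vanishing ideal of \<open>X\<close>, read backwards: a point that is
  missed is separated from the projection of \<open>X\<close> by a function from S(W).\<close>

lemma not_covers_scfun:
  assumes X: "zariski_closed X" "X \<subseteq> char_variety g" "\<not> covers X i"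
  shows "\<exists>s \<xi>. scfun W s \<and> \<xi> \<in> flag i \<and> s \<xi> \<noteq> 0 \<and> (\<forall>\<eta>\<in>acone X. s \<eta> = 0)"
proof -
  obtain \<xi> where \<xi>: "\<xi> \<in> flag i" "\<And>\<eta>. \<eta> \<in> acone X \<Longrightarrow> \<not> fibre_eq W \<eta> \<xi>"
    using X(3) unfolding covers_def by blast
  have gen: "{f. pfun f} \<subseteq> module_span (vanishing_ideal X) gens {s. scfun W s}"
    using M_all module_span_mono[OF real_ideal_vanishes[OF sys X(2)]] by blast
  have "\<not> (\<exists>\<eta>. fibre_eq W \<eta> \<xi> \<and> (\<forall>f\<in>vanishing_ideal X. f \<eta> = 0))"
    using \<xi>(2) vanishing_ideal_zeros[OF X(1)] by blast
  then have "\<exists>s. scfun W s \<and> s \<in> vanishing_ideal X \<and> s \<xi> \<noteq> 0"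
    using lying_over[OF finite_gens pideal_vanishing_ideal gen pfun_gens, of \<xi>] by blast
  then show ?thesis using \<xi>(1) unfolding vanishing_ideal_def by blast
qed

lemma finite_fibre_acone:
  assumes "X \<subseteq> char_variety g"
  shows "finite {\<eta> \<in> acone X. fibre_eq W \<eta> \<xi>}"
proof (rule finite_subset)
  show "{\<eta> \<in> acone X. fibre_eq W \<eta> \<xi>} \<subseteq> {\<eta>. fibre_eq W \<eta> \<xi> \<and> (\<forall>f\<in>real_ideal g. f \<eta> = 0)}"
    using real_ideal_vanishes[OF sys assms] unfolding vanishing_ideal_def by blast
  show "finite {\<eta>. fibre_eq W \<eta> \<xi> \<and> (\<forall>f\<in>real_ideal g. f \<eta> = 0)}"
    by (rule finite_fibre[OF finite_gens pideal_real_ideal[OF sys] M_all])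
qed

definition lifts :: "(complex^'n) set set \<Rightarrow> nat \<Rightarrow> (complex^'n) set set set" where
  "lifts Z i = {X. zariski_closed X \<and> X \<subseteq> Z \<and> acone X \<subseteq> flag i \<and> covers X i}"

text \<open>Fibres are finite, so along a chain of lifts they stabilize and the intersection is still a lift.\<close>

lemma lifts_Inter:
  assumes Z: "Z \<subseteq> char_variety g" and D: "D \<noteq> {}" "D \<subseteq> lifts Z i"
    and chain: "\<And>X Y. X \<in> D \<Longrightarrow> Y \<in> D \<Longrightarrow> X \<subseteq> Y \<or> Y \<subseteq> X"
  shows "\<Inter>D \<in> lifts Z i"
proof -
  have D': "zariski_closed X" "X \<subseteq> Z" "acone X \<subseteq> flag i" "covers X i" if "X \<in> D" for X
    using D(2) that by (auto simp: lifts_def)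
  obtain X0 where X0: "X0 \<in> D" using D(1) by blast
  have closed: "zariski_closed (\<Inter>D)" by (rule zariski_closed_Inter[OF D(1) D'(1)])
  have "covers (\<Inter>D) i" unfolding covers_def
  proof
    fix \<xi> assume \<xi>: "\<xi> \<in> flag i"
    define S where "S X = {\<eta> \<in> acone X. fibre_eq W \<eta> \<xi>}" for X
    have fin: "finite (S X)" if "X \<in> D" for X
      unfolding S_def using finite_fibre_acone D'(2)[OF that] Z by blast
    obtain X where X: "X \<in> D" "\<And>Y. Y \<in> D \<Longrightarrow> card (S X) \<le> card (S Y)"
      using ex_has_least_nat[of "\<lambda>X. X \<in> D" X0 "\<lambda>X. card (S X)"] X0 by blast
    have sub: "S X \<subseteq> S Y" if Y: "Y \<in> D" for Y
    proof (cases "X \<subseteq> Y")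
      case True
      then show ?thesis using acone_mono[OF True] by (auto simp: S_def)
    next
      case False
      then have "Y \<subseteq> X" using chain[OF X(1) Y] by blast
      then have "S Y \<subseteq> S X" using acone_mono by (auto simp: S_def)
      then have "S Y = S X" using card_seteq[OF fin[OF X(1)]] X(2)[OF Y] by blast
      then show ?thesis by simp
    qed
    obtain \<eta> where \<eta>: "\<eta> \<in> S X" using D'(4)[OF X(1)] \<xi> unfolding covers_def S_def by blast
    have "\<eta> = 0 \<or> vec.span {\<eta>} \<in> Y" if "Y \<in> D" for Y
      using sub[OF that] \<eta> acone_iff[OF zariski_closed_proj[OF D'(1)[OF that]]] unfolding S_def by blast
    then have "\<eta> \<in> acone (\<Inter>D)" unfolding acone_iff[OF zariski_closed_proj[OF closed]] by blast
    then show "\<exists>\<eta>\<in>acone (\<Inter>D). fibre_eq W \<eta> \<xi>" using \<eta> unfolding S_def by blast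
  qed
  moreover have "\<Inter>D \<subseteq> Z" using X0 D'(2) by blast
  moreover have "acone (\<Inter>D) \<subseteq> flag i" using acone_mono[of "\<Inter>D" X0] X0 D'(3)[OF X0] by blast
  ultimately show ?thesis using closed by (simp add: lifts_def)
qed

text \<open>Cut \<open>Z\<close> with the linear equations of \<open>flag i\<close>. They come from
  \<open>W\<close>, so every point over \<open>flag i\<close> satisfies them.\<close>

lemma lifts_nonempty:
  assumes Z: "zariski_closed Z" "covers Z j" and i: "i \<le> j"
  shows "lifts Z i \<noteq> {}"
proof -
  obtain F where F: "\<And>f. f \<in> F \<Longrightarrow> mpoly_homogeneous f" "Z = zero_locus F" using Z(1) by (auto simp: zariski_closed_def)
  define lf where "lf t = Poly_Mapping.map complex_of_real (linp (b t))" for t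
  let ?F = "F \<union> lf ` {i..<r}"
  have lf: "mpoly_eval (lf t) = cform (b t)" for t by (simp add: lf_def cform_def real_eval_def)
  have hom: "mpoly_homogeneous f" if "f \<in> ?F" for f
  proof -
    have "mpoly_homogeneous (lf t)" for t
      unfolding lf_def mpoly_homogeneous_hfun using map_of_real_hom_poly[OF hom_poly_linp] by blast
    then show ?thesis using that F(1) by blast
  qed
  let ?Z = "zero_locus ?F"
  have cl: "zariski_closed ?Z" unfolding zariski_closed_def using hom by blast
  have sub: "?Z \<subseteq> Z" unfolding F(2) by (auto simp: zero_locus_def)
  have "acone ?Z \<subseteq> flag i"
  proof
    fix \<eta> assume \<eta>: "\<eta> \<in> acone ?Z"
    show "\<eta> \<in> flag i"
    proof (cases "\<eta> = 0")
      case True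
      then show ?thesis by (simp add: flag_def)
    next
      case False
      then have "\<forall>f\<in>?F. mpoly_eval f \<eta> = 0"
        using \<eta> zero_locus_homogeneous[OF hom False] acone_iff[OF zariski_closed_proj[OF cl]] by blast
      then have "mpoly_eval (lf t) \<eta> = 0" if "i \<le> t" "t < r" for t using that by simp
      then show ?thesis by (simp add: flag_def lf)
    qed
  qed
  moreover have "covers ?Z i" unfolding covers_def
  proof
    fix \<xi> assume \<xi>: "\<xi> \<in> flag i"
    then have "\<xi> \<in> flag j" using flag_mono[OF i] by blast
    then obtain \<eta> where \<eta>: "\<eta> \<in> acone Z" "fibre_eq W \<eta> \<xi>" using Z(2) unfolding covers_def by blast
    have \<eta>f: "\<eta> \<in> flag i" using flag_fibre_eq[OF \<xi> \<eta>(2)] .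
    have "\<eta> \<in> acone ?Z"
    proof (cases "\<eta> = 0")
      case False
      then have "vec.span {\<eta>} \<in> zero_locus F" using \<eta>(1) acone_iff[OF zariski_closed_proj[OF Z(1)]] F(2) by blast
      then have "\<forall>f\<in>F. mpoly_eval f \<eta> = 0" using zero_locus_homogeneous[OF F(1) False] by blast
      moreover have "\<forall>t\<in>{i..<r}. mpoly_eval (lf t) \<eta> = 0" using \<eta>f by (simp add: flag_def lf)
      ultimately have "vec.span {\<eta>} \<in> ?Z" using zero_locus_homogeneous[OF hom False] by blast
      then show ?thesis using acone_iff[OF zariski_closed_proj[OF cl]] by blast
    qed (simp add: acone_def)
    then show "\<exists>\<eta>\<in>acone ?Z. fibre_eq W \<eta> \<xi>" using \<eta>(2) by blast
  qed
  ultimately have "?Z \<in> lifts Z i" using cl sub by (simp add: lifts_def)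
  then show ?thesis by blast
qed

lemma minimal_lift_exists:
  assumes Z: "zariski_closed Z" "Z \<subseteq> char_variety g" "covers Z j" and i: "i \<le> j"
  obtains X where "X \<in> lifts Z i" "\<And>Y. Y \<in> lifts Z i \<Longrightarrow> Y \<subseteq> X \<Longrightarrow> Y = X"
proof -
  \<comment> \<open>Complements turn the maximal element of Zorn's lemma into a minimal
    lift.\<close>
  have "\<exists>M\<in>uminus ` lifts Z i. \<forall>X\<in>uminus ` lifts Z i. M \<subseteq> X \<longrightarrow> X = M"
  proof (rule subset_Zorn_nonempty)
    show "uminus ` lifts Z i \<noteq> {}" using lifts_nonempty[OF Z(1,3) i] by simp
    fix C assume C: "C \<noteq> {}" "subset.chain (uminus ` lifts Z i) C"
    then have CA: "C \<subseteq> uminus ` lifts Z i" and ch: "\<And>X Y. X \<in> C \<Longrightarrow> Y \<in> C \<Longrightarrow> X \<subseteq> Y \<or> Y \<subseteq> X"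
      unfolding subset_chain_def by auto
    have "\<Inter>(uminus ` C) \<in> lifts Z i"
    proof (rule lifts_Inter[OF Z(2)])
      show "uminus ` C \<noteq> {}" using C(1) by simp
      show "uminus ` C \<subseteq> lifts Z i" using CA by auto
      fix X Y assume "X \<in> uminus ` C" "Y \<in> uminus ` C"
      then obtain X' Y' where "X' \<in> C" "Y' \<in> C" "X = - X'" "Y = - Y'" by blast
      then show "X \<subseteq> Y \<or> Y \<subseteq> X" using ch[of X' Y'] by blast
    qed
    then have "- \<Inter>(uminus ` C) \<in> uminus ` lifts Z i" by (rule imageI)
    moreover have "- \<Inter>(uminus ` C) = \<Union>C" by auto
    ultimately show "\<Union>C \<in> uminus ` lifts Z i" by simp
  qed
  then obtain X where X: "X \<in> lifts Z i" "\<forall>Y\<in>uminus ` lifts Z i. - X \<subseteq> Y \<longrightarrow> Y = - X" by (elim bexE imageE) simp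
  show ?thesis
  proof (rule that[OF X(1)])
    fix Y assume Y: "Y \<in> lifts Z i" "Y \<subseteq> X"
    then have "- Y \<in> uminus ` lifts Z i" "- X \<subseteq> - Y" by auto
    then have "- Y = - X" using X(2) by blast
    then show "Y = X" by simp
  qed
qed

text \<open>If both fail, two functions from S(W) are nonzero somewhere on \<open>flag i\<close>
  while their product vanishes on it. On the line joining the two points this is a product of
  nonzero polynomials in one variable that vanishes identically.\<close>

lemma covers_union:
  assumes A: "zariski_closed A" "A \<subseteq> char_variety g" and B: "zariski_closed B" "B \<subseteq> char_variety g"
    and cov: "covers (A \<union> B) i"
  shows "covers A i \<or> covers B i"
proof (rule ccontr)
  assume "\<not> ?thesis"
  then obtain s1 \<xi>1 s2 \<xi>2 where s1: "scfun W s1" "\<xi>1 \<in> flag i" "s1 \<xi>1 \<noteq> 0" "\<forall>\<eta>\<in>acone A. s1 \<eta> = 0"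
    and s2: "scfun W s2" "\<xi>2 \<in> flag i" "s2 \<xi>2 \<noteq> 0" "\<forall>\<eta>\<in>acone B. s2 \<eta> = 0"
    using not_covers_scfun[OF A] not_covers_scfun[OF B] by blast
  have z: "s1 \<xi> * s2 \<xi> = 0" if \<xi>: "\<xi> \<in> flag i" for \<xi>
  proof -
    obtain \<eta> where \<eta>: "\<eta> \<in> acone A \<union> acone B" "fibre_eq W \<eta> \<xi>"
      using cov \<xi> unfolding covers_def acone_Un by blast
    then have "s1 \<eta> * s2 \<eta> = 0" using s1(4) s2(4) by auto
    then show ?thesis using scfun_fibre_eq[OF s1(1) \<eta>(2)] scfun_fibre_eq[OF s2(1) \<eta>(2)] by simp
  qed
  obtain p1 where p1: "\<And>t. poly p1 t = s1 (\<xi>1 + t *s (\<xi>2 - \<xi>1))" using pfun_line[OF scfun_pfun[OF s1(1)]] by blast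
  obtain p2 where p2: "\<And>t. poly p2 t = s2 (\<xi>1 + t *s (\<xi>2 - \<xi>1))" using pfun_line[OF scfun_pfun[OF s2(1)]] by blast
  have "poly (p1 * p2) t = 0" for t
    using z[OF flag_line[OF s1(2) s2(2)], of t] by (simp add: p1 p2)
  then have "p1 * p2 = 0" using poly_all_0_iff_0 by blast
  then have "p1 = 0 \<or> p2 = 0" by simp
  moreover have "poly p1 0 \<noteq> 0" unfolding p1 using s1(3) by simp
  moreover have "poly p2 1 \<noteq> 0" unfolding p2 using s2(3) by simp
  ultimately show False by auto
qed

lemma cform_basis: "i < r \<Longrightarrow> j < r \<Longrightarrow> cform (b i) (cvec (b j)) = (if i = j then 1 else 0)"
  by (simp add: cform_cvec orth)

text \<open>Take a minimal lift. If it is a union of two closed sets, one of them already covers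
  \<open>flag i\<close> and equals it by minimality.\<close>

lemma irreducible_lift:
  assumes Z: "zariski_closed Z" "Z \<subseteq> char_variety g" "covers Z j" and i: "1 \<le> i" "i \<le> j" "i \<le> r"
  obtains X where "irreducible_closed X" "X \<subseteq> Z" "acone X \<subseteq> flag i" "covers X i"
proof -
  obtain X where X: "X \<in> lifts Z i" "\<And>Y. Y \<in> lifts Z i \<Longrightarrow> Y \<subseteq> X \<Longrightarrow> Y = X"
    using minimal_lift_exists[OF Z i(2)] by blast
  have X': "zariski_closed X" "X \<subseteq> Z" "acone X \<subseteq> flag i" "covers X i" using X(1) by (auto simp: lifts_def)
  have "irreducible_closed X" unfolding irreducible_closed_def
  proof (intro conjI allI impI)
    show "zariski_closed X" by fact
    \<comment> \<open>The assumption \<open>1 \<le> i\<close> puts a point with nonzero projection,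
      dual to \<open>b 0\<close>, into \<open>flag i\<close>.\<close>
    show "X \<noteq> {}"
    proof
      assume "X = {}"
      then have 0: "acone X = {0}" by (simp add: acone_def)
      have "cvec (b 0) \<in> flag i" using i by (auto simp: flag_def cform_basis)
      then have "fibre_eq W 0 (cvec (b 0))" using X'(4) 0 unfolding covers_def by auto
      then have "cform (b 0) 0 = cform (b 0) (cvec (b 0))" using bW i unfolding fibre_eq_def by auto
      then show False using i cform_basis[of 0 0] by simp
    qed
    fix A B assume AB: "zariski_closed A \<and> zariski_closed B \<and> X = A \<union> B"
    then have sub: "A \<subseteq> X" "B \<subseteq> X" by auto
    have "covers A i \<or> covers B i"
      by (rule covers_union) (use AB X'(4) sub X'(2) Z(2) in auto)
    moreover have "Y = X" if "zariski_closed Y" "Y \<subseteq> X" "covers Y i" for Y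
      using X(2)[of Y] that X'(2,3) acone_mono[OF that(2)] by (auto simp: lifts_def)
    ultimately show "X = A \<or> X = B" using AB sub by blast
  qed
  then show ?thesis using that X' by blast
qed

text \<open>The point dual to \<open>b i\<close> lies in \<open>flag (Suc i)\<close>, but no point
  over it lies in \<open>flag i\<close>.\<close>

lemma flag_strict:
  assumes "acone X \<subseteq> flag i" "covers Y (Suc i)" "i < r"
  shows "X \<noteq> Y"
proof
  assume "X = Y"
  have "cvec (b i) \<in> flag (Suc i)" using assms(3) by (auto simp: flag_def cform_basis)
  then obtain \<eta> where \<eta>: "\<eta> \<in> acone Y" "fibre_eq W \<eta> (cvec (b i))" using assms(2) unfolding covers_def by blast
  then have "cform (b i) \<eta> = 1" using bW[OF assms(3)] cform_basis[OF assms(3,3)] by (simp add: fibre_eq_def)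
  moreover have "cform (b i) \<eta> = 0" using \<eta>(1) assms(1,3) \<open>X = Y\<close> by (auto simp: flag_def)
  ultimately show False by simp
qed

text \<open>Lifts are built downward from \<open>flag r\<close>, each inside the previous one. The
  condition \<open>k < r\<close> stops at \<open>flag 1\<close>, whose lift is still
  nonempty.\<close>

lemma flag_chain:
  assumes "k < r"
  shows "\<exists>D. (\<forall>t. r - k \<le> t \<and> t \<le> r \<longrightarrow> irreducible_closed (D t) \<and> D t \<subseteq> char_variety g \<and> acone (D t) \<subseteq> flag t \<and> covers (D t) t) \<and>
    (\<forall>t. r - k \<le> t \<and> t < r \<longrightarrow> D t \<subset> D (Suc t))"
  using assms
proof (induction k)
  case 0
  then obtain X where X: "irreducible_closed X" "X \<subseteq> char_variety g" "acone X \<subseteq> flag r" "covers X r"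
    using irreducible_lift[OF zariski_closed_char_variety[OF sys] order_refl covers_char_variety, of r] by auto
  show ?case
  proof (intro exI[of _ "\<lambda>_. X"] conjI allI impI)
    fix t assume "r - 0 \<le> t \<and> t \<le> r"
    then have "t = r" by simp
    then show "irreducible_closed X" "X \<subseteq> char_variety g" "acone X \<subseteq> flag t" "covers X t" using X by simp_all
  qed auto
next
  case (Suc k)
  then obtain D where D: "\<And>t. r - k \<le> t \<and> t \<le> r \<Longrightarrow> irreducible_closed (D t) \<and> D t \<subseteq> char_variety g \<and> acone (D t) \<subseteq> flag t \<and> covers (D t) t"
    "\<And>t. r - k \<le> t \<and> t < r \<Longrightarrow> D t \<subset> D (Suc t)" by (metis Suc_lessD)
  let ?i = "r - Suc k"
  have i: "Suc ?i = r - k" "1 \<le> ?i" "?i < r" using Suc.prems by auto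
  have Di: "irreducible_closed (D (r - k))" "D (r - k) \<subseteq> char_variety g" "covers (D (r - k)) (r - k)" using D(1)[of "r - k"] by auto
  have cl: "zariski_closed (D (r - k))" using Di(1) by (simp add: irreducible_closed_def)
  obtain X where X: "irreducible_closed X" "X \<subseteq> D (r - k)" "acone X \<subseteq> flag ?i" "covers X ?i"
    using irreducible_lift[OF cl Di(2,3), of ?i] i by auto
  have ne: "X \<noteq> D (r - k)" using flag_strict[OF X(3), of "D (r - k)"] Di(3) i by simp
  let ?D = "\<lambda>t. if t = ?i then X else D t"
  show ?case
  proof (intro exI[of _ ?D] conjI allI impI)
    fix t assume t: "r - Suc k \<le> t \<and> t \<le> r"
    have "t = ?i \<or> (r - k \<le> t \<and> t \<le> r \<and> t \<noteq> ?i)" using t i by linarith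
    then have "irreducible_closed (?D t) \<and> ?D t \<subseteq> char_variety g \<and> acone (?D t) \<subseteq> flag t \<and> covers (?D t) t"
      using X Di(2) D(1)[of t] by auto
    then show "irreducible_closed (?D t)" "?D t \<subseteq> char_variety g" "acone (?D t) \<subseteq> flag t" "covers (?D t) t" by auto
  next
    fix t assume t: "r - Suc k \<le> t \<and> t < r"
    show "?D t \<subset> ?D (Suc t)"
    proof (cases "t = ?i")
      case True
      then show ?thesis using X(2) ne i by auto
    next
      case False
      then have "r - k \<le> t" using t i by linarith
      moreover have "Suc t \<noteq> ?i" using t by linarith
      ultimately show ?thesis using False D(2)[of t] t by simp
    qed
  qed
qed

lemma char_variety_chain:
  assumes "1 \<le> r"
  obtains C where "\<forall>i\<le>r - 1. irreducible_closed (C i) \<and> C i \<subseteq> char_variety g" "\<forall>i<r - 1. C i \<subset> C (Suc i)"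
proof -
  obtain D where D: "\<forall>t. 1 \<le> t \<and> t \<le> r \<longrightarrow> irreducible_closed (D t) \<and> D t \<subseteq> char_variety g \<and> acone (D t) \<subseteq> flag t \<and> covers (D t) t"
    "\<forall>t. 1 \<le> t \<and> t < r \<longrightarrow> D t \<subset> D (Suc t)"
    using flag_chain[of "r - 1"] assms by auto
  show ?thesis by (rule that[of "\<lambda>i. D (Suc i)"]) (use D assms in auto)
qed

end

section \<open>The functional dimension is the dimension of the characteristic variety plus one\<close>

lemma long_chain_exists:
  fixes g :: "nat \<Rightarrow> (real^'n \<Rightarrow> real^'m) set"
  assumes sys: "symbolic_system g" and van: "\<And>i j. i \<ge> 1 \<Longrightarrow> spencer_vanishes g i j" and d: "1 \<le> functional_dim g"
  obtains l C where "functional_dim g \<le> Suc l" "\<forall>i\<le>l. irreducible_closed (C i) \<and> C i \<subseteq> char_variety g" "\<forall>i<l. C i \<subset> C (Suc i)"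
proof -
  obtain W :: "(real^'n) set" where W: "subspace W" "finite_over (op_ideal g) W" "\<And>k F. swpoly W k F \<Longrightarrow> F \<in> op_ideal g \<Longrightarrow> F = 0"
    using noether_normalization[of "op_ideal g"] op_ideal_mult[OF sys] op_ideal_zero op_ideal_add one_notin_op_ideal[OF sys] by metis
  have dW: "functional_dim g \<le> dim W" by (rule functional_dim_le[OF sys van W(1,2)])
  obtain E where E: "\<And>k F. k \<ge> E \<Longrightarrow> hom_poly k F \<Longrightarrow> qideal (op_ideal g) W k F"
    using finite_over_degree[OF W(2) op_ideal_mult[OF sys] op_ideal_zero] by blast
  obtain B where B: "B \<subseteq> W" "pairwise orthogonal B" "\<And>x. x \<in> B \<Longrightarrow> norm x = 1" "independent B" "card B = dim W" "span B = W"
    using orthonormal_basis_subspace[OF W(1)] by metis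
  have finB: "finite B" using B(4) by (rule finiteI_independent)
  obtain b where b: "bij_betw b {0..<card B} B" using ex_bij_betw_nat_finite[OF finB] by blast
  have bB: "b i \<in> B" if "i < dim W" for i using bij_betwE[OF b] that B(5) by simp
  have "b i \<bullet> b j = (if i = j then 1 else 0)" if ij: "i < dim W" "j < dim W" for i j
  proof (cases "i = j")
    case True
    then show ?thesis using B(3)[OF bB[OF ij(1)]] by (simp add: norm_eq_1)
  next
    case False
    then have "b i \<noteq> b j" using bij_betw_imp_inj_on[OF b] ij B(5) by (auto simp: inj_on_def)
    then show ?thesis using B(2) bB[OF ij(1)] bB[OF ij(2)] False by (simp add: pairwise_def orthogonal_def)
  qed
  then interpret normalized_system g W E b "dim W"
    by unfold_locales (use sys E W(3) bB B(1) in auto)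
  have "1 \<le> dim W" using d dW by simp
  then obtain C where "\<forall>i\<le>dim W - 1. irreducible_closed (C i) \<and> C i \<subseteq> char_variety g" "\<forall>i<dim W - 1. C i \<subset> C (Suc i)"
    by (rule char_variety_chain)
  then show ?thesis using that[of "dim W - 1" C] dW by simp
qed

text \<open>A chain has at most \<open>functional_dim g\<close> members and one chain attains this;
  since \<open>l\<close> counts inclusions, the dimension is one less.\<close>

lemma proj_dim_char_variety:
  fixes g :: "nat \<Rightarrow> (real^'n \<Rightarrow> real^'m) set"
  assumes sys: "symbolic_system g" and van: "\<And>i j. i \<ge> 1 \<Longrightarrow> spencer_vanishes g i j"
  shows "proj_dim (char_variety g) = int (functional_dim g) - 1"
proof (cases "functional_dim g = 0")
  case True
  then show ?thesis using char_variety_empty[OF sys van] by (simp add: proj_dim_def)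
next
  case False
  let ?S = "{l. \<exists>C. (\<forall>i\<le>l. irreducible_closed (C i) \<and> C i \<subseteq> char_variety g) \<and> (\<forall>i<l. C i \<subset> C (Suc i))}"
  have ub: "l < functional_dim g" if "l \<in> ?S" for l
    using that char_variety_chain_length[OF sys van] by blast
  obtain l C where l: "functional_dim g \<le> Suc l" "\<forall>i\<le>l. irreducible_closed (C i) \<and> C i \<subseteq> char_variety g" "\<forall>i<l. C i \<subset> C (Suc i)"
    using long_chain_exists[OF sys van] False by (metis One_nat_def Suc_leI neq0_conv)
  have lS: "l \<in> ?S" using l by blast
  have d: "Suc l = functional_dim g" using ub[OF lS] l(1) by linarith
  moreover have "Sup ?S = l"
  proof (rule cSup_eq_maximum[OF lS])
    fix k assume "k \<in> ?S"
    then show "k \<le> l" using ub[of k] d by simp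
  qed
  moreover have "char_variety g \<noteq> {}" using l(2) unfolding irreducible_closed_def by blast
  ultimately show ?thesis by (simp add: proj_dim_def)
qed

theorem theorem3:
  fixes g :: "nat \<Rightarrow> (real^'n \<Rightarrow> real^'m) set"
    and p :: nat
  assumes "symbolic_system g"
    and "pure_first_order g"
    and "involutive g"
    and "proj_codim (char_variety g) = int CARD('n) - int p"
  shows "functional_rank g =
    (\<Sum>i\<le>CARD('n). (-1) ^ i * real (spencer_dim g 0 i) *
      ((- real i) ^ (CARD('n) - p) / fact (CARD('n) - p)))"
proof -
  note van = involutive_pure_first_order_vanishes[OF assms(1-3)]
  \<comment> \<open>The codimension is (n - 1) - (functional dimension - 1), so the hypothesis
    identifies \<open>p\<close>.\<close>
  have "p = functional_dim g"
    using assms(4) proj_dim_char_variety[OF assms(1) van] unfolding proj_codim_def by simp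
  then show ?thesis
    using functional_rank_eq_moment(2)[OF assms(1) van]
    by (simp add: spencer_moment_def sum_divide_distrib)
qed

end
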